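(* There exists a constant $C$ independent of $h$ and $z$ such that for all $0<h<1$ and all $z\in\Omega_h$, $$\|\nabla \widetilde{G}^z\|_{L^1(\Omega_h)}\le C.$$
   Context: Let $\Omega\subset\mathbb{R}^3$ be a convex bounded domain with sufficiently smooth boundary. Let $\{\mathcal{T}_h\}_{0<h<1}$ be a quasi-uniform, shape-regular family of triangulations (by tetrahedra) of size $h$ of polyhedral computational domains $\Omega_h\subset\Omega$, and let $V_h(\Omega_h)$ be the space of continuous functions on $\Omega_h$ that are affine on each tetrahedron of $\mathcal{T}_h$. For $z\in\Omega_h$, let $\tilde\delta^z\ge 0$ be a regularized delta function: a function supported in an element $\tau_0\in\mathcal{T}_h$ containing $z$ with $\int_{\tau_0}\tilde\delta^z v_h\,dx=v_h(z)$ for all $v_h\in V_h(\Omega_h)$ (in particular $\int_{\tau_0}\tilde\delta^z\,dx=1$), and satisfying, with a constant $C$ independent of $z$ and $h$, $\|\tilde\delta^z\|_{W^s_p(\tau_0)}\le C h^{-s-3(1-1/p)}$ for $1\le p\le\infty$, $s=0,1$. The regularized Green's function $\widetilde{G}^z$ is the solution of $-\Delta\widetilde{G}^z=\tilde\delta^z$ in $\Omega$, $\widetilde{G}^z=0$ on $\partial\Omega$. *)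

theory Defs
  imports "HOL-Analysis.Analysis" "HOL-Probability.Essential_Supremum"
begin

section \<open>Smooth functions and smooth domains\<close>

fun C_k_on :: "nat \<Rightarrow> 'a::euclidean_space set \<Rightarrow> ('a \<Rightarrow> real) \<Rightarrow> bool" where
  "C_k_on 0 U f \<longleftrightarrow> continuous_on U f"
| "C_k_on (Suc k) U f \<longleftrightarrow>
     (\<forall>x\<in>U. f differentiable (at x)) \<and>
     (\<forall>v. C_k_on k U (\<lambda>x. frechet_derivative f (at x) v))"

text \<open>Local defining functions: near each boundary point the set is the negativity set of a
  \<open>C\<^sup>k\<close> function without critical points.\<close>

definition C_k_boundary :: "nat \<Rightarrow> 'a::euclidean_space set \<Rightarrow> bool" where
  "C_k_boundary k \<Omega> \<longleftrightarrow>
     (\<forall>x0\<in>frontier \<Omega>. \<exists>U \<rho>. open U \<and> x0 \<in> U \<and> C_k_on k U \<rho> \<and>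
        (\<forall>x\<in>U. frechet_derivative \<rho> (at x) \<noteq> (\<lambda>_. 0)) \<and>
        \<Omega> \<inter> U = {x \<in> U. \<rho> x < 0})"

definition test_functions :: "'a::euclidean_space set \<Rightarrow> ('a \<Rightarrow> real) set" where
  "test_functions U = {\<phi>. (\<forall>k. C_k_on k UNIV \<phi>) \<and>
     compact (closure {x. \<phi> x \<noteq> 0}) \<and> closure {x. \<phi> x \<noteq> 0} \<subseteq> U}"


section \<open>Lebesgue and Sobolev norms\<close>

text \<open>\<open>x\<^sup>a\<close> for an exponent \<open>a > 0\<close>, extended by \<open>\<infinity>\<^sup>a = \<infinity>\<close>.\<close>

definition epowr :: "ennreal \<Rightarrow> real \<Rightarrow> ennreal" where
  "epowr x a = (if x = \<infinity> then \<infinity> else ennreal (enn2real x powr a))"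

definition Lp_norm ::
  "ennreal \<Rightarrow> 'a::euclidean_space set \<Rightarrow> ('a \<Rightarrow> 'b::real_normed_vector) \<Rightarrow> ennreal" where
  "Lp_norm p S f =
     (if f \<notin> borel_measurable (lebesgue_on S) then \<infinity>
      else if p = \<infinity> then esssup (lebesgue_on S) (\<lambda>x. ennreal (norm (f x)))
      else epowr (\<integral>\<^sup>+x. ennreal (norm (f x) powr enn2real p) \<partial>lebesgue_on S) (1 / enn2real p))"

definition locally_integrable_on :: "('a::euclidean_space \<Rightarrow> real) \<Rightarrow> 'a set \<Rightarrow> bool"
    (infix \<open>locally'_integrable'_on\<close> 46) where
  "f locally_integrable_on U \<longleftrightarrow>
     (\<forall>K. compact K \<and> K \<subseteq> U \<longrightarrow> set_integrable lebesgue K f)"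

definition has_weak_pderiv ::
  "'a::euclidean_space set \<Rightarrow> 'a \<Rightarrow> ('a \<Rightarrow> real) \<Rightarrow> ('a \<Rightarrow> real) \<Rightarrow> bool" where
  "has_weak_pderiv U b u g \<longleftrightarrow>
     u locally_integrable_on U \<and> g locally_integrable_on U \<and>
     (\<forall>\<phi>\<in>test_functions U.
        (LINT x:U|lebesgue. u x * frechet_derivative \<phi> (at x) b) =
        - (LINT x:U|lebesgue. g x * \<phi> x))"

text \<open>Weak derivatives are unique only up to null sets; \<open>weak_pderiv\<close> and \<open>weak_grad\<close> pick
  a representative, and are meaningful only where the weak derivatives exist.\<close>

definition weak_pderiv ::
  "'a::euclidean_space set \<Rightarrow> 'a \<Rightarrow> ('a \<Rightarrow> real) \<Rightarrow> 'a \<Rightarrow> real" where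
  "weak_pderiv U b u = (SOME g. has_weak_pderiv U b u g)"

definition weak_grad :: "'a::euclidean_space set \<Rightarrow> ('a \<Rightarrow> real) \<Rightarrow> 'a \<Rightarrow> 'a" where
  "weak_grad U u x = (\<Sum>b\<in>Basis. weak_pderiv U b u x *\<^sub>R b)"

text \<open>The norm of \<open>W\<^sup>1\<^sub>p(U)\<close>, with value \<open>\<infinity>\<close> for functions outside that space.\<close>

definition W1p_norm :: "ennreal \<Rightarrow> 'a::euclidean_space set \<Rightarrow> ('a \<Rightarrow> real) \<Rightarrow> ennreal" where
  "W1p_norm p U u =
     (if \<exists>b\<in>Basis. \<nexists>g. has_weak_pderiv U b u g then \<infinity>
      else if p = \<infinity> then
        max (Lp_norm \<infinity> U u) (SUP b\<in>Basis. Lp_norm \<infinity> U (weak_pderiv U b u))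
      else
        epowr (epowr (Lp_norm p U u) (enn2real p) +
               (\<Sum>b\<in>Basis. epowr (Lp_norm p U (weak_pderiv U b u)) (enn2real p)))
              (1 / enn2real p))"

definition H1_0 :: "'a::euclidean_space set \<Rightarrow> ('a \<Rightarrow> real) set" where
  "H1_0 U = {u. W1p_norm 2 U u < \<infinity> \<and>
     (\<exists>\<phi>. (\<forall>n::nat. \<phi> n \<in> test_functions U) \<and>
          (\<lambda>n. W1p_norm 2 U (\<lambda>x. u x - \<phi> n x)) \<longlonglongrightarrow> 0)}"

text \<open>Since \<open>f\<close> will in general be discontinuous, \<open>-\<Delta>u = f\<close> in \<open>\<Omega>\<close>, \<open>u = 0\<close> on \<open>\<partial>\<Omega>\<close> is
  understood in the weak sense.\<close>

definition solves_dirichlet_poisson ::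
  "'a::euclidean_space set \<Rightarrow> ('a \<Rightarrow> real) \<Rightarrow> ('a \<Rightarrow> real) \<Rightarrow> bool" where
  "solves_dirichlet_poisson \<Omega> f u \<longleftrightarrow>
     u \<in> H1_0 \<Omega> \<and>
     (\<forall>v\<in>H1_0 \<Omega>.
        (LINT x:\<Omega>|lebesgue. weak_grad \<Omega> u x \<bullet> weak_grad \<Omega> v x) =
        (LINT x:\<Omega>|lebesgue. f x * v x))"


section \<open>Families of triangulations\<close>

text \<open>Elements are closed tetrahedra. The computational domain is the open set they fill, so
  that vertices of the mesh may lie on the boundary of \<open>\<Omega>\<close>.\<close>

definition mesh_domain :: "(real^3) set set \<Rightarrow> (real^3) set" where
  "mesh_domain \<T> = interior (\<Union>\<T>)"

definition tetrahedral_mesh :: "(real^3) set set \<Rightarrow> bool" where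
  "tetrahedral_mesh \<T> \<longleftrightarrow>
     \<T> \<noteq> {} \<and> triangulation \<T> \<and> (\<forall>\<tau>\<in>\<T>. 3 simplex \<tau>) \<and> connected (mesh_domain \<T>)"

definition inball_diameter :: "(real^3) set \<Rightarrow> real" where
  "inball_diameter \<tau> = Sup {2 * r |r x. 0 \<le> r \<and> cball x r \<subseteq> \<tau>}"

definition shape_regular :: "(real \<Rightarrow> (real^3) set set) \<Rightarrow> bool" where
  "shape_regular \<T> \<longleftrightarrow>
     (\<exists>\<sigma>>0. \<forall>h\<in>{0<..<1}. \<forall>\<tau>\<in>\<T> h. diameter \<tau> \<le> \<sigma> * inball_diameter \<tau>)"

text \<open>This also expresses that \<open>\<T> h\<close> has size \<open>h\<close>, up to fixed factors.\<close>

definition quasi_uniform :: "(real \<Rightarrow> (real^3) set set) \<Rightarrow> bool" where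
  "quasi_uniform \<T> \<longleftrightarrow>
     (\<exists>c>0. \<exists>C>0. \<forall>h\<in>{0<..<1}. \<forall>\<tau>\<in>\<T> h. c * h \<le> diameter \<tau> \<and> diameter \<tau> \<le> C * h)"

definition P1_space :: "(real^3) set set \<Rightarrow> (real^3 \<Rightarrow> real) set" where
  "P1_space \<T> = {v. continuous_on (mesh_domain \<T>) v \<and>
     (\<forall>\<tau>\<in>\<T>. \<exists>a b. \<forall>x\<in>\<tau>. v x = a \<bullet> x + b)}"


section \<open>Regularized delta functions\<close>

text \<open>The exponents are \<open>-s - 3(1 - 1/p)\<close> for \<open>s = 0, 1\<close>, where \<open>1/\<infinity> = 0\<close>.

  Nonnegativity of \<open>\<delta>\<close> is deliberately not required. A nonnegative \<open>\<delta>\<close> reproducing affine functions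
  is a probability density on \<open>\<tau>0\<close> with barycentre \<open>z\<close>; as \<open>z\<close> approaches a face of \<open>\<tau>0\<close> its mass
  concentrates near that face, which the bound \<open>C h\<^sup>-\<^sup>3\<close> for \<open>p = \<infinity>\<close> excludes. No family of
  nonnegative \<open>\<delta>\<close> can therefore satisfy the remaining conditions for all \<open>z\<close> with one \<open>C\<close>.\<close>

definition regularized_delta ::
  "real \<Rightarrow> (real^3) set set \<Rightarrow> real \<Rightarrow> real^3 \<Rightarrow> (real^3 \<Rightarrow> real) \<Rightarrow> bool" where
  "regularized_delta C \<T> h z \<delta> \<longleftrightarrow>
     (\<exists>\<tau>0\<in>\<T>. z \<in> \<tau>0 \<and>
        (\<forall>x. x \<notin> \<tau>0 \<longrightarrow> \<delta> x = 0) \<and>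
        (\<forall>v\<in>P1_space \<T>. (LINT x:\<tau>0|lebesgue. \<delta> x * v x) = v z) \<and>
        (\<forall>p\<ge>1. Lp_norm p \<tau>0 \<delta> \<le> ennreal (C * h powr (- 3 * (1 - enn2real (1 / p))))) \<and>
        (\<forall>p\<ge>1. W1p_norm p (interior \<tau>0) \<delta> \<le>
                 ennreal (C * h powr (- 1 - 3 * (1 - enn2real (1 / p))))))"

end

theory Submission
  imports Defs
begin

text \<open>Away from \<open>z\<close> the gradient of the Green's function decays like \<open>|x - z|\<^sup>-\<^sup>2\<close>. In dimension three
this is integrable, but its square is not, so the energy of \<open>G\<close> blows up as \<open>h\<close> tends to \<open>0\<close> and
a weight has to compensate the growth near \<open>z\<close>. Let \<open>\<omega>(x) = |x - z|\<^sup>2 + h\<^sup>2\<close>. The pointwise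
inequality \<open>2 a \<le> \<omega> a\<^sup>2 + 1 / \<omega>\<close> with \<open>a = |\<nabla>G|\<close> reduces the claim to bounds for the integrals of
\<open>\<omega> |\<nabla>G|\<^sup>2\<close> and of \<open>1 / \<omega>\<close>, uniform in \<open>h\<close> and \<open>z\<close>. The second one is at most the integral of
\<open>|x - z|\<^sup>-\<^sup>2\<close> over a ball that contains \<open>\<Omega>\<close>.

For the first one, testing \<open>-\<Delta>G = \<delta>\<close> with \<open>\<omega> G\<close> gives, because \<open>\<Delta>\<omega> = 6\<close>,
\<open>\<integral> \<omega> |\<nabla>G|\<^sup>2 = 3 \<integral> G\<^sup>2 + \<integral> \<delta> \<omega> G\<close> (\<open>weighted_energy_identity\<close>, \<open>weighted_gradient_estimate\<close>). The right
side is controlled by the pointwise bound \<open>|G| \<le> W\<close>, where \<open>W = K \<omega>\<^sup>-\<^sup>1\<^sup>/\<^sup>2\<close> is a multiple of a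
regularized fundamental solution: then \<open>G\<^sup>2 \<le> K\<^sup>2 / \<omega>\<close>, and \<open>|\<delta> \<omega> G|\<close> is at most a constant times
\<open>1 / \<omega>\<close> as well. The bound \<open>|G| \<le> W\<close> is a comparison principle (\<open>comparison_abs\<close>): \<open>W\<close> is positive, and
\<open>-\<Delta>W = 3 K h\<^sup>2 \<omega>\<^sup>-\<^sup>5\<^sup>/\<^sup>2\<close> (\<open>laplacian_barrier\<close>) is positive everywhere and of size \<open>K h\<^sup>-\<^sup>3\<close> on the element
that supports \<open>\<delta>\<close>, since that element contains \<open>z\<close> and has diameter of order \<open>h\<close>. As
\<open>|\<delta>| \<le> C h\<^sup>-\<^sup>3\<close>, a constant \<open>K\<close> independent of \<open>h\<close> and \<open>z\<close> makes \<open>W\<close> a supersolution for both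
\<open>\<delta>\<close> and \<open>-\<delta>\<close> (\<open>gradient_L1_bound\<close>).

The solution is only a weak one. It is the limit in \<open>H\<^sup>1\<close> of test functions \<open>\<phi>\<^sub>n\<close>, and every
argument is carried out on the \<open>\<phi>\<^sub>n\<close> with classical derivatives: \<open>\<phi>\<^sub>n\<close> satisfies the
equation up to a residual that vanishes in the limit when it is tested with a sequence bounded in
\<open>H\<^sup>1\<close> (\<open>residual_tendsto_0\<close>). The test functions used are \<open>\<omega> \<phi>\<^sub>n\<close> and \<open>s(\<phi>\<^sub>n - W)\<close>, where the smooth
function \<open>s(t) = exp(-1/t)\<close> for \<open>t > 0\<close>, \<open>s(t) = 0\<close> otherwise, replaces the positive part of the
usual comparison argument. The chosen weak gradient of a test function is known only through its
integrals against test functions; the fundamental lemma of the calculus of variations identifies it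
with the classical gradient almost everywhere (\<open>weak_grad_smooth\<close>).\<close>

section \<open>Calculus of smooth functions\<close>

lemma C_k_on_cong:
  assumes "open U" "\<And>x. x \<in> U \<Longrightarrow> f x = g x" "C_k_on k U f"
  shows "C_k_on k U g"
  using assms(2,3)
proof (induction k arbitrary: f g)
  case 0
  then show ?case using continuous_on_cong by force
next
  case (Suc k)
  have d: "f differentiable (at x)" if "x \<in> U" for x using Suc.prems that by simp
  have "g differentiable (at x)" if "x \<in> U" for x
    using d[OF that] Suc.prems(1) assms(1) that
    by (metis differentiable_def has_derivative_transform_within_open)
  moreover have "frechet_derivative f (at x) = frechet_derivative g (at x)" if "x \<in> U" for x
    using d[OF that] Suc.prems(1) assms(1) that
    by (intro frechet_derivative_transform_within_open)
  then have "C_k_on k U (\<lambda>x. frechet_derivative g (at x) v)" for v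
    using Suc.IH[of "\<lambda>x. frechet_derivative f (at x) v" "\<lambda>x. frechet_derivative g (at x) v"] Suc.prems(2)
    by simp
  ultimately show ?case by simp
qed

lemma C_k_on_mono:
  assumes "C_k_on (Suc k) U f"
  shows "C_k_on k U f"
  using assms
proof (induction k arbitrary: f)
  case 0
  then show ?case
    by (simp add: continuous_at_imp_continuous_on differentiable_imp_continuous_within)
next
  case (Suc k)
  then show ?case by (metis C_k_on.simps(2))
qed

text \<open>Any formula \<open>f'\<close> for the derivative can replace the total \<open>frechet_derivative\<close>; openness of \<open>U\<close>
matters because the formula is known on \<open>U\<close> only.\<close>

lemma C_k_on_SucI:
  assumes "open U" "\<And>x. x \<in> U \<Longrightarrow> (f has_derivative f' x) (at x)"
    and "\<And>v. C_k_on k U (\<lambda>x. f' x v)"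
  shows "C_k_on (Suc k) U f"
proof -
  have "frechet_derivative f (at x) = f' x" if "x \<in> U" for x
    using assms(2)[OF that] by (metis frechet_derivative_at)
  then have "C_k_on k U (\<lambda>x. frechet_derivative f (at x) v)" for v
    using C_k_on_cong[OF assms(1) _ assms(3)] by simp
  then show ?thesis using assms(2) by (auto simp: differentiable_def)
qed

lemma C_k_on_SucD:
  assumes "C_k_on (Suc k) U f" "x \<in> U"
  shows "(f has_derivative frechet_derivative f (at x)) (at x)"
  using assms by (simp add: frechet_derivative_works)

lemma C_k_on_const: "open U \<Longrightarrow> C_k_on k U (\<lambda>_. c)"
proof (induction k arbitrary: c)
  case (Suc k)
  show ?case by (rule C_k_on_SucI[where f' = "\<lambda>_ _. 0"]) (use Suc in auto)
qed auto

lemma C_k_on_add: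
  assumes "open U" "C_k_on k U f" "C_k_on k U g"
  shows "C_k_on k U (\<lambda>x. f x + g x)"
  using assms(2,3)
proof (induction k arbitrary: f g)
  case (Suc k)
  show ?case
    by (rule C_k_on_SucI[OF assms(1) has_derivative_add[OF Suc.prems[THEN C_k_on_SucD]]])
       (use Suc in auto)
qed (simp add: continuous_on_add)

lemma C_k_on_mult:
  assumes "open U" "C_k_on k U f" "C_k_on k U g"
  shows "C_k_on k U (\<lambda>x. f x * g x)"
  using assms(2,3)
proof (induction k arbitrary: f g)
  case (Suc k)
  have "C_k_on k U f" "C_k_on k U g"
    using Suc.prems by (auto intro: C_k_on_mono simp del: C_k_on.simps)
  then show ?case
    by (intro C_k_on_SucI[OF assms(1) has_derivative_mult[OF Suc.prems[THEN C_k_on_SucD]]]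
          C_k_on_add[OF assms(1)] Suc.IH)
       (use Suc.prems in simp_all)
qed (simp add: continuous_on_mult)

lemma C_k_on_inner: "open U \<Longrightarrow> C_k_on k U (\<lambda>x. x \<bullet> b)"
proof (induction k)
  case (Suc k)
  show ?case
    by (rule C_k_on_SucI[where f' = "\<lambda>_ v. v \<bullet> b"])
       (use Suc in \<open>auto intro!: C_k_on_const derivative_eq_intros\<close>)
qed (simp add: continuous_on_inner continuous_on_id continuous_on_const)

lemma C_k_on_sum:
  assumes "open U" "finite I" "\<And>i. i \<in> I \<Longrightarrow> C_k_on k U (f i)"
  shows "C_k_on k U (\<lambda>x. \<Sum>i\<in>I. f i x)"
  using assms(2,3)
  by (induction I rule: finite_induct) (simp_all add: C_k_on_const C_k_on_add assms(1))

lemma C_k_on_prod: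
  assumes "open U" "finite I" "\<And>i. i \<in> I \<Longrightarrow> C_k_on k U (f i)"
  shows "C_k_on k U (\<lambda>x. \<Prod>i\<in>I. f i x)"
  using assms(2,3)
  by (induction I rule: finite_induct) (simp_all add: C_k_on_const C_k_on_mult assms(1))

text \<open>The derivative of \<open>f \<circ> q\<close> is a multiple of \<open>f' \<circ> q\<close>, so the induction on \<open>k\<close> has to range over
all outer functions.\<close>

lemma C_k_on_comp:
  fixes f :: "real \<Rightarrow> real"
  assumes "open U" "C_k_on k V f" "C_k_on k U q" "q ` U \<subseteq> V"
  shows "C_k_on k U (\<lambda>x. f (q x))"
  using assms(2,3)
proof (induction k arbitrary: f)
  case 0
  then show ?case using assms(4) by (auto intro: continuous_on_compose2)
next
  case (Suc k)
  let ?D = "\<lambda>x. frechet_derivative f (at x)"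
  have lin: "?D y t = t * ?D y 1" if "y \<in> V" for y t
    using linear_frechet_derivative[of f "at y"] Suc.prems(1) that linear_cmul[of "?D y" t 1]
    by simp
  show ?case
  proof (rule C_k_on_SucI[OF assms(1)])
    fix x assume x: "x \<in> U"
    then have y: "q x \<in> V" using assms(4) by auto
    have "(\<lambda>v. ?D (q x) (frechet_derivative q (at x) v)) = (\<lambda>v. frechet_derivative q (at x) v * ?D (q x) 1)"
      using lin[OF y] by blast
    with has_derivative_compose[OF C_k_on_SucD[OF Suc.prems(2) x] C_k_on_SucD[OF Suc.prems(1) y]]
    show "((\<lambda>x. f (q x)) has_derivative
        (\<lambda>v. frechet_derivative q (at x) v * ?D (q x) 1)) (at x)"
      by (simp only:)
  next
    fix v
    show "C_k_on k U (\<lambda>x. frechet_derivative q (at x) v * ?D (q x) 1)"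
    proof (rule C_k_on_mult[OF assms(1)])
      show "C_k_on k U (\<lambda>x. frechet_derivative q (at x) v)"
        using Suc.prems(2) by simp
      have "C_k_on k V (\<lambda>y. ?D y 1)"
        using Suc.prems(1) by simp
      then show "C_k_on k U (\<lambda>x. ?D (q x) 1)"
        by (rule Suc.IH) (rule C_k_on_mono[OF Suc.prems(2)])
    qed
  qed
qed

lemma C_k_on_real_SucI:
  fixes f :: "real \<Rightarrow> real"
  assumes "open U" "\<And>x. x \<in> U \<Longrightarrow> (f has_real_derivative f' x) (at x)" "C_k_on k U f'"
  shows "C_k_on (Suc k) U f"
proof (rule C_k_on_SucI[OF assms(1)])
  show "(f has_derivative (\<lambda>t. f' x * t)) (at x)" if "x \<in> U" for x
    using assms(2)[OF that] by (simp add: has_field_derivative_def)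
  show "C_k_on k U (\<lambda>x. f' x * t)" for t
    by (intro C_k_on_mult C_k_on_const assms)
qed

lemma C_k_on_powr: "C_k_on k {0<..} (\<lambda>t::real. t powr a)"
proof (induction k arbitrary: a)
  case 0
  have "continuous_on {0<..} (\<lambda>t::real. t powr a)"
    by (rule continuous_on_powr) auto
  then show ?case by simp
next
  case (Suc k)
  show ?case
  proof (rule C_k_on_real_SucI)
    show "((\<lambda>t. t powr a) has_real_derivative a * t powr (a - 1)) (at t)" if "t \<in> {0<..}" for t :: real
      using that has_real_derivative_powr[of t a] by simp
    show "C_k_on k {0<..} (\<lambda>t::real. a * t powr (a - 1))"
      by (intro C_k_on_mult C_k_on_const Suc open_greaterThan)
  qed simp
qed

text \<open>The case \<open>m = 0\<close> is the classical smooth function that is flat at the origin. The other members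
of the family are what its derivatives are made of: each derivative is a linear combination of
members with larger \<open>m\<close>, which makes smoothness an induction over the whole family.\<close>

definition exp_bump :: "nat \<Rightarrow> real \<Rightarrow> real" where
  "exp_bump m t = (if t > 0 then exp (- (1 / t)) / t ^ m else 0)"

lemma exp_bump_tendsto_0: "(exp_bump m \<longlongrightarrow> 0) (at_right 0)"
proof -
  have "((\<lambda>t::real. exp (- (1 / t)) / t ^ m) \<longlongrightarrow> 0) (at_right 0)"
  proof -
    have "((\<lambda>y::real. y ^ m / exp y) \<longlongrightarrow> 0) at_top"
      by (rule tendsto_power_div_exp_0)
    from filterlim_compose[OF this filterlim_inverse_at_top_right]
    show ?thesis by (simp add: exp_minus field_simps)
  qed
  then show ?thesis
    by (rule Lim_transform_eventually)
       (auto simp: eventually_at_right_field exp_bump_def intro!: exI[of _ 1])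
qed

lemma exp_bump_has_derivative:
  "(exp_bump m has_real_derivative (exp_bump (m + 2) t - real m * exp_bump (m + 1) t)) (at t)"
proof -
  consider "t > 0" | "t < 0" | "t = 0" by linarith
  then show ?thesis
  proof cases
    case 1
    have "((\<lambda>t. exp (- (1 / t)) / t ^ m) has_real_derivative
        (exp_bump (m + 2) t - real m * exp_bump (m + 1) t)) (at t)"
      using 1 by (auto intro!: derivative_eq_intros simp: exp_bump_def field_simps power2_eq_square)
        (cases m; simp add: field_simps)
    then show ?thesis
      by (rule has_field_derivative_transform_within_open[where S = "{0<..}"])
        (use 1 in \<open>auto simp: exp_bump_def\<close>)
  next
    case 2
    have "((\<lambda>t. 0) has_real_derivative (exp_bump (m + 2) t - real m * exp_bump (m + 1) t)) (at t)"
      using 2 by (simp add: exp_bump_def)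
    then show ?thesis
      by (rule has_field_derivative_transform_within_open[where S = "{..<0}"])
        (use 2 in \<open>auto simp: exp_bump_def\<close>)
  next
    case 3
    \<comment> \<open>For \<open>y > 0\<close> the difference quotient at the origin is the next member of the family.\<close>
    have "((\<lambda>y. exp_bump m y / y) \<longlongrightarrow> 0) (at_right 0)"
      using exp_bump_tendsto_0[of "Suc m"]
      by (rule Lim_transform_eventually)
         (auto simp: eventually_at_right_field exp_bump_def intro!: exI[of _ 1])
    moreover have "((\<lambda>y. exp_bump m y / y) \<longlongrightarrow> 0) (at_left 0)"
      by (rule tendsto_eventually) (auto simp: eventually_at_left_field exp_bump_def intro!: exI[of _ "-1"])
    ultimately show ?thesis
      using 3 by (simp add: has_field_derivative_iff filterlim_split_at exp_bump_def)
  qed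
qed

lemma C_k_on_exp_bump: "C_k_on k UNIV (exp_bump m)"
proof (induction k arbitrary: m)
  case 0
  show ?case using exp_bump_has_derivative
    by (auto intro!: continuous_at_imp_continuous_on DERIV_isCont)
next
  case (Suc k)
  show ?case
  proof (rule C_k_on_real_SucI)
    show "(exp_bump m has_real_derivative exp_bump (m + 2) t + (- real m) * exp_bump (m + 1) t) (at t)"
      for t using exp_bump_has_derivative[of m t] by simp
    show "C_k_on k UNIV (\<lambda>t. exp_bump (m + 2) t + (- real m) * exp_bump (m + 1) t)"
      by (intro C_k_on_add C_k_on_mult C_k_on_const Suc open_UNIV)
  qed simp
qed

section \<open>Gradients and test functions\<close>

definition smooth :: "('a::euclidean_space \<Rightarrow> real) \<Rightarrow> bool" where
  "smooth f \<longleftrightarrow> (\<forall>k. C_k_on k UNIV f)"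

definition grad :: "('a::euclidean_space \<Rightarrow> real) \<Rightarrow> 'a \<Rightarrow> 'a" where
  "grad f x = (\<Sum>b\<in>Basis. frechet_derivative f (at x) b *\<^sub>R b)"

lemma grad_eqI:
  assumes "(f has_derivative (\<lambda>v. g \<bullet> v)) (at x)"
  shows "grad f x = g"
proof -
  have "frechet_derivative f (at x) = (\<lambda>v. g \<bullet> v)"
    using frechet_derivative_at[OF assms] by simp
  then show ?thesis by (simp add: grad_def euclidean_representation)
qed

text \<open>Linearity lets the values of the derivative on the basis determine it, so \<open>grad\<close> represents the
whole derivative and no longer refers to coordinates.\<close>

lemma differentiable_has_derivative_grad:
  assumes "f differentiable (at x)"
  shows "(f has_derivative (\<lambda>v. grad f x \<bullet> v)) (at x)"
proof -
  let ?D = "frechet_derivative f (at x)"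
  have lin: "linear ?D" using assms by (rule linear_frechet_derivative)
  have "?D v = grad f x \<bullet> v" for v
  proof -
    have "?D v = ?D (\<Sum>b\<in>Basis. (v \<bullet> b) *\<^sub>R b)" by (simp add: euclidean_representation)
    also have "\<dots> = (\<Sum>b\<in>Basis. (v \<bullet> b) * ?D b)"
      using lin by (simp add: linear_sum linear_cmul)
    also have "\<dots> = grad f x \<bullet> v"
      by (simp add: grad_def inner_sum_right inner_sum_left inner_commute mult.commute)
    finally show ?thesis .
  qed
  then have "?D = (\<lambda>v. grad f x \<bullet> v)" by blast
  with assms show ?thesis by (metis frechet_derivative_works)
qed

lemma smooth_has_derivative_grad: "smooth f \<Longrightarrow> (f has_derivative (\<lambda>v. grad f x \<bullet> v)) (at x)"
  unfolding smooth_def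
  by (metis C_k_on.simps(2) UNIV_I differentiable_has_derivative_grad)

lemma smooth_frechet_derivative:
  "smooth f \<Longrightarrow> frechet_derivative f (at x) v = grad f x \<bullet> v"
  using frechet_derivative_at[OF smooth_has_derivative_grad] by metis

lemma smooth_grad_inner: "smooth f \<Longrightarrow> smooth (\<lambda>x. grad f x \<bullet> v)"
proof -
  assume "smooth f"
  then have "C_k_on (Suc k) UNIV f" for k unfolding smooth_def by blast
  then have "C_k_on k UNIV (\<lambda>x. frechet_derivative f (at x) v)" for k by simp
  then show ?thesis using smooth_frechet_derivative[OF \<open>smooth f\<close>] by (simp add: smooth_def)
qed

lemma smooth_continuous_on: "smooth f \<Longrightarrow> continuous_on S f"
  unfolding smooth_def by (metis C_k_on.simps(1) continuous_on_subset subset_UNIV)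

lemma smooth_continuous_on_grad: "smooth f \<Longrightarrow> continuous_on S (grad f)"
proof -
  assume f: "smooth f"
  have "continuous_on S (\<lambda>x. grad f x \<bullet> b)" for b
    using smooth_continuous_on[OF smooth_grad_inner[OF f]] .
  then show ?thesis using continuous_on_componentwise by blast
qed

lemma smooth_const: "smooth (\<lambda>_. c)"
  by (simp add: smooth_def C_k_on_const)

lemma smooth_inner: "smooth (\<lambda>x. x \<bullet> b)"
  by (simp add: smooth_def C_k_on_inner)

lemma smooth_add: "smooth f \<Longrightarrow> smooth g \<Longrightarrow> smooth (\<lambda>x. f x + g x)"
  by (simp add: smooth_def C_k_on_add)

lemma smooth_mult: "smooth f \<Longrightarrow> smooth g \<Longrightarrow> smooth (\<lambda>x. f x * g x)"
  by (simp add: smooth_def C_k_on_mult)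

lemma smooth_sum: "finite I \<Longrightarrow> (\<And>i. i \<in> I \<Longrightarrow> smooth (f i)) \<Longrightarrow> smooth (\<lambda>x. \<Sum>i\<in>I. f i x)"
  by (simp add: smooth_def C_k_on_sum)

lemma smooth_prod: "finite I \<Longrightarrow> (\<And>i. i \<in> I \<Longrightarrow> smooth (f i)) \<Longrightarrow> smooth (\<lambda>x. \<Prod>i\<in>I. f i x)"
  by (simp add: smooth_def C_k_on_prod)

lemma smooth_diff: "smooth f \<Longrightarrow> smooth g \<Longrightarrow> smooth (\<lambda>x. f x - g x)"
  using smooth_add[OF _ smooth_mult[OF smooth_const[of "-1"]], of f g] by simp

lemma smooth_uminus: "smooth f \<Longrightarrow> smooth (\<lambda>x. - f x)"
  using smooth_diff[OF smooth_const[of 0]] by simp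

lemma smooth_powr:
  assumes "smooth q" "\<And>x. q x > 0"
  shows "smooth (\<lambda>x. q x powr a)"
  unfolding smooth_def
proof
  fix k show "C_k_on k UNIV (\<lambda>x. q x powr a)"
    by (rule C_k_on_comp[OF open_UNIV C_k_on_powr]) (use assms in \<open>auto simp: smooth_def\<close>)
qed

lemma smooth_exp_bump:
  assumes "smooth q"
  shows "smooth (\<lambda>x. exp_bump m (q x))"
  unfolding smooth_def
proof
  fix k show "C_k_on k UNIV (\<lambda>x. exp_bump m (q x))"
    by (rule C_k_on_comp[OF open_UNIV C_k_on_exp_bump]) (use assms in \<open>auto simp: smooth_def\<close>)
qed

lemma grad_mult:
  assumes "smooth f" "smooth g"
  shows "grad (\<lambda>x. f x * g x) x = f x *\<^sub>R grad g x + g x *\<^sub>R grad f x"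
  by (rule grad_eqI)
     (use has_derivative_mult[OF assms[THEN smooth_has_derivative_grad], of x] in
       \<open>simp add: inner_add_left mult.commute\<close>)

lemma grad_diff:
  assumes "smooth f" "smooth g"
  shows "grad (\<lambda>x. f x - g x) x = grad f x - grad g x"
  by (rule grad_eqI)
     (use has_derivative_diff[OF assms[THEN smooth_has_derivative_grad], of x] in
       \<open>simp add: inner_diff_left\<close>)

lemma grad_uminus: "smooth f \<Longrightarrow> grad (\<lambda>x. - f x) x = - grad f x"
  by (rule grad_eqI)
     (use has_derivative_minus[OF smooth_has_derivative_grad, of f x] in simp)

lemma grad_comp:
  fixes f :: "real \<Rightarrow> real"
  assumes "smooth q" "(f has_real_derivative f') (at (q x))"
  shows "grad (\<lambda>x. f (q x)) x = f' *\<^sub>R grad q x"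
  by (rule grad_eqI)
     (use has_derivative_compose[OF smooth_has_derivative_grad[OF assms(1)], of f "\<lambda>t. f' * t" x] assms(2)
       in \<open>simp add: has_field_derivative_def\<close>)

lemma test_functions_iff:
  "\<phi> \<in> test_functions U \<longleftrightarrow>
     smooth \<phi> \<and> compact (closure {x. \<phi> x \<noteq> 0}) \<and> closure {x. \<phi> x \<noteq> 0} \<subseteq> U"
  by (simp add: test_functions_def smooth_def)

lemma test_functions_smooth: "\<phi> \<in> test_functions U \<Longrightarrow> smooth \<phi>"
  by (simp add: test_functions_iff)

lemma zero_off_support: "x \<notin> closure {x. \<phi> x \<noteq> 0} \<Longrightarrow> \<phi> x = 0"
  using subsetD[OF closure_subset, of x "{x. \<phi> x \<noteq> 0}"] by auto

text \<open>Everything built from a test function \<open>\<phi>\<close> that vanishes where \<open>\<phi>\<close> vanishes identically is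
again a test function; this is how all test functions of the later arguments are recognized.\<close>

lemma test_functionsI_support:
  assumes "\<phi> \<in> test_functions U" "smooth \<psi>" "\<And>x. x \<notin> closure {x. \<phi> x \<noteq> 0} \<Longrightarrow> \<psi> x = 0"
  shows "\<psi> \<in> test_functions U"
proof -
  have "closure {x. \<psi> x \<noteq> 0} \<subseteq> closure {x. \<phi> x \<noteq> 0}"
    using assms(3) by (intro closure_minimal) (blast, simp)
  moreover from this have "compact (closure {x. \<psi> x \<noteq> 0})"
    using assms(1) unfolding test_functions_iff by (metis closed_closure compact_Int_closed inf.absorb2)
  ultimately show ?thesis using assms(1,2) by (auto simp: test_functions_iff)
qed

lemma grad_eq_0_off_support:
  assumes "x \<notin> closure {x. \<phi> x \<noteq> 0}"
  shows "grad \<phi> x = 0"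
proof (rule grad_eqI)
  have "((\<lambda>_. 0) has_derivative (\<lambda>v. 0 \<bullet> v)) (at x)" by simp
  then show "(\<phi> has_derivative (\<lambda>v. 0 \<bullet> v)) (at x)"
  proof (rule has_derivative_transform_within_open)
    show "open (- closure {x. \<phi> x \<noteq> 0})" "x \<in> - closure {x. \<phi> x \<noteq> 0}"
      using assms by auto
    show "0 = \<phi> y" if "y \<in> - closure {x. \<phi> x \<noteq> 0}" for y
      using zero_off_support[of y \<phi>] that by simp
  qed
qed

lemma test_functions_zero: "\<phi> \<in> test_functions U \<Longrightarrow> x \<notin> U \<Longrightarrow> \<phi> x = 0"
  using zero_off_support[of x \<phi>] by (auto simp: test_functions_iff)

lemma test_functions_grad_zero: "\<phi> \<in> test_functions U \<Longrightarrow> x \<notin> U \<Longrightarrow> grad \<phi> x = 0"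
  using grad_eq_0_off_support[of x \<phi>] by (auto simp: test_functions_iff)

lemma test_functions_mult:
  assumes "smooth w" "\<phi> \<in> test_functions U"
  shows "(\<lambda>x. w x * \<phi> x) \<in> test_functions U"
  by (rule test_functionsI_support[OF assms(2) smooth_mult[OF assms(1) test_functions_smooth[OF assms(2)]]])
     (drule zero_off_support, simp)

lemma test_functions_uminus: "\<phi> \<in> test_functions U \<Longrightarrow> (\<lambda>x. - \<phi> x) \<in> test_functions U"
  using test_functions_mult[OF smooth_const[of "-1"]] by simp

lemma test_functions_bounded:
  fixes \<phi> :: "'a::euclidean_space \<Rightarrow> real"
  assumes "\<phi> \<in> test_functions U"
  obtains B where "B \<ge> 0" "\<And>x. \<bar>\<phi> x\<bar> \<le> B" "\<And>x. norm (grad \<phi> x) \<le> B"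
proof -
  let ?K = "closure {x. \<phi> x \<noteq> 0}"
  have K: "compact ?K" and s: "smooth \<phi>" using assms by (auto simp: test_functions_iff)
  have "bounded (\<phi> ` ?K)" "bounded (grad \<phi> ` ?K)"
    by (intro compact_imp_bounded compact_continuous_image K smooth_continuous_on[OF s]
        smooth_continuous_on_grad[OF s])+
  then obtain B1 B2 where B: "\<And>x. x \<in> ?K \<Longrightarrow> norm (\<phi> x) \<le> B1" "\<And>x. x \<in> ?K \<Longrightarrow> norm (grad \<phi> x) \<le> B2"
    by (metis bounded_iff imageI)
  show ?thesis
  proof (rule that[of "\<bar>B1\<bar> + \<bar>B2\<bar>"])
    fix x
    show "\<bar>\<phi> x\<bar> \<le> \<bar>B1\<bar> + \<bar>B2\<bar>"
    proof (cases "x \<in> ?K")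
      case False
      then have "\<phi> x = 0" by (rule zero_off_support)
      then show ?thesis by simp
    qed (use B(1)[of x] in auto)
    show "norm (grad \<phi> x) \<le> \<bar>B1\<bar> + \<bar>B2\<bar>"
    proof (cases "x \<in> ?K")
      case False
      then show ?thesis by (simp add: grad_eq_0_off_support)
    qed (use B(2)[of x] in auto)
  qed simp
qed

lemma smooth_lipschitz:
  fixes \<phi> :: "'a::euclidean_space \<Rightarrow> real"
  assumes "smooth \<phi>" "\<And>x. norm (grad \<phi> x) \<le> B"
  shows "\<bar>\<phi> x - \<phi> y\<bar> \<le> B * norm (x - y)"
proof -
  have "norm (\<phi> x - \<phi> y) \<le> B * norm (x - y)"
  proof (rule differentiable_bound[OF convex_UNIV])
    fix u
    show "(\<phi> has_derivative (\<lambda>v. grad \<phi> u \<bullet> v)) (at u within UNIV)"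
      using smooth_has_derivative_grad[OF assms(1)] by simp
    show "onorm (\<lambda>v. grad \<phi> u \<bullet> v) \<le> B"
    proof (rule onorm_le)
      show "norm (grad \<phi> u \<bullet> v) \<le> B * norm v" for v
        using Cauchy_Schwarz_ineq2[of "grad \<phi> u" v] mult_right_mono[OF assms(2)[of u] norm_ge_zero[of v]]
        by simp
    qed
  qed auto
  then show ?thesis by simp
qed

lemma test_functions_integrable:
  assumes "continuous_on UNIV f" "\<phi> \<in> test_functions U" "\<And>x. x \<notin> closure {x. \<phi> x \<noteq> 0} \<Longrightarrow> f x = 0"
  shows "integrable lborel (f :: _ \<Rightarrow> real)"
proof -
  let ?K = "closure {x. \<phi> x \<noteq> 0}"
  have "integrable lborel (\<lambda>x. indicator ?K x *\<^sub>R f x)"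
    using assms(2) continuous_on_subset[OF assms(1) subset_UNIV]
    by (intro borel_integrable_compact) (auto simp: test_functions_iff)
  moreover have "(\<lambda>x. indicator ?K x *\<^sub>R f x) = f"
    using assms(3) by (auto simp: indicator_def fun_eq_iff)
  ultimately show ?thesis by simp
qed

text \<open>The difference quotients of \<open>\<phi>\<close> in direction \<open>b\<close> have integral zero because Lebesgue measure is
translation invariant. They are bounded by the Lipschitz constant and supported in a fixed ball, so
dominated convergence carries this over to the derivative.\<close>

lemma integral_grad_test_function:
  fixes \<phi> :: "'a::euclidean_space \<Rightarrow> real"
  assumes "\<phi> \<in> test_functions U"
  shows "(\<integral>x. grad \<phi> x \<bullet> b \<partial>lborel) = 0"
proof -
  have s: "smooth \<phi>" using assms by (simp add: test_functions_iff)
  have int: "integrable lborel \<phi>"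
    by (rule test_functions_integrable[OF smooth_continuous_on[OF s] assms])
       (rule zero_off_support)
  obtain B where B: "B \<ge> 0" "\<And>x. norm (grad \<phi> x) \<le> B"
    using test_functions_bounded[OF assms] by metis
  have "bounded {x. \<phi> x \<noteq> 0}"
    using assms unfolding test_functions_iff by (meson bounded_subset closure_subset compact_imp_bounded)
  then obtain R where "\<forall>x\<in>{x. \<phi> x \<noteq> 0}. norm x \<le> R"
    unfolding bounded_iff by (rule exE)
  then have R: "norm x \<le> R" if "\<phi> x \<noteq> 0" for x using that by simp
  define t where "t n = inverse (real (Suc n))" for n
  define d where "d n x = (\<phi> (x + t n *\<^sub>R b) - \<phi> x) / t n" for n x
  have t: "t n > 0" "t n \<le> 1" for n by (auto simp: t_def inverse_eq_divide)
  have tl: "t \<longlonglongrightarrow> 0" unfolding t_def by (rule LIMSEQ_inverse_real_of_nat)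
  have shift: "integrable lborel (\<lambda>x. \<phi> (x + c))" "(\<integral>x. \<phi> (x + c) \<partial>lborel) = (\<integral>x. \<phi> x \<partial>lborel)" for c
  proof -
    have m: "(+) c \<in> measurable lborel (borel::'a measure)" by measurable
    have p: "\<phi> \<in> borel_measurable borel" using int by (auto dest: borel_measurable_integrable)
    show "integrable lborel (\<lambda>x. \<phi> (x + c))"
      using integrable_distr_eq[OF m p] int lborel_distr_plus[of c] by (simp add: add.commute)
    show "(\<integral>x. \<phi> (x + c) \<partial>lborel) = (\<integral>x. \<phi> x \<partial>lborel)"
      using integral_distr[OF m p] lborel_distr_plus[of c] by (simp add: add.commute)
  qed
  have d0: "(\<integral>x. d n x \<partial>lborel) = 0" for n
    using shift[of "t n *\<^sub>R b"] int unfolding d_def by simp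
  have "(\<lambda>n. \<integral>x. d n x \<partial>lborel) \<longlonglongrightarrow> (\<integral>x. grad \<phi> x \<bullet> b \<partial>lborel)"
  proof (rule integral_dominated_convergence)
    show "(\<lambda>x. grad \<phi> x \<bullet> b) \<in> borel_measurable lborel"
      using smooth_continuous_on[OF smooth_grad_inner[OF s]] by (simp add: borel_measurable_continuous_onI)
    show "d n \<in> borel_measurable lborel" for n
      using shift(1)[of "t n *\<^sub>R b"] int unfolding d_def by (auto intro!: borel_measurable_integrable)
    show "integrable lborel (\<lambda>x. indicator (cball 0 (R + norm b)) x *\<^sub>R (B * norm b))"
      by (rule borel_integrable_compact) auto
    show "AE x in lborel. (\<lambda>n. d n x) \<longlonglongrightarrow> grad \<phi> x \<bullet> b"
    proof (intro AE_I2)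
      fix x
      have "((\<lambda>s. x + s *\<^sub>R b) has_derivative (\<lambda>s. s *\<^sub>R b)) (at 0)"
        by (auto intro!: derivative_eq_intros)
      moreover have "(\<phi> has_derivative (\<lambda>v. grad \<phi> x \<bullet> v)) (at (x + 0 *\<^sub>R b))"
        using smooth_has_derivative_grad[OF s, of x] by simp
      ultimately have "((\<lambda>s. \<phi> (x + s *\<^sub>R b)) has_derivative (\<lambda>s. grad \<phi> x \<bullet> (s *\<^sub>R b))) (at 0)"
        by (rule has_derivative_compose)
      then have "((\<lambda>s. \<phi> (x + s *\<^sub>R b)) has_real_derivative (grad \<phi> x \<bullet> b)) (at 0)"
        by (simp add: has_field_derivative_def mult_commute_abs)
      then have "((\<lambda>s. (\<phi> (x + s *\<^sub>R b) - \<phi> x) / s) \<longlongrightarrow> grad \<phi> x \<bullet> b) (at 0)"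
        by (simp add: DERIV_def)
      moreover have "filterlim t (at 0) sequentially"
        unfolding filterlim_at using tl t(1) by (simp add: less_imp_neq[symmetric])
      ultimately show "(\<lambda>n. d n x) \<longlonglongrightarrow> grad \<phi> x \<bullet> b"
        unfolding d_def by (rule filterlim_compose)
    qed
    show "AE x in lborel. norm (d n x) \<le> indicator (cball 0 (R + norm b)) x *\<^sub>R (B * norm b)" for n
    proof (intro AE_I2)
      fix x
      have tb: "norm (t n *\<^sub>R b) \<le> norm b" using t[of n] by (simp add: mult_left_le_one_le)
      show "norm (d n x) \<le> indicator (cball 0 (R + norm b)) x *\<^sub>R (B * norm b)"
      proof (cases "x \<in> cball 0 (R + norm b)")
        case True
        have "\<bar>\<phi> (x + t n *\<^sub>R b) - \<phi> x\<bar> \<le> t n * (B * norm b)"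
          using smooth_lipschitz[OF s B(2), of "x + t n *\<^sub>R b" x] t[of n] by (simp add: mult_ac)
        then show ?thesis using True t[of n] by (simp add: d_def field_simps)
      next
        case False
        then have "norm x > R + norm b" by simp
        moreover have "norm (x + t n *\<^sub>R b) \<ge> norm x - norm b"
          using tb norm_diff_ineq[of x "t n *\<^sub>R b"] by linarith
        ultimately have "\<phi> x = 0" "\<phi> (x + t n *\<^sub>R b) = 0"
          using R[of x] R[of "x + t n *\<^sub>R b"] norm_ge_zero[of b] by (smt (verit))+
        then show ?thesis using B(1) by (simp add: d_def)
      qed
    qed
  qed
  then show ?thesis using d0 LIMSEQ_unique[of "\<lambda>n. 0"] by auto
qed

section \<open>Weak derivatives\<close>

lemma set_integral_lebesgue_on:
  "S \<in> sets lebesgue \<Longrightarrow> (LINT x:S|lebesgue. f x) = (\<integral>x. (f x :: real) \<partial>lebesgue_on S)"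
  by (simp add: set_lebesgue_integral_def integral_restrict_space)

lemma set_integrable_lebesgue_on:
  "S \<in> sets lebesgue \<Longrightarrow> set_integrable lebesgue S (f :: 'a::euclidean_space \<Rightarrow> real) \<longleftrightarrow> integrable (lebesgue_on S) f"
  by (simp add: set_integrable_def integrable_restrict_space)

lemma integral_lebesgue_on_eq_lborel:
  fixes f :: "'a::euclidean_space \<Rightarrow> real"
  assumes "S \<in> sets lebesgue" "f \<in> borel_measurable borel" "\<And>x. x \<notin> S \<Longrightarrow> f x = 0"
  shows "(\<integral>x. f x \<partial>lebesgue_on S) = (\<integral>x. f x \<partial>lborel)"
proof -
  have "(\<lambda>x. indicator S x *\<^sub>R f x) = f" using assms(3) by (auto simp: indicator_def fun_eq_iff)
  then show ?thesis using assms by (simp add: integral_restrict_space integral_completion)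
qed

lemma finite_measure_lebesgue_on:
  fixes S :: "'a::euclidean_space set"
  assumes "S \<in> lmeasurable"
  shows "finite_measure (lebesgue_on S)"
  by standard
     (use fmeasurableD2[OF assms] fmeasurableD[OF assms] in
       \<open>simp add: emeasure_restrict_space del: emeasure_completion\<close>)

lemma continuous_measurable_lebesgue_on:
  fixes f :: "'a::euclidean_space \<Rightarrow> 'b::{second_countable_topology, topological_space}"
  shows "S \<in> sets lebesgue \<Longrightarrow> continuous_on UNIV f \<Longrightarrow> f \<in> borel_measurable (lebesgue_on S)"
  by (meson continuous_imp_measurable_on_sets_lebesgue continuous_on_subset subset_UNIV)

lemma continuous_integrable_lebesgue_on:
  fixes f :: "'a::euclidean_space \<Rightarrow> real"
  assumes "bounded S" "S \<in> sets lebesgue" "continuous_on UNIV f"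
  shows "integrable (lebesgue_on S) f"
proof -
  interpret finite_measure "lebesgue_on S" using assms by (intro finite_measure_lebesgue_on bounded_set_imp_lmeasurable)
  have "compact (f ` closure S)"
    using assms by (intro compact_continuous_image continuous_on_subset[OF assms(3)]) auto
  from compact_imp_bounded[OF this] obtain B where B: "\<forall>y\<in>f ` closure S. norm y \<le> B"
    unfolding bounded_iff by (rule exE)
  show ?thesis
  proof (rule integrable_const_bound)
    show "AE x in lebesgue_on S. norm (f x) \<le> B"
      using B closure_subset by (intro AE_I2) (auto simp: space_restrict_space)
    show "f \<in> borel_measurable (lebesgue_on S)"
      using assms by (intro continuous_measurable_lebesgue_on)
  qed
qed

lemma integration_by_parts:
  fixes w :: "'a::euclidean_space \<Rightarrow> real"
  assumes "U \<in> sets lebesgue" "smooth w" "\<phi> \<in> test_functions U"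
  shows "(\<integral>x. w x * (grad \<phi> x \<bullet> b) \<partial>lebesgue_on U) = - (\<integral>x. (grad w x \<bullet> b) * \<phi> x \<partial>lebesgue_on U)"
proof -
  have s: "smooth \<phi>" using assms(3) by (rule test_functions_smooth)
  note smooths = assms(2) s smooth_grad_inner
  have c1: "continuous_on UNIV (\<lambda>x. w x * (grad \<phi> x \<bullet> b))"
    by (intro smooth_continuous_on smooth_mult smooths)
  have c2: "continuous_on UNIV (\<lambda>x. (grad w x \<bullet> b) * \<phi> x)"
    by (intro smooth_continuous_on smooth_mult smooths)
  have i1: "integrable lborel (\<lambda>x. w x * (grad \<phi> x \<bullet> b))"
    using c1 assms(3) by (rule test_functions_integrable) (simp add: grad_eq_0_off_support)
  have i2: "integrable lborel (\<lambda>x. (grad w x \<bullet> b) * \<phi> x)"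
    using c2 assms(3) by (rule test_functions_integrable) (drule zero_off_support, simp)
  have "0 = (\<integral>x. grad (\<lambda>x. w x * \<phi> x) x \<bullet> b \<partial>lborel)"
    using integral_grad_test_function[OF test_functions_mult[OF assms(2,3)]] by simp
  also have "\<dots> = (\<integral>x. w x * (grad \<phi> x \<bullet> b) + (grad w x \<bullet> b) * \<phi> x \<partial>lborel)"
    by (simp only: grad_mult[OF assms(2) s] inner_add_left inner_scaleR_left mult.commute[of "\<phi> _"])
  also have "\<dots> = (\<integral>x. w x * (grad \<phi> x \<bullet> b) \<partial>lborel) + (\<integral>x. (grad w x \<bullet> b) * \<phi> x \<partial>lborel)"
    using i1 i2 by simp
  also have "(\<integral>x. w x * (grad \<phi> x \<bullet> b) \<partial>lborel) = (\<integral>x. w x * (grad \<phi> x \<bullet> b) \<partial>lebesgue_on U)"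
    using assms(1) c1 test_functions_grad_zero[OF assms(3)]
    by (intro integral_lebesgue_on_eq_lborel[symmetric]) (auto intro: borel_measurable_continuous_onI)
  also have "(\<integral>x. (grad w x \<bullet> b) * \<phi> x \<partial>lborel) = (\<integral>x. (grad w x \<bullet> b) * \<phi> x \<partial>lebesgue_on U)"
    using assms(1) c2 test_functions_zero[OF assms(3)]
    by (intro integral_lebesgue_on_eq_lborel[symmetric]) (auto intro: borel_measurable_continuous_onI)
  finally show ?thesis by simp
qed

lemma exp_bump_0_simps: "exp_bump 0 t \<ge> 0" "exp_bump 0 t \<le> 1" "t \<le> 0 \<Longrightarrow> exp_bump 0 t = 0" "t > 0 \<Longrightarrow> exp_bump 0 t > 0"
  by (auto simp: exp_bump_def)

text \<open>Rescaling the argument turns \<open>exp_bump 0\<close> into the indicator of the positive half line, which makes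
indicators of boxes limits of test functions.\<close>

lemma exp_bump_steepening:
  "(\<lambda>n. exp_bump 0 (real (Suc n) * s)) \<longlonglongrightarrow> of_bool (s > 0)"
proof (cases "s > 0")
  case True
  have "(\<lambda>n. inverse (real (Suc n)) * (1 / s)) \<longlonglongrightarrow> 0 * (1 / s)"
    by (intro tendsto_mult LIMSEQ_inverse_real_of_nat tendsto_const)
  then have "(\<lambda>n. exp (- (inverse (real (Suc n)) * (1 / s)))) \<longlonglongrightarrow> exp (- (0 * (1 / s)))"
    by (intro tendsto_exp tendsto_minus)
  moreover have "exp_bump 0 (real (Suc n) * s) = exp (- (inverse (real (Suc n)) * (1 / s)))" for n
    using True by (simp add: exp_bump_def field_simps add_pos_nonneg)
  ultimately show ?thesis using True by simp
next
  case False
  then have "exp_bump 0 (real (Suc n) * s) = 0" for n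
    by (intro exp_bump_0_simps) (simp add: mult_nonneg_nonpos)
  then show ?thesis using False by simp
qed

text \<open>A box is cut out by finitely many inequalities between coordinates; the product of the steepened
bumps of all of them vanishes outside the box and tends to \<open>1\<close> inside.\<close>

lemma test_functions_approximate_box:
  fixes a b :: "'a::euclidean_space"
  assumes "cbox a b \<subseteq> U"
  obtains \<psi> where "\<And>n::nat. \<psi> n \<in> test_functions U" "\<And>n x. \<bar>\<psi> n x\<bar> \<le> 1"
    "\<And>n x. x \<notin> cbox a b \<Longrightarrow> \<psi> n x = 0" "\<And>x. (\<lambda>n. \<psi> n x) \<longlonglongrightarrow> indicator (box a b) x"
proof -
  define e where "e n i x = exp_bump 0 (real (Suc n) * (x \<bullet> i - a \<bullet> i)) * exp_bump 0 (real (Suc n) * (b \<bullet> i - x \<bullet> i))"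
    for n and i x :: 'a
  define \<psi> where "\<psi> n x = (\<Prod>i\<in>Basis. e n i x)" for n x
  have e: "0 \<le> e n i x" "e n i x \<le> 1" for n i x
    by (auto simp: e_def exp_bump_0_simps intro!: mult_le_one)
  have zero: "\<psi> n x = 0" if "x \<notin> cbox a b" for n x
  proof -
    obtain i where i: "i \<in> Basis" "\<not> (a \<bullet> i \<le> x \<bullet> i \<and> x \<bullet> i \<le> b \<bullet> i)"
      using \<open>x \<notin> cbox a b\<close> by (auto simp: mem_box)
    then have "x \<bullet> i - a \<bullet> i \<le> 0 \<or> b \<bullet> i - x \<bullet> i \<le> 0" by auto
    then have "e n i x = 0"
      unfolding e_def by (auto intro!: exp_bump_0_simps mult_nonneg_nonpos)
    then show ?thesis using i by (auto simp: \<psi>_def)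
  qed
  show ?thesis
  proof (rule that)
    fix n
    have "smooth (\<psi> n)"
      unfolding \<psi>_def e_def
      by (intro smooth_prod smooth_mult smooth_exp_bump smooth_diff smooth_const smooth_inner finite_Basis)
    moreover have sub: "closure {x. \<psi> n x \<noteq> 0} \<subseteq> cbox a b"
      using zero by (intro closure_minimal) (blast, rule closed_cbox)
    moreover have "compact (closure {x. \<psi> n x \<noteq> 0})"
      using sub by (metis bounded_cbox bounded_subset compact_eq_bounded_closed closed_closure)
    ultimately show "\<psi> n \<in> test_functions U" using assms by (auto simp: test_functions_iff)
    fix x
    show "\<bar>\<psi> n x\<bar> \<le> 1"
      using e by (simp add: \<psi>_def prod_nonneg prod_le_1)
  next
    show "\<psi> n x = 0" if "x \<notin> cbox a b" for n x using zero[OF that] .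
  next
    fix x
    have "(\<lambda>n. \<psi> n x) \<longlonglongrightarrow> (\<Prod>i\<in>Basis. of_bool (x \<bullet> i - a \<bullet> i > 0) * of_bool (b \<bullet> i - x \<bullet> i > 0))"
      unfolding \<psi>_def e_def by (intro tendsto_prod tendsto_mult exp_bump_steepening)
    also have "(\<Prod>i\<in>Basis. of_bool (x \<bullet> i - a \<bullet> i > 0) * of_bool (b \<bullet> i - x \<bullet> i > 0)) = (indicator (box a b) x :: real)"
    proof (cases "x \<in> box a b")
      case True
      then show ?thesis by (simp add: mem_box)
    next
      case False
      then obtain i where "i \<in> Basis" "\<not> (a \<bullet> i < x \<bullet> i \<and> x \<bullet> i < b \<bullet> i)" by (auto simp: mem_box)
      then show ?thesis using False by (auto intro!: bexI[of _ i])
    qed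
    finally show "(\<lambda>n. \<psi> n x) \<longlonglongrightarrow> indicator (box a b) x" .
  qed
qed

text \<open>Boxes are stable under intersection and generate the Borel sets, so the integral of \<open>F\<close> over every
Borel set vanishes by Dynkin's argument; the hypothesis on the full integral is what complements
need.\<close>

lemma vanishing_on_boxes_imp_AE_zero:
  fixes F :: "'a::euclidean_space \<Rightarrow> real"
  assumes "integrable lebesgue F" "(\<integral>x. F x \<partial>lebesgue) = 0"
    and "\<And>c d. (LINT x:box c d|lebesgue. F x) = 0" and B: "B \<in> lmeasurable"
  shows "AE x in lebesgue_on B. F x = 0"
proof -
  have Bs: "B \<in> sets lebesgue" using B by blast
  have set_int: "set_integrable lebesgue A F" if "A \<in> sets lebesgue" for A
    unfolding set_integrable_def using that assms(1) by (rule integrable_mult_indicator)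
  have borel0: "(LINT x:A|lebesgue. F x) = 0" if A: "A \<in> sets borel" for A
  proof -
    have A': "A \<in> sigma_sets UNIV (range (\<lambda>(a, b). box a b :: 'a set))"
      using A unfolding borel_eq_box by (simp add: sets_measure_of)
    have stable: "Int_stable (range (\<lambda>(a, b). box a b :: 'a set))"
    proof (rule Int_stableI)
      fix A B assume "A \<in> range (\<lambda>(a, b). box a b :: 'a set)" "B \<in> range (\<lambda>(a, b). box a b :: 'a set)"
      then obtain a b c d where "A = box a b" "B = box c d" by (elim imageE) (simp split: prod.splits)
      then show "A \<inter> B \<in> range (\<lambda>(a, b). box a b :: 'a set)"
        by (simp only: box_Int_box) (rule range_eqI[where x = "(_, _)"], simp)
    qed
    have "range (\<lambda>(a, b). box a b :: 'a set) \<subseteq> Pow UNIV" by simp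
    with stable show ?thesis
      using A'
    proof (induction rule: sigma_sets_induct_disjoint)
      case (basic A) then show ?case using assms(3) by auto
    next
      case (compl A)
      have m: "A \<in> sets lebesgue"
        using compl(1) unfolding borel_eq_box[symmetric]
        by (metis borel_eq_box sets_completionI_sets sets_lborel sets_measure_of subset_UNIV Pow_UNIV)
      have "(LINT x:UNIV - A|lebesgue. F x) + (LINT x:A|lebesgue. F x) = (LINT x:(UNIV - A) \<union> A|lebesgue. F x)"
        by (rule set_integral_Un[symmetric])
           (use m in \<open>auto intro!: set_int\<close>)
      also have "\<dots> = 0" using assms(2) by (simp add: set_lebesgue_integral_def)
      finally show ?case using compl(2) by simp
    next
      case (union A)
      have m: "A i \<in> sets lebesgue" for i
        using union(2) 
        by (metis borel_eq_box sets_completionI_sets sets_lborel sets_measure_of subset_UNIV Pow_UNIV range_subsetD)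
      have "(LINT x:(\<Union>i. A i)|lebesgue. F x) = (\<Sum>i. (LINT x:(A i)|lebesgue. F x))"
        by (rule lebesgue_integral_countable_add)
           (use m union(1) in \<open>auto simp: disjoint_family_on_def intro!: set_int\<close>)
      then show ?case using union(3) by simp
    qed (simp add: set_lebesgue_integral_def)
  qed
  have leb0: "(LINT x:A|lebesgue. F x) = 0" if A: "A \<in> sets lebesgue" for A
  proof -
    obtain S N N' where S: "A = S \<union> N" "N \<subseteq> N'" "N' \<in> null_sets lborel" "S \<in> sets lborel"
      using A by (rule sets_completionE)
    have "AE x in lebesgue. x \<notin> N'" using S(3) by (intro AE_completion AE_not_in)
    then have "AE x in lebesgue. indicator A x *\<^sub>R F x = indicator S x *\<^sub>R F x"
      by eventually_elim (use S in \<open>auto simp: indicator_def\<close>)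
    then have "(LINT x:A|lebesgue. F x) = (LINT x:S|lebesgue. F x)"
      unfolding set_lebesgue_integral_def using A S(4) set_int[unfolded set_integrable_def]
      by (intro integral_cong_AE borel_measurable_integrable) auto
    then show ?thesis using borel0 S(4) by simp
  qed
  interpret finite_measure "lebesgue_on B" using B by (rule finite_measure_lebesgue_on)
  show ?thesis
  proof (rule density_zero)
    show "integrable (lebesgue_on B) F"
      using set_int[OF Bs] Bs by (simp add: integrable_restrict_space set_integrable_def)
    fix A assume "A \<in> sets (lebesgue_on B)"
    then have A: "A \<in> sets lebesgue" "A \<subseteq> B" using Bs by (auto simp: sets_restrict_space_iff)
    have "set_lebesgue_integral (lebesgue_on B) A F = (LINT x:A|lebesgue. F x)"
      unfolding set_lebesgue_integral_def using Bs A
      by (auto simp: integral_restrict_space indicator_def intro!: Bochner_Integration.integral_cong)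
    then show "set_lebesgue_integral (lebesgue_on B) A F = 0" using leb0[OF A(1)] by simp
  qed
qed

text \<open>Approximating the indicator of a box by test functions shows that \<open>g\<close> integrates to zero over every
box whose closure lies in \<open>U\<close>, and \<open>U\<close> is a countable union of closed boxes.\<close>

lemma fundamental_lemma_calculus_of_variations:
  fixes g :: "'a::euclidean_space \<Rightarrow> real"
  assumes U: "open U" and g: "g locally_integrable_on U"
    and 0: "\<And>\<phi>. \<phi> \<in> test_functions U \<Longrightarrow> (LINT x:U|lebesgue. g x * \<phi> x) = 0"
  shows "AE x in lebesgue_on U. g x = 0"
proof -
  have box0: "(LINT x:box a b|lebesgue. g x) = 0" if sub: "cbox a b \<subseteq> U" for a b
  proof -
    obtain \<psi> where \<psi>: "\<And>n::nat. \<psi> n \<in> test_functions U" "\<And>n x. \<bar>\<psi> n x\<bar> \<le> 1"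
      "\<And>n x. x \<notin> cbox a b \<Longrightarrow> \<psi> n x = 0" "\<And>x. (\<lambda>n. \<psi> n x) \<longlonglongrightarrow> indicator (box a b) x"
      using test_functions_approximate_box[OF sub] by metis
    have int: "integrable lebesgue (\<lambda>x. indicator (cbox a b) x *\<^sub>R g x)"
      using g sub compact_cbox unfolding locally_integrable_on_def set_integrable_def by blast
    have eq: "indicator U x *\<^sub>R (g x * \<psi> n x) = (indicator (cbox a b) x *\<^sub>R g x) * \<psi> n x" for n x
      using \<psi>(3)[of x n] sub by (auto simp: indicator_def)
    have m\<psi>: "\<psi> n \<in> borel_measurable lebesgue" for n
      by (intro measurable_completion)
         (simp add: borel_measurable_continuous_onI smooth_continuous_on[OF test_functions_smooth[OF \<psi>(1)]])
    have "(\<lambda>n. \<integral>x. (indicator (cbox a b) x *\<^sub>R g x) * \<psi> n x \<partial>lebesgue) \<longlonglongrightarrow>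
        (\<integral>x. (indicator (cbox a b) x *\<^sub>R g x) * indicator (box a b) x \<partial>lebesgue)"
    proof (rule integral_dominated_convergence)
      show "integrable lebesgue (\<lambda>x. \<bar>indicator (cbox a b) x *\<^sub>R g x\<bar>)" using int by (rule integrable_abs)
      show "AE x in lebesgue. norm ((indicator (cbox a b) x *\<^sub>R g x) * \<psi> n x) \<le> \<bar>indicator (cbox a b) x *\<^sub>R g x\<bar>" for n
        using \<psi>(2)[of n] by (intro AE_I2) (auto simp: abs_mult intro!: mult_left_le)
      show "AE x in lebesgue. (\<lambda>n. (indicator (cbox a b) x *\<^sub>R g x) * \<psi> n x) \<longlonglongrightarrow> (indicator (cbox a b) x *\<^sub>R g x) * indicator (box a b) x"
        by (intro AE_I2 tendsto_mult tendsto_const \<psi>(4))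
      show "(\<lambda>x. (indicator (cbox a b) x *\<^sub>R g x) * \<psi> n x) \<in> borel_measurable lebesgue" for n
        by (intro borel_measurable_times borel_measurable_integrable[OF int] m\<psi>)
      show "(\<lambda>x. (indicator (cbox a b) x *\<^sub>R g x) * indicator (box a b) x) \<in> borel_measurable lebesgue"
        by (intro borel_measurable_times borel_measurable_integrable[OF int] borel_measurable_indicator) simp
    qed
    moreover have "(\<integral>x. (indicator (cbox a b) x *\<^sub>R g x) * \<psi> n x \<partial>lebesgue) = 0" for n
      using 0[OF \<psi>(1)[of n]] unfolding set_lebesgue_integral_def eq .
    ultimately have "(\<integral>x. (indicator (cbox a b) x *\<^sub>R g x) * indicator (box a b) x \<partial>lebesgue) = 0"
      by (simp add: LIMSEQ_const_iff)
    moreover have "(\<lambda>x. (indicator (cbox a b) x *\<^sub>R g x) * indicator (box a b) x) = (\<lambda>x. indicator (box a b) x *\<^sub>R g x)"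
      using box_subset_cbox[of a b] by (auto simp: indicator_def fun_eq_iff)
    ultimately show ?thesis unfolding set_lebesgue_integral_def by simp
  qed
  have cb: "AE x in lebesgue. x \<in> cbox a b \<longrightarrow> g x = 0" if sub: "cbox a b \<subseteq> U" for a b
  proof -
    let ?F = "\<lambda>x. indicator (box a b) x *\<^sub>R g x"
    have "set_integrable lebesgue (cbox a b) g"
      using g sub compact_cbox unfolding locally_integrable_on_def by blast
    then have "set_integrable lebesgue (box a b) g"
      by (rule set_integrable_subset) (auto simp: box_subset_cbox)
    then have i: "integrable lebesgue ?F" by (simp add: set_integrable_def)
    have "AE x in lebesgue_on (box a b). ?F x = 0"
    proof (rule vanishing_on_boxes_imp_AE_zero[OF i])
      show "box a b \<in> lmeasurable" by simp
      show "(\<integral>x. ?F x \<partial>lebesgue) = 0"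
        using box0[OF sub] by (simp add: set_lebesgue_integral_def)
      fix c d
      let ?l = "\<Sum>i\<in>Basis. max (a\<bullet>i) (c\<bullet>i) *\<^sub>R i" and ?u = "\<Sum>i\<in>Basis. min (b\<bullet>i) (d\<bullet>i) *\<^sub>R i"
      have "cbox ?l ?u \<subseteq> U" using sub Int_interval[of a b c d] by blast
      from box0[OF this] have "(LINT x:box a b \<inter> box c d|lebesgue. g x) = 0"
        unfolding box_Int_box .
      then show "(LINT x:box c d|lebesgue. ?F x) = 0"
        unfolding set_lebesgue_integral_def by (simp add: indicator_inter_arith mult_ac)
    qed
    then have "AE x in lebesgue_on (box a b). g x = 0" 
      by (auto simp: AE_restrict_space_iff)
    then have "AE x in lebesgue. x \<in> box a b \<longrightarrow> g x = 0"
      by (simp add: AE_restrict_space_iff)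
    moreover have "AE x in lebesgue. x \<notin> cbox a b - box a b"
      using negligible_frontier_interval[of a b] unfolding negligible_iff_null_sets by (rule AE_not_in)
    ultimately show ?thesis by eventually_elim auto
  qed
  obtain \<D> where \<D>: "countable \<D>" "\<D> \<subseteq> Pow U" "\<And>X. X \<in> \<D> \<Longrightarrow> \<exists>a b. X = cbox a b" "\<Union>\<D> = U"
    using open_countable_Union_open_cbox[OF U] by metis
  have "AE x in lebesgue. \<forall>X\<in>\<D>. x \<in> X \<longrightarrow> g x = 0"
    unfolding AE_ball_countable[OF \<D>(1)]
  proof
    fix X assume X: "X \<in> \<D>"
    then obtain a b where "X = cbox a b" using \<D>(3) by blast
    then show "AE x in lebesgue. x \<in> X \<longrightarrow> g x = 0" using cb[of a b] X \<D>(2) by auto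
  qed
  then have "AE x in lebesgue. x \<in> U \<longrightarrow> g x = 0"
    by eventually_elim (use \<D>(4) in auto)
  then show ?thesis using U by (simp add: AE_restrict_space_iff)
qed


lemma locally_integrable_on_continuous:
  assumes "continuous_on UNIV f"
  shows "f locally_integrable_on U"
  unfolding locally_integrable_on_def
  using continuous_integrable_lebesgue_on[OF compact_imp_bounded _ assms]
  by (auto simp: set_integrable_lebesgue_on lmeasurable_compact fmeasurableD)

lemma locally_integrable_mult_test_function:
  fixes w :: "'a::euclidean_space \<Rightarrow> real"
  assumes "u locally_integrable_on U" "U \<in> sets lebesgue" "\<phi> \<in> test_functions U" "continuous_on UNIV w"
    and "\<And>x. x \<notin> closure {x. \<phi> x \<noteq> 0} \<Longrightarrow> w x = 0"
  shows "integrable (lebesgue_on U) (\<lambda>x. u x * w x)"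
proof -
  let ?K = "closure {x. \<phi> x \<noteq> 0}"
  have K: "compact ?K" "?K \<subseteq> U" using assms(3) by (auto simp: test_functions_iff)
  have i: "integrable lebesgue (\<lambda>x. indicator ?K x *\<^sub>R u x)"
    using assms(1) K unfolding locally_integrable_on_def set_integrable_def by blast
  have "bounded (w ` ?K)"
    by (intro compact_imp_bounded compact_continuous_image K continuous_on_subset[OF assms(4)]) auto
  then obtain B where B: "\<forall>y\<in>w ` ?K. norm y \<le> B"
    unfolding bounded_iff by (rule exE)
  have eq: "indicator U x *\<^sub>R (u x * w x) = (indicator ?K x *\<^sub>R u x) * w x" for x
    using assms(5)[of x] K(2) by (cases "x \<in> ?K") (auto simp: indicator_def)
  have "integrable lebesgue (\<lambda>x. (indicator ?K x *\<^sub>R u x) * w x)"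
  proof (rule Bochner_Integration.integrable_bound)
    show "integrable lebesgue (\<lambda>x. B * (indicator ?K x *\<^sub>R u x))"
      using i by (rule integrable_mult_right)
    have "w \<in> borel_measurable lebesgue"
      using assms(4) by (intro measurable_completion) (simp add: borel_measurable_continuous_onI)
    then show "(\<lambda>x. (indicator ?K x *\<^sub>R u x) * w x) \<in> borel_measurable lebesgue"
      by (intro borel_measurable_times borel_measurable_integrable[OF i])
    show "AE x in lebesgue. norm (indicator ?K x *\<^sub>R u x * w x) \<le> norm (B * (indicator ?K x *\<^sub>R u x))"
    proof (intro AE_I2)
      fix x
      show "norm (indicator ?K x *\<^sub>R u x * w x) \<le> norm (B * (indicator ?K x *\<^sub>R u x))"
      proof (cases "x \<in> ?K")
        case True
        then have "\<bar>w x\<bar> \<le> \<bar>B\<bar>" using B by force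
        then have "\<bar>w x\<bar> * \<bar>u x\<bar> \<le> \<bar>B\<bar> * \<bar>u x\<bar>" by (rule mult_right_mono) simp
        then show ?thesis using True by (simp add: abs_mult mult.commute)
      qed simp
    qed
  qed
  then show ?thesis using assms(2) unfolding eq[symmetric] by (simp add: integrable_restrict_space)
qed

lemma has_weak_pderiv_iff:
  assumes "U \<in> sets lebesgue"
  shows "has_weak_pderiv U b u g \<longleftrightarrow> u locally_integrable_on U \<and> g locally_integrable_on U \<and>
     (\<forall>\<phi>\<in>test_functions U. (\<integral>x. u x * (grad \<phi> x \<bullet> b) \<partial>lebesgue_on U) = - (\<integral>x. g x * \<phi> x \<partial>lebesgue_on U))"
  unfolding has_weak_pderiv_def set_integral_lebesgue_on[OF assms]
  by (simp add: smooth_frechet_derivative test_functions_smooth cong: ball_cong)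

lemma locally_integrable_times_test_function:
  assumes "u locally_integrable_on U" "U \<in> sets lebesgue" "\<phi> \<in> test_functions U"
  shows "integrable (lebesgue_on U) (\<lambda>x. u x * \<phi> x)"
    "integrable (lebesgue_on U) (\<lambda>x. u x * (grad \<phi> x \<bullet> b))"
proof -
  note s = test_functions_smooth[OF assms(3)]
  show "integrable (lebesgue_on U) (\<lambda>x. u x * \<phi> x)"
    using locally_integrable_mult_test_function[OF assms smooth_continuous_on[OF s]]
    by (metis zero_off_support)
  show "integrable (lebesgue_on U) (\<lambda>x. u x * (grad \<phi> x \<bullet> b))"
    using locally_integrable_mult_test_function[OF assms smooth_continuous_on[OF smooth_grad_inner[OF s]]]
    by (simp add: grad_eq_0_off_support)
qed

lemma has_weak_pderiv_unique:
  fixes g :: "'a::euclidean_space \<Rightarrow> real"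
  assumes U: "open U" and "has_weak_pderiv U b u g" "has_weak_pderiv U b u g'"
  shows "AE x in lebesgue_on U. g x = g' x"
proof -
  have Us: "U \<in> sets lebesgue" using U by simp
  have g: "g locally_integrable_on U" "g' locally_integrable_on U"
    using assms by (auto simp: has_weak_pderiv_def)
  have "AE x in lebesgue_on U. g x - g' x = 0"
  proof (rule fundamental_lemma_calculus_of_variations[OF U])
    show "(\<lambda>x. g x - g' x) locally_integrable_on U"
      using g unfolding locally_integrable_on_def by (auto intro: set_integral_diff)
    fix \<phi> assume \<phi>: "\<phi> \<in> test_functions U"
    have "(\<integral>x. g x * \<phi> x \<partial>lebesgue_on U) = (\<integral>x. g' x * \<phi> x \<partial>lebesgue_on U)"
      using assms(2,3) \<phi> unfolding has_weak_pderiv_iff[OF Us] by (metis neg_equal_iff_equal)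
    then show "(LINT x:U|lebesgue. (g x - g' x) * \<phi> x) = 0"
      unfolding set_integral_lebesgue_on[OF Us]
      using locally_integrable_times_test_function(1)[OF g(1) Us \<phi>] locally_integrable_times_test_function(1)[OF g(2) Us \<phi>]
      by (simp add: left_diff_distrib)
  qed
  then show ?thesis by simp
qed

lemma has_weak_pderiv_smooth:
  assumes "U \<in> sets lebesgue" "smooth w"
  shows "has_weak_pderiv U b w (\<lambda>x. grad w x \<bullet> b)"
  unfolding has_weak_pderiv_iff[OF assms(1)]
  using assms integration_by_parts[OF assms]
  by (auto intro!: locally_integrable_on_continuous smooth_continuous_on smooth_grad_inner)

lemma has_weak_pderiv_diff:
  fixes u :: "'a::euclidean_space \<Rightarrow> real"
  assumes Us: "U \<in> sets lebesgue" and "has_weak_pderiv U b u g" "has_weak_pderiv U b v k"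
  shows "has_weak_pderiv U b (\<lambda>x. u x - v x) (\<lambda>x. g x - k x)"
proof -
  have li: "u locally_integrable_on U" "v locally_integrable_on U" "g locally_integrable_on U" "k locally_integrable_on U"
    using assms by (auto simp: has_weak_pderiv_def)
  then have "(\<lambda>x. u x - v x) locally_integrable_on U" "(\<lambda>x. g x - k x) locally_integrable_on U"
    unfolding locally_integrable_on_def by (auto intro: set_integral_diff)
  moreover have "(\<integral>x. (u x - v x) * (grad \<phi> x \<bullet> b) \<partial>lebesgue_on U) = - (\<integral>x. (g x - k x) * \<phi> x \<partial>lebesgue_on U)"
    if \<phi>: "\<phi> \<in> test_functions U" for \<phi>
    using assms(2,3) \<phi> li[THEN locally_integrable_times_test_function(1)[OF _ Us \<phi>]] li[THEN locally_integrable_times_test_function(2)[OF _ Us \<phi>]]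
    unfolding has_weak_pderiv_iff[OF Us] by (simp add: left_diff_distrib)
  ultimately show ?thesis unfolding has_weak_pderiv_iff[OF Us] by blast
qed

text \<open>This makes the arbitrary choice in \<open>weak_pderiv\<close> harmless: it differs from any other weak derivative
on a null set only.\<close>

lemma weak_pderiv_AE_eq:
  assumes "open U" "has_weak_pderiv U b u g"
  shows "has_weak_pderiv U b u (weak_pderiv U b u)" "AE x in lebesgue_on U. weak_pderiv U b u x = g x"
proof -
  show *: "has_weak_pderiv U b u (weak_pderiv U b u)"
    unfolding weak_pderiv_def by (rule someI[of "has_weak_pderiv U b u"]) (rule assms(2))
  show "AE x in lebesgue_on U. weak_pderiv U b u x = g x"
    using has_weak_pderiv_unique[OF assms(1) * assms(2)] .
qed

section \<open>The Sobolev norm in terms of square integrals\<close>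

lemma epowr_mono: "x \<le> y \<Longrightarrow> 0 < a \<Longrightarrow> epowr x a \<le> epowr y a"
proof -
  assume *: "x \<le> y" "0 < a"
  show ?thesis
  proof (cases "y = \<infinity>")
    case False
    then have "x \<noteq> \<infinity>" "y < top" using * by (auto simp: less_top top_unique)
    moreover have "enn2real x powr a \<le> enn2real y powr a"
      using * \<open>y < top\<close> by (intro powr_mono2) (auto intro: enn2real_mono)
    ultimately show ?thesis using False by (simp add: epowr_def ennreal_leI)
  qed (simp add: epowr_def)
qed

lemma epowr_ennreal: "r \<ge> 0 \<Longrightarrow> epowr (ennreal r) a = ennreal (r powr a)"
  by (simp add: epowr_def)

lemma epowr_square_root: "epowr (epowr x 2) (1 / 2) = x"
proof (cases x)
  case (real r)
  then show ?thesis by (simp add: epowr_ennreal powr_powr)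
qed (simp add: epowr_def)

lemma epowr_less_top: "x < top \<Longrightarrow> epowr x a < top"
  by (simp add: epowr_def)

lemma Lp_norm_2_eq:
  fixes f :: "'a::euclidean_space \<Rightarrow> real"
  assumes "f \<in> borel_measurable (lebesgue_on S)" "integrable (lebesgue_on S) (\<lambda>x. (f x)\<^sup>2)"
  shows "Lp_norm 2 S f = ennreal (sqrt (\<integral>x. (f x)\<^sup>2 \<partial>lebesgue_on S))"
proof -
  have "(\<integral>\<^sup>+x. ennreal (norm (f x) powr 2) \<partial>lebesgue_on S) = (\<integral>\<^sup>+x. ennreal ((f x)\<^sup>2) \<partial>lebesgue_on S)"
    by (intro nn_integral_cong) simp
  also have "\<dots> = ennreal (\<integral>x. (f x)\<^sup>2 \<partial>lebesgue_on S)"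
    using assms(2) by (intro nn_integral_eq_integral) auto
  finally show ?thesis
    using assms(1) by (simp add: Lp_norm_def epowr_ennreal powr_half_sqrt)
qed

lemma Lp_norm_2_finite:
  fixes f :: "'a::euclidean_space \<Rightarrow> real"
  assumes "Lp_norm 2 S f < \<infinity>"
  shows "f \<in> borel_measurable (lebesgue_on S)" "integrable (lebesgue_on S) (\<lambda>x. (f x)\<^sup>2)"
proof -
  show m: "f \<in> borel_measurable (lebesgue_on S)"
    using assms by (auto simp: Lp_norm_def split: if_splits)
  have "(\<integral>\<^sup>+x. ennreal (norm (f x) powr 2) \<partial>lebesgue_on S) < \<infinity>"
    using assms m by (auto simp: Lp_norm_def epowr_def less_top split: if_splits)
  also have "(\<integral>\<^sup>+x. ennreal (norm (f x) powr 2) \<partial>lebesgue_on S) = (\<integral>\<^sup>+x. ennreal ((f x)\<^sup>2) \<partial>lebesgue_on S)"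
    by (intro nn_integral_cong) simp
  finally show "integrable (lebesgue_on S) (\<lambda>x. (f x)\<^sup>2)"
    using m by (intro integrableI_nonneg) auto
qed

text \<open>Completeness of Lebesgue measure: measurability survives a change on a null set.\<close>

lemma measurable_lebesgue_on_AE_cong:
  fixes f g :: "'a::euclidean_space \<Rightarrow> real"
  assumes "S \<in> sets lebesgue" "AE x in lebesgue_on S. f x = g x" "g \<in> borel_measurable (lebesgue_on S)"
  shows "f \<in> borel_measurable (lebesgue_on S)"
proof -
  obtain N where N: "{x \<in> space (lebesgue_on S). \<not> f x = g x} \<subseteq> N"
      "emeasure (lebesgue_on S) N = 0" "N \<in> sets (lebesgue_on S)"
    using assms(2) by (rule AE_E)
  have "N \<in> null_sets (lebesgue_on S)" using N(2,3) by (rule null_setsI)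
  note null = borel_measurable_diff_null[OF this assms(1)]
  have "g \<in> borel_measurable (lebesgue_on (S - N))"
    using null assms(3) by blast
  moreover have "f x = g x" if "x \<in> space (lebesgue_on (S - N))" for x
    using that N(1) by (auto simp: space_restrict_space)
  ultimately have "f \<in> borel_measurable (lebesgue_on (S - N))"
    using measurable_cong[of "lebesgue_on (S - N)" f g borel] by blast
  then show ?thesis using null by blast
qed

lemma W1p_norm_2_eq:
  assumes "\<forall>b\<in>Basis. \<exists>g. has_weak_pderiv U b u g"
  shows "W1p_norm 2 U u =
    epowr (epowr (Lp_norm 2 U u) 2 + (\<Sum>b\<in>Basis. epowr (Lp_norm 2 U (weak_pderiv U b u)) 2)) (1 / 2)"
  using assms by (simp add: W1p_norm_def)

lemma W1p_norm_2_finite: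
  assumes "W1p_norm 2 U u < \<infinity>"
  shows "\<forall>b\<in>Basis. \<exists>g. has_weak_pderiv U b u g"
    "Lp_norm 2 U u \<le> W1p_norm 2 U u"
    "b \<in> Basis \<Longrightarrow> Lp_norm 2 U (weak_pderiv U b u) \<le> W1p_norm 2 U u"
proof -
  show ex: "\<forall>b\<in>Basis. \<exists>g. has_weak_pderiv U b u g"
    using assms by (auto simp: W1p_norm_def split: if_splits)
  have "epowr (epowr (Lp_norm 2 U u) 2) (1 / 2) \<le> W1p_norm 2 U u"
    unfolding W1p_norm_2_eq[OF ex] by (intro epowr_mono) auto
  then show "Lp_norm 2 U u \<le> W1p_norm 2 U u" by (simp only: epowr_square_root)
  assume b: "b \<in> Basis"
  have "epowr (Lp_norm 2 U (weak_pderiv U b u)) 2 \<le> (\<Sum>b\<in>Basis. epowr (Lp_norm 2 U (weak_pderiv U b u)) 2)"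
    by (rule member_le_sum[OF b]) auto
  also have "\<dots> \<le> epowr (Lp_norm 2 U u) 2 + (\<Sum>b\<in>Basis. epowr (Lp_norm 2 U (weak_pderiv U b u)) 2)"
    by simp
  finally have "epowr (epowr (Lp_norm 2 U (weak_pderiv U b u)) 2) (1 / 2) \<le> W1p_norm 2 U u"
    unfolding W1p_norm_2_eq[OF ex] by (intro epowr_mono) auto
  then show "Lp_norm 2 U (weak_pderiv U b u) \<le> W1p_norm 2 U u" by (simp only: epowr_square_root)
qed

lemma weak_grad_inner: "b \<in> Basis \<Longrightarrow> weak_grad U u x \<bullet> b = weak_pderiv U b u x"
  by (simp add: weak_grad_def)

text \<open>The bridge between the weak formulation and calculus, used for test functions.\<close>

lemma weak_grad_smooth:
  assumes "open U" "smooth w"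
  shows "AE x in lebesgue_on U. weak_grad U w x = grad w x"
proof -
  have "AE x in lebesgue_on U. \<forall>b\<in>Basis. weak_pderiv U b w x = grad w x \<bullet> b"
    unfolding AE_ball_countable[OF countable_finite[OF finite_Basis]]
  proof
    have "U \<in> sets lebesgue" using assms(1) by simp
    then show "AE x in lebesgue_on U. weak_pderiv U b w x = grad w x \<bullet> b" for b
      using assms by (intro weak_pderiv_AE_eq has_weak_pderiv_smooth)
  qed
  then show ?thesis
    by eventually_elim (rule euclidean_eqI, simp add: weak_grad_inner)
qed

lemma test_functions_in_H1_0:
  fixes U :: "'a::euclidean_space set"
  assumes U: "open U" "bounded U" and \<phi>: "\<phi> \<in> test_functions U"
  shows "\<phi> \<in> H1_0 U"
proof -
  have Us: "U \<in> sets lebesgue" using U by simp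
  have wp: "AE x in lebesgue_on U. weak_pderiv U b w x = grad w x \<bullet> b"
    "weak_pderiv U b w \<in> borel_measurable (lebesgue_on U)"
    "Lp_norm 2 U (weak_pderiv U b w) = ennreal (sqrt (\<integral>x. (grad w x \<bullet> b)\<^sup>2 \<partial>lebesgue_on U))"
    if w: "smooth w" for w b
  proof -
    note * = weak_pderiv_AE_eq[OF U(1) has_weak_pderiv_smooth[OF Us w]]
    show AE: "AE x in lebesgue_on U. weak_pderiv U b w x = grad w x \<bullet> b" by (rule *(2))
    have c: "continuous_on UNIV (\<lambda>x. grad w x \<bullet> b)"
      using w by (intro smooth_continuous_on smooth_grad_inner)
    have m: "(\<lambda>x. grad w x \<bullet> b) \<in> borel_measurable (lebesgue_on U)"
      by (intro continuous_measurable_lebesgue_on Us c)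
    show mw: "weak_pderiv U b w \<in> borel_measurable (lebesgue_on U)"
      using measurable_lebesgue_on_AE_cong[OF Us AE m] .
    have i: "integrable (lebesgue_on U) (\<lambda>x. (grad w x \<bullet> b)\<^sup>2)"
      by (intro continuous_integrable_lebesgue_on U(2) Us continuous_on_power c)
    have AE2: "AE x in lebesgue_on U. (weak_pderiv U b w x)\<^sup>2 = (grad w x \<bullet> b)\<^sup>2"
      using AE by eventually_elim simp
    have "integrable (lebesgue_on U) (\<lambda>x. (weak_pderiv U b w x)\<^sup>2)"
      using integrable_cong_AE[OF borel_measurable_power[OF mw] borel_measurable_power[OF m] AE2] i by blast
    moreover have "(\<integral>x. (weak_pderiv U b w x)\<^sup>2 \<partial>lebesgue_on U) = (\<integral>x. (grad w x \<bullet> b)\<^sup>2 \<partial>lebesgue_on U)"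
      by (rule integral_cong_AE[OF borel_measurable_power[OF mw] borel_measurable_power[OF m] AE2])
    ultimately show "Lp_norm 2 U (weak_pderiv U b w) = ennreal (sqrt (\<integral>x. (grad w x \<bullet> b)\<^sup>2 \<partial>lebesgue_on U))"
      using Lp_norm_2_eq[OF mw] by (simp only:)
  qed
  have ex: "\<forall>b\<in>Basis. \<exists>g. has_weak_pderiv U b w g" if "smooth w" for w
    using has_weak_pderiv_smooth[OF Us that] by blast
  have Lp: "Lp_norm 2 U w = ennreal (sqrt (\<integral>x. (w x)\<^sup>2 \<partial>lebesgue_on U))" if "smooth w" for w
    by (intro Lp_norm_2_eq continuous_measurable_lebesgue_on continuous_integrable_lebesgue_on
        U(2) Us continuous_on_power smooth_continuous_on that)
  note s = test_functions_smooth[OF \<phi>]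
  have "W1p_norm 2 U \<phi> < \<infinity>"
    unfolding W1p_norm_2_eq[OF ex[OF s]] Lp[OF s] wp(3)[OF s] infinity_ennreal_def
    by (rule epowr_less_top) (simp add: epowr_less_top)
  moreover have "W1p_norm 2 U (\<lambda>x. \<phi> x - \<phi> x) = 0"
  proof -
    note z = smooth_const[of "0 :: real"]
    have "grad (\<lambda>_. 0) x = 0" for x :: 'a by (simp add: grad_def)
    then show ?thesis
      by (simp add: W1p_norm_2_eq[OF ex[OF z]] Lp[OF z] wp(3)[OF z] epowr_def)
  qed
  ultimately show ?thesis
    unfolding H1_0_def mem_Collect_eq using \<phi> by (intro conjI exI[of _ "\<lambda>_. \<phi>"]) simp_all
qed

lemma H1_0_square_integrable:
  fixes U :: "'a::euclidean_space set"
  assumes "u \<in> H1_0 U"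
  shows "u \<in> borel_measurable (lebesgue_on U)" "integrable (lebesgue_on U) (\<lambda>x. (u x)\<^sup>2)"
    "weak_grad U u \<in> borel_measurable (lebesgue_on U)"
    "integrable (lebesgue_on U) (\<lambda>x. (norm (weak_grad U u x))\<^sup>2)"
proof -
  have f: "W1p_norm 2 U u < \<infinity>" using assms by (simp add: H1_0_def)
  have "Lp_norm 2 U u < \<infinity>" using W1p_norm_2_finite(2)[OF f] f by (rule le_less_trans)
  then show "u \<in> borel_measurable (lebesgue_on U)" "integrable (lebesgue_on U) (\<lambda>x. (u x)\<^sup>2)"
    by (rule Lp_norm_2_finite)+
  have *: "Lp_norm 2 U (weak_pderiv U b u) < \<infinity>" if "b \<in> Basis" for b
    using W1p_norm_2_finite(3)[OF f that] f by (rule le_less_trans)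
  have m: "weak_pderiv U b u \<in> borel_measurable (lebesgue_on U)" 
    "integrable (lebesgue_on U) (\<lambda>x. (weak_pderiv U b u x)\<^sup>2)" if "b \<in> Basis" for b
    using Lp_norm_2_finite[OF *[OF that]] .
  show "weak_grad U u \<in> borel_measurable (lebesgue_on U)"
    unfolding weak_grad_def[abs_def] by (intro borel_measurable_sum borel_measurable_scaleR m) auto
  have "(norm (weak_grad U u x))\<^sup>2 = (\<Sum>b\<in>Basis. (weak_pderiv U b u x)\<^sup>2)" for x
    unfolding power2_norm_eq_inner euclidean_inner[of "weak_grad U u x" "weak_grad U u x"]
    by (simp add: weak_grad_inner power2_eq_square)
  then show "integrable (lebesgue_on U) (\<lambda>x. (norm (weak_grad U u x))\<^sup>2)"
    using m by (simp add: Bochner_Integration.integrable_sum)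
qed

text \<open>The norm of \<open>W\<^sup>1\<^sub>2\<close> dominates each of its terms, and the weak derivatives of \<open>u - \<phi>\<^sub>n\<close> are,
up to null sets, those of \<open>u\<close> minus the classical ones of \<open>\<phi>\<^sub>n\<close>. Hence convergence in the norm is
convergence of square integrals.\<close>

lemma H1_0_approximation:
  fixes U :: "'a::euclidean_space set"
  assumes U: "open U" "bounded U" and u: "u \<in> H1_0 U"
  obtains \<phi> where "\<And>n::nat. \<phi> n \<in> test_functions U"
    "(\<lambda>n. \<integral>x. (u x - \<phi> n x)\<^sup>2 \<partial>lebesgue_on U) \<longlonglongrightarrow> 0"
    "(\<lambda>n. \<integral>x. (norm (weak_grad U u x - grad (\<phi> n) x))\<^sup>2 \<partial>lebesgue_on U) \<longlonglongrightarrow> 0"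
proof -
  have fin: "W1p_norm 2 U u < \<infinity>"
    and "\<exists>\<phi>. (\<forall>n::nat. \<phi> n \<in> test_functions U) \<and> (\<lambda>n. W1p_norm 2 U (\<lambda>x. u x - \<phi> n x)) \<longlonglongrightarrow> 0"
    using u by (simp_all add: H1_0_def)
  then obtain \<phi> where \<phi>_all: "\<forall>n::nat. \<phi> n \<in> test_functions U"
    and lim: "(\<lambda>n. W1p_norm 2 U (\<lambda>x. u x - \<phi> n x)) \<longlonglongrightarrow> ennreal 0"
    unfolding ennreal_0 by (elim exE conjE)
  then have \<phi>: "\<phi> n \<in> test_functions U" for n by simp
  have Us: "U \<in> sets lebesgue" using U by simp
  define W where "W n = W1p_norm 2 U (\<lambda>x. u x - \<phi> n x)" for n
  have W0: "(\<lambda>n. (enn2real (W n))\<^sup>2) \<longlonglongrightarrow> 0"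
    using tendsto_power[OF tendsto_enn2real[OF lim], of 2] by (simp add: W_def)
  \<comment> \<open>Weak derivatives of \<open>u - \<phi>\<^sub>n\<close> can be read off from the norm only when it is finite.\<close>
  have ev: "\<forall>\<^sub>F n in sequentially. W n < \<infinity>"
    using order_tendstoD(2)[OF lim, of \<infinity>] by (simp add: W_def)
  have sq: "(\<integral>x. (f x)\<^sup>2 \<partial>lebesgue_on U) \<le> (enn2real (W n))\<^sup>2"
    if "W n < \<infinity>" "Lp_norm 2 U f \<le> W n" for n and f :: "'a \<Rightarrow> real"
  proof -
    have f: "Lp_norm 2 U f < \<infinity>" using that(2,1) by (rule le_less_trans)
    have "ennreal (sqrt (\<integral>x. (f x)\<^sup>2 \<partial>lebesgue_on U)) \<le> W n"
      using that(2) unfolding Lp_norm_2_eq[OF Lp_norm_2_finite(1)[OF f] Lp_norm_2_finite(2)[OF f]] .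
    then have "enn2real (ennreal (sqrt (\<integral>x. (f x)\<^sup>2 \<partial>lebesgue_on U))) \<le> enn2real (W n)"
      using that(1) by (intro enn2real_mono) simp_all
    then have "sqrt (\<integral>x. (f x)\<^sup>2 \<partial>lebesgue_on U) \<le> enn2real (W n)"
      by simp
    then show ?thesis by (simp add: sqrt_le_D)
  qed
  have ex: "\<exists>g. has_weak_pderiv U b u g" if "b \<in> Basis" for b
    using W1p_norm_2_finite(1)[OF fin] that by blast
  define d where "d n b x = weak_pderiv U b u x - grad (\<phi> n) x \<bullet> b" for n b x
  have AE: "AE x in lebesgue_on U. weak_pderiv U b (\<lambda>x. u x - \<phi> n x) x = d n b x" if "b \<in> Basis" for n b
    unfolding d_def using ex[OF that] weak_pderiv_AE_eq(1)[OF U(1)]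
      has_weak_pderiv_smooth[OF Us test_functions_smooth[OF \<phi>]]
    by (intro weak_pderiv_AE_eq(2)[OF U(1)] has_weak_pderiv_diff[OF Us]) auto
  note m = H1_0_square_integrable[OF u]
  have dm: "d n b \<in> borel_measurable (lebesgue_on U)" if "b \<in> Basis" for n b
  proof -
    have "(\<lambda>x. weak_grad U u x \<bullet> b - grad (\<phi> n) x \<bullet> b) \<in> borel_measurable (lebesgue_on U)"
      by (intro borel_measurable_diff borel_measurable_inner m borel_measurable_const
          continuous_measurable_lebesgue_on Us smooth_continuous_on_grad test_functions_smooth[OF \<phi>])
    then show ?thesis by (simp add: d_def[abs_def] weak_grad_inner[OF that])
  qed
  have di: "integrable (lebesgue_on U) (\<lambda>x. (d n b x)\<^sup>2)" "(\<integral>x. (d n b x)\<^sup>2 \<partial>lebesgue_on U) \<le> (enn2real (W n))\<^sup>2"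
    if "W n < \<infinity>" "b \<in> Basis" for n b
  proof -
    have le: "Lp_norm 2 U (weak_pderiv U b (\<lambda>x. u x - \<phi> n x)) \<le> W n"
      using W1p_norm_2_finite(3)[OF _ that(2)] that(1) unfolding W_def by blast
    then have fi: "Lp_norm 2 U (weak_pderiv U b (\<lambda>x. u x - \<phi> n x)) < \<infinity>"
      using that(1) by (rule le_less_trans)
    have AE2: "AE x in lebesgue_on U. (weak_pderiv U b (\<lambda>x. u x - \<phi> n x) x)\<^sup>2 = (d n b x)\<^sup>2"
      using AE[OF that(2), of n] by eventually_elim simp
    show "integrable (lebesgue_on U) (\<lambda>x. (d n b x)\<^sup>2)"
      using integrable_cong_AE[OF borel_measurable_power[OF Lp_norm_2_finite(1)[OF fi]]
          borel_measurable_power[OF dm[OF that(2)]] AE2] Lp_norm_2_finite(2)[OF fi] by blast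
    show "(\<integral>x. (d n b x)\<^sup>2 \<partial>lebesgue_on U) \<le> (enn2real (W n))\<^sup>2"
      using integral_cong_AE[OF borel_measurable_power[OF Lp_norm_2_finite(1)[OF fi]]
          borel_measurable_power[OF dm[OF that(2)]] AE2] sq[OF that(1) le] by simp
  qed
  have norm_eq: "(norm (weak_grad U u x - grad (\<phi> n) x))\<^sup>2 = (\<Sum>b\<in>Basis. (d n b x)\<^sup>2)" for n x
    unfolding power2_norm_eq_inner
      euclidean_inner[of "weak_grad U u x - grad (\<phi> n) x" "weak_grad U u x - grad (\<phi> n) x"]
    by (simp add: weak_grad_inner power2_eq_square inner_diff_left d_def)
  show ?thesis
  proof (rule that[OF \<phi>])
    show "(\<lambda>n. \<integral>x. (u x - \<phi> n x)\<^sup>2 \<partial>lebesgue_on U) \<longlonglongrightarrow> 0"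
    proof (rule tendsto_sandwich[OF _ _ tendsto_const W0])
      show "\<forall>\<^sub>F n in sequentially. (\<integral>x. (u x - \<phi> n x)\<^sup>2 \<partial>lebesgue_on U) \<le> (enn2real (W n))\<^sup>2"
        using ev
      proof eventually_elim
        case (elim n)
        from W1p_norm_2_finite(2)[OF elim[unfolded W_def]]
        show ?case by (intro sq elim) (simp add: W_def)
      qed
    qed simp
    show "(\<lambda>n. \<integral>x. (norm (weak_grad U u x - grad (\<phi> n) x))\<^sup>2 \<partial>lebesgue_on U) \<longlonglongrightarrow> 0"
    proof (rule tendsto_sandwich[OF _ _ tendsto_const])
      show "(\<lambda>n. real DIM('a) * (enn2real (W n))\<^sup>2) \<longlonglongrightarrow> 0"
        using tendsto_mult_right_zero[OF W0] .
      show "\<forall>\<^sub>F n in sequentially. (\<integral>x. (norm (weak_grad U u x - grad (\<phi> n) x))\<^sup>2 \<partial>lebesgue_on U)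
          \<le> real DIM('a) * (enn2real (W n))\<^sup>2"
        using ev
      proof eventually_elim
        case (elim n)
        then have "(\<integral>x. (norm (weak_grad U u x - grad (\<phi> n) x))\<^sup>2 \<partial>lebesgue_on U)
            = (\<Sum>b\<in>Basis. \<integral>x. (d n b x)\<^sup>2 \<partial>lebesgue_on U)"
          unfolding norm_eq using di(1) by (intro Bochner_Integration.integral_sum) auto
        also have "\<dots> \<le> (\<Sum>b\<in>(Basis::'a set). (enn2real (W n))\<^sup>2)"
          using di(2) elim by (intro sum_mono) auto
        finally show ?case by simp
      qed
    qed simp
  qed
qed

lemma solves_dirichlet_poisson_tested:
  fixes U :: "'a::euclidean_space set"
  assumes U: "open U" "bounded U" and "solves_dirichlet_poisson U f u" and v: "v \<in> test_functions U"
  shows "(\<integral>x. weak_grad U u x \<bullet> grad v x \<partial>lebesgue_on U) = (\<integral>x. f x * v x \<partial>lebesgue_on U)"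
proof -
  have Us: "U \<in> sets lebesgue" using U by simp
  have "v \<in> H1_0 U" using U v by (rule test_functions_in_H1_0)
  note mv = H1_0_square_integrable(3)[OF this]
  have mu: "weak_grad U u \<in> borel_measurable (lebesgue_on U)"
    using assms(3) by (auto simp: solves_dirichlet_poisson_def intro: H1_0_square_integrable)
  note s = test_functions_smooth[OF v]
  have mg: "grad v \<in> borel_measurable (lebesgue_on U)"
    by (intro continuous_measurable_lebesgue_on Us smooth_continuous_on_grad s)
  have "(\<integral>x. weak_grad U u x \<bullet> weak_grad U v x \<partial>lebesgue_on U) = (\<integral>x. f x * v x \<partial>lebesgue_on U)"
    using assms(3) \<open>v \<in> H1_0 U\<close>
    unfolding solves_dirichlet_poisson_def set_integral_lebesgue_on[OF Us] by blast
  moreover have "(\<integral>x. weak_grad U u x \<bullet> weak_grad U v x \<partial>lebesgue_on U) = (\<integral>x. weak_grad U u x \<bullet> grad v x \<partial>lebesgue_on U)"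
  proof (rule integral_cong_AE)
    show "AE x in lebesgue_on U. weak_grad U u x \<bullet> weak_grad U v x = weak_grad U u x \<bullet> grad v x"
      using weak_grad_smooth[OF U(1) s] by eventually_elim simp
  qed (intro borel_measurable_inner mu mv mg)+
  ultimately show ?thesis by simp
qed

section \<open>Square integrable functions\<close>

definition square_integrable :: "'a measure \<Rightarrow> ('a \<Rightarrow> real) \<Rightarrow> bool" where
  "square_integrable M f \<longleftrightarrow> f \<in> borel_measurable M \<and> integrable M (\<lambda>x. (f x)\<^sup>2)"

lemma square_integrable_bound:
  assumes "square_integrable M g" "f \<in> borel_measurable M" "AE x in M. \<bar>f x\<bar> \<le> \<bar>g x\<bar>"
  shows "square_integrable M f"
  unfolding square_integrable_def
proof
  show "integrable M (\<lambda>x. (f x)\<^sup>2)"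
  proof (rule Bochner_Integration.integrable_bound)
    show "integrable M (\<lambda>x. (g x)\<^sup>2)" using assms(1) by (simp add: square_integrable_def)
    show "(\<lambda>x. (f x)\<^sup>2) \<in> borel_measurable M" using assms(2) by (rule borel_measurable_power)
    show "AE x in M. norm ((f x)\<^sup>2) \<le> norm ((g x)\<^sup>2)"
      using assms(3) by eventually_elim (simp add: abs_le_square_iff)
  qed
qed (rule assms(2))

lemma square_integrable_cmult: "square_integrable M f \<Longrightarrow> square_integrable M (\<lambda>x. c * f x)"
  unfolding square_integrable_def
  by (auto simp: power_mult_distrib intro!: borel_measurable_times borel_measurable_const)

lemma square_integrable_add:
  assumes "square_integrable M f" "square_integrable M g"
  shows "square_integrable M (\<lambda>x. f x + g x)"
  unfolding square_integrable_def
proof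
  show m: "(\<lambda>x. f x + g x) \<in> borel_measurable M"
    using assms by (auto simp: square_integrable_def)
  show "integrable M (\<lambda>x. (f x + g x)\<^sup>2)"
  proof (rule Bochner_Integration.integrable_bound)
    show "integrable M (\<lambda>x. 2 * (f x)\<^sup>2 + 2 * (g x)\<^sup>2)"
      using assms by (simp add: square_integrable_def)
    show "(\<lambda>x. (f x + g x)\<^sup>2) \<in> borel_measurable M" using m by (rule borel_measurable_power)
    show "AE x in M. norm ((f x + g x)\<^sup>2) \<le> norm (2 * (f x)\<^sup>2 + 2 * (g x)\<^sup>2)"
    proof (rule AE_I2)
      fix x
      have "(f x + g x)\<^sup>2 \<le> 2 * (f x)\<^sup>2 + 2 * (g x)\<^sup>2"
        using zero_le_power2[of "f x - g x"] by (simp add: power2_sum power2_diff)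
      then show "norm ((f x + g x)\<^sup>2) \<le> norm (2 * (f x)\<^sup>2 + 2 * (g x)\<^sup>2)" by simp
    qed
  qed
qed

lemma square_integrable_diff:
  assumes "square_integrable M f" "square_integrable M g"
  shows "square_integrable M (\<lambda>x. f x - g x)"
  using square_integrable_add[OF assms(1) square_integrable_cmult[OF assms(2), of "-1"]] by simp

lemma integrable_mult_square_integrable:
  assumes "square_integrable M f" "square_integrable M g"
  shows "integrable M (\<lambda>x. f x * g x)"
proof (rule Bochner_Integration.integrable_bound)
  show "integrable M (\<lambda>x. (f x)\<^sup>2 + (g x)\<^sup>2)" using assms by (simp add: square_integrable_def)
  show "(\<lambda>x. f x * g x) \<in> borel_measurable M" using assms by (auto simp: square_integrable_def)
  show "AE x in M. norm (f x * g x) \<le> norm ((f x)\<^sup>2 + (g x)\<^sup>2)"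
  proof (rule AE_I2)
    fix x
    have "2 * \<bar>f x * g x\<bar> \<le> (f x)\<^sup>2 + (g x)\<^sup>2"
      using zero_le_power2[of "\<bar>f x\<bar> - \<bar>g x\<bar>"] by (simp add: power2_diff abs_mult)
    then show "norm (f x * g x) \<le> norm ((f x)\<^sup>2 + (g x)\<^sup>2)" by simp
  qed
qed

lemma Cauchy_Schwarz_integral:
  assumes f: "square_integrable M f" and g: "square_integrable M g"
  shows "(\<integral>x. \<bar>f x * g x\<bar> \<partial>M) \<le> sqrt (\<integral>x. (f x)\<^sup>2 \<partial>M) * sqrt (\<integral>x. (g x)\<^sup>2 \<partial>M)"
proof -
  have m: "f \<in> borel_measurable M" "g \<in> borel_measurable M"
    and i: "integrable M (\<lambda>x. (f x)\<^sup>2)" "integrable M (\<lambda>x. (g x)\<^sup>2)"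
    using f g by (auto simp: square_integrable_def)
  let ?X = "\<integral>x. \<bar>f x * g x\<bar> \<partial>M"
  have nn: "(\<integral>\<^sup>+x. ennreal \<bar>f x\<bar> * ennreal \<bar>g x\<bar> \<partial>M) = ennreal ?X"
    using integrable_abs[OF integrable_mult_square_integrable[OF f g]]
    by (subst nn_integral_eq_integral[symmetric]) (simp_all add: abs_mult ennreal_mult)
  have sq: "(\<integral>\<^sup>+x. (ennreal \<bar>f x\<bar>)\<^sup>2 \<partial>M) = ennreal (\<integral>x. (f x)\<^sup>2 \<partial>M)"
    if "integrable M (\<lambda>x. (f x)\<^sup>2)" for f
    using that by (subst nn_integral_eq_integral[symmetric]) (simp_all add: ennreal_power)
  have "(ennreal ?X)\<^sup>2 \<le> ennreal (\<integral>x. (f x)\<^sup>2 \<partial>M) * ennreal (\<integral>x. (g x)\<^sup>2 \<partial>M)"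
    using Cauchy_Schwarz_nn_integral[of "\<lambda>x. ennreal \<bar>f x\<bar>" M "\<lambda>x. ennreal \<bar>g x\<bar>"] m
    unfolding nn sq[OF i(1)] sq[OF i(2)] by simp
  then have "?X\<^sup>2 \<le> (\<integral>x. (f x)\<^sup>2 \<partial>M) * (\<integral>x. (g x)\<^sup>2 \<partial>M)"
    by (simp add: ennreal_power ennreal_mult[symmetric])
  then have "?X \<le> sqrt ((\<integral>x. (f x)\<^sup>2 \<partial>M) * (\<integral>x. (g x)\<^sup>2 \<partial>M))"
    by (rule real_le_rsqrt)
  then show ?thesis by (simp add: real_sqrt_mult)
qed

lemma Cauchy_Schwarz_tendsto_0:
  assumes "\<And>n. square_integrable M (f n)" "\<And>n. square_integrable M (g n)"
    and "(\<lambda>n. \<integral>x. (f n x)\<^sup>2 \<partial>M) \<longlonglongrightarrow> 0" and B: "\<And>n. (\<integral>x. (g n x)\<^sup>2 \<partial>M) \<le> B"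
  shows "(\<lambda>n. \<integral>x. \<bar>f n x * g n x\<bar> \<partial>M) \<longlonglongrightarrow> 0"
proof (rule tendsto_sandwich[OF _ _ tendsto_const])
  show "(\<lambda>n. sqrt (\<integral>x. (f n x)\<^sup>2 \<partial>M) * sqrt B) \<longlonglongrightarrow> 0"
    using tendsto_mult_left_zero[OF tendsto_real_sqrt[OF assms(3), simplified]] .
  show "\<forall>\<^sub>F n in sequentially. (\<integral>x. \<bar>f n x * g n x\<bar> \<partial>M) \<le> sqrt (\<integral>x. (f n x)\<^sup>2 \<partial>M) * sqrt B"
  proof (rule always_eventually, rule allI)
    fix n
    have "sqrt (\<integral>x. (f n x)\<^sup>2 \<partial>M) * sqrt (\<integral>x. (g n x)\<^sup>2 \<partial>M) \<le> sqrt (\<integral>x. (f n x)\<^sup>2 \<partial>M) * sqrt B"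
      using B[of n] by (intro mult_left_mono) simp_all
    with Cauchy_Schwarz_integral[OF assms(1,2)[of n]]
    show "(\<integral>x. \<bar>f n x * g n x\<bar> \<partial>M) \<le> sqrt (\<integral>x. (f n x)\<^sup>2 \<partial>M) * sqrt B" by (rule order_trans)
  qed
qed simp

lemma square_integral_le_twice:
  assumes "square_integrable M f1" "square_integrable M f2" "square_integrable M f3"
    and "\<And>x. \<bar>f1 x\<bar> \<le> \<bar>f2 x\<bar> + \<bar>f3 x\<bar>"
  shows "(\<integral>x. (f1 x)\<^sup>2 \<partial>M) \<le> 2 * (\<integral>x. (f2 x)\<^sup>2 \<partial>M) + 2 * (\<integral>x. (f3 x)\<^sup>2 \<partial>M)"
proof -
  have i: "integrable M (\<lambda>x. (f1 x)\<^sup>2)" "integrable M (\<lambda>x. (f2 x)\<^sup>2)" "integrable M (\<lambda>x. (f3 x)\<^sup>2)"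
    using assms by (auto simp: square_integrable_def)
  have "(\<integral>x. (f1 x)\<^sup>2 \<partial>M) \<le> (\<integral>x. 2 * (f2 x)\<^sup>2 + 2 * (f3 x)\<^sup>2 \<partial>M)"
  proof (rule integral_mono[OF i(1)])
    show "integrable M (\<lambda>x. 2 * (f2 x)\<^sup>2 + 2 * (f3 x)\<^sup>2)" using i by simp
    fix x
    have "(f1 x)\<^sup>2 \<le> (\<bar>f2 x\<bar> + \<bar>f3 x\<bar>)\<^sup>2" using assms(4)[of x] by (metis abs_ge_zero power2_abs power_mono)
    also have "\<dots> \<le> 2 * (f2 x)\<^sup>2 + 2 * (f3 x)\<^sup>2"
      using zero_le_power2[of "\<bar>f2 x\<bar> - \<bar>f3 x\<bar>"] by (simp add: power2_sum power2_diff)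
    finally show "(f1 x)\<^sup>2 \<le> 2 * (f2 x)\<^sup>2 + 2 * (f3 x)\<^sup>2" .
  qed
  also have "\<dots> = 2 * (\<integral>x. (f2 x)\<^sup>2 \<partial>M) + 2 * (\<integral>x. (f3 x)\<^sup>2 \<partial>M)" using i by simp
  finally show ?thesis .
qed

lemma square_integrable_continuous:
  fixes f :: "'a::euclidean_space \<Rightarrow> real"
  assumes "bounded U" "U \<in> sets lebesgue" "continuous_on UNIV f"
  shows "square_integrable (lebesgue_on U) f"
  unfolding square_integrable_def using assms
  by (intro conjI continuous_measurable_lebesgue_on continuous_integrable_lebesgue_on continuous_on_power)

section \<open>Weak solutions and their smooth approximations\<close>

definition laplacian :: "('a::euclidean_space \<Rightarrow> real) \<Rightarrow> 'a \<Rightarrow> real" where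
  "laplacian w x = (\<Sum>b\<in>Basis. grad (\<lambda>y. grad w y \<bullet> b) x \<bullet> b)"

lemma smooth_laplacian: "smooth w \<Longrightarrow> smooth (laplacian w)"
  unfolding laplacian_def[abs_def] by (intro smooth_sum smooth_grad_inner finite_Basis)

lemma Green_identity:
  fixes w :: "'a::euclidean_space \<Rightarrow> real"
  assumes U: "bounded U" "U \<in> sets lebesgue" and w: "smooth w" and \<phi>: "\<phi> \<in> test_functions U"
  shows "(\<integral>x. grad w x \<bullet> grad \<phi> x \<partial>lebesgue_on U) = - (\<integral>x. laplacian w x * \<phi> x \<partial>lebesgue_on U)"
proof -
  note s = test_functions_smooth[OF \<phi>]
  have i1: "integrable (lebesgue_on U) (\<lambda>x. (grad w x \<bullet> b) * (grad \<phi> x \<bullet> b))" for b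
    by (intro continuous_integrable_lebesgue_on U smooth_continuous_on smooth_mult smooth_grad_inner w s)
  have i2: "integrable (lebesgue_on U) (\<lambda>x. (grad (\<lambda>y. grad w y \<bullet> b) x \<bullet> b) * \<phi> x)" for b
    by (intro continuous_integrable_lebesgue_on U smooth_continuous_on smooth_mult smooth_grad_inner w s)
  have "(\<integral>x. grad w x \<bullet> grad \<phi> x \<partial>lebesgue_on U)
      = (\<Sum>b\<in>Basis. \<integral>x. (grad w x \<bullet> b) * (grad \<phi> x \<bullet> b) \<partial>lebesgue_on U)"
    unfolding euclidean_inner[of "grad w _" "grad \<phi> _"] using i1 by (intro Bochner_Integration.integral_sum)
  also have "\<dots> = (\<Sum>b\<in>Basis. - (\<integral>x. (grad (\<lambda>y. grad w y \<bullet> b) x \<bullet> b) * \<phi> x \<partial>lebesgue_on U))"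
    by (intro sum.cong refl integration_by_parts U(2) smooth_grad_inner w \<phi>)
  also have "\<dots> = - (\<integral>x. laplacian w x * \<phi> x \<partial>lebesgue_on U)"
    unfolding laplacian_def sum_distrib_right sum_negf
    using i2 by (subst Bochner_Integration.integral_sum) simp_all
  finally show ?thesis .
qed

text \<open>The form in which a weak solution is used below: a square integrable function \<open>u\<close> with gradient
\<open>Du\<close>, the \<open>H\<^sup>1\<close> limit of the test functions \<open>\<phi>\<^sub>n\<close>, for which the equation may be tested with
classical test functions.\<close>

locale approximated_weak_solution =
  fixes U :: "'a::euclidean_space set" and f u :: "'a \<Rightarrow> real" and Du :: "'a \<Rightarrow> 'a"
    and \<phi> :: "nat \<Rightarrow> 'a \<Rightarrow> real"
  assumes U: "open U" "bounded U"
    and u: "square_integrable (lebesgue_on U) u"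
    and Du_measurable: "Du \<in> borel_measurable (lebesgue_on U)"
    and Du: "square_integrable (lebesgue_on U) (\<lambda>x. norm (Du x))"
    and test: "\<phi> n \<in> test_functions U"
    and u_lim: "(\<lambda>n. \<integral>x. (u x - \<phi> n x)\<^sup>2 \<partial>lebesgue_on U) \<longlonglongrightarrow> 0"
    and Du_lim: "(\<lambda>n. \<integral>x. (norm (Du x - grad (\<phi> n) x))\<^sup>2 \<partial>lebesgue_on U) \<longlonglongrightarrow> 0"
    and tested: "v \<in> test_functions U \<Longrightarrow>
      (\<integral>x. Du x \<bullet> grad v x \<partial>lebesgue_on U) = (\<integral>x. f x * v x \<partial>lebesgue_on U)"
begin

abbreviation "M \<equiv> lebesgue_on U"

lemma Us: "U \<in> sets lebesgue" using U by simp

lemmas continuous_integrable = continuous_integrable_lebesgue_on[OF U(2) Us]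
lemmas continuous_square_integrable = square_integrable_continuous[OF U(2) Us]
lemmas continuous_measurable = continuous_measurable_lebesgue_on[OF Us]
lemmas \<phi>_smooth = test_functions_smooth[OF test]

lemma \<phi>_square_integrable: "square_integrable M (\<phi> n)"
  by (intro continuous_square_integrable smooth_continuous_on \<phi>_smooth)

lemma grad_square_integrable: "smooth w \<Longrightarrow> square_integrable M (\<lambda>x. norm (grad w x))"
  by (intro continuous_square_integrable continuous_on_norm smooth_continuous_on_grad)

lemma Du_diff_square_integrable: "square_integrable M (\<lambda>x. norm (Du x - grad (\<phi> n) x))"
proof (rule square_integrable_bound)
  show "square_integrable M (\<lambda>x. norm (Du x) + norm (grad (\<phi> n) x))"
    by (intro square_integrable_add Du grad_square_integrable \<phi>_smooth)
  show "(\<lambda>x. norm (Du x - grad (\<phi> n) x)) \<in> borel_measurable M"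
    using borel_measurable_diff[OF Du_measurable continuous_measurable[OF smooth_continuous_on_grad[OF \<phi>_smooth]]]
    by (rule measurable_compose[OF _ borel_measurable_norm])
  show "AE x in M. \<bar>norm (Du x - grad (\<phi> n) x)\<bar> \<le> \<bar>norm (Du x) + norm (grad (\<phi> n) x)\<bar>"
  proof (rule AE_I2)
    fix x
    show "\<bar>norm (Du x - grad (\<phi> n) x)\<bar> \<le> \<bar>norm (Du x) + norm (grad (\<phi> n) x)\<bar>"
      using norm_triangle_ineq4[of "Du x" "grad (\<phi> n) x"] by simp
  qed
qed

lemma grad_\<phi>_bounded: "\<exists>B. \<forall>n. (\<integral>x. (norm (grad (\<phi> n) x))\<^sup>2 \<partial>M) \<le> B"
proof -
  have "Bseq (\<lambda>n. \<integral>x. (norm (Du x - grad (\<phi> n) x))\<^sup>2 \<partial>M)"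
    by (rule convergent_imp_Bseq[OF convergentI[OF Du_lim]])
  then obtain K where K: "\<And>n. \<bar>\<integral>x. (norm (Du x - grad (\<phi> n) x))\<^sup>2 \<partial>M\<bar> \<le> K"
    unfolding Bseq_def by auto
  have "(\<integral>x. (norm (grad (\<phi> n) x))\<^sup>2 \<partial>M) \<le> 2 * (\<integral>x. (norm (Du x))\<^sup>2 \<partial>M) + 2 * K" for n
  proof -
    have "(\<integral>x. (norm (grad (\<phi> n) x))\<^sup>2 \<partial>M)
        \<le> 2 * (\<integral>x. (norm (Du x))\<^sup>2 \<partial>M) + 2 * (\<integral>x. (norm (Du x - grad (\<phi> n) x))\<^sup>2 \<partial>M)"
    proof (rule square_integral_le_twice[OF grad_square_integrable[OF \<phi>_smooth] Du Du_diff_square_integrable])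
      fix x
      show "\<bar>norm (grad (\<phi> n) x)\<bar> \<le> \<bar>norm (Du x)\<bar> + \<bar>norm (Du x - grad (\<phi> n) x)\<bar>"
        using norm_triangle_sub[of "grad (\<phi> n) x" "Du x"] by (simp add: norm_minus_commute)
    qed
    then show ?thesis using K[of n] by simp
  qed
  then show ?thesis by blast
qed

lemma \<phi>_bounded: "\<exists>B. \<forall>n. (\<integral>x. (\<phi> n x)\<^sup>2 \<partial>M) \<le> B"
proof -
  have "Bseq (\<lambda>n. \<integral>x. (u x - \<phi> n x)\<^sup>2 \<partial>M)"
    by (rule convergent_imp_Bseq[OF convergentI[OF u_lim]])
  then obtain K where K: "\<And>n. \<bar>\<integral>x. (u x - \<phi> n x)\<^sup>2 \<partial>M\<bar> \<le> K"
    unfolding Bseq_def by auto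
  have "(\<integral>x. (\<phi> n x)\<^sup>2 \<partial>M) \<le> 2 * (\<integral>x. (u x)\<^sup>2 \<partial>M) + 2 * K" for n
  proof -
    have "(\<integral>x. (\<phi> n x)\<^sup>2 \<partial>M) \<le> 2 * (\<integral>x. (u x)\<^sup>2 \<partial>M) + 2 * (\<integral>x. (u x - \<phi> n x)\<^sup>2 \<partial>M)"
      by (rule square_integral_le_twice[OF \<phi>_square_integrable u square_integrable_diff[OF u \<phi>_square_integrable]])
         linarith
    then show ?thesis using K[of n] by simp
  qed
  then show ?thesis by blast
qed

lemma u_weak_lim:
  assumes g: "square_integrable M g"
  shows "(\<lambda>n. \<integral>x. g x * \<phi> n x \<partial>M) \<longlonglongrightarrow> (\<integral>x. g x * u x \<partial>M)"
proof -
  have "(\<lambda>n. \<integral>x. \<bar>(u x - \<phi> n x) * g x\<bar> \<partial>M) \<longlonglongrightarrow> 0"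
    by (rule Cauchy_Schwarz_tendsto_0[OF square_integrable_diff[OF u \<phi>_square_integrable] g u_lim order_refl])
  then have "(\<lambda>n. \<integral>x. (u x - \<phi> n x) * g x \<partial>M) \<longlonglongrightarrow> 0"
    by (rule tendsto_0_le[where K = 1]) (auto intro!: always_eventually integral_abs_bound)
  then have "(\<lambda>n. (\<integral>x. g x * u x \<partial>M) - (\<integral>x. (u x - \<phi> n x) * g x \<partial>M)) \<longlonglongrightarrow> (\<integral>x. g x * u x \<partial>M) - 0"
    by (intro tendsto_diff tendsto_const)
  moreover have "(\<integral>x. g x * u x \<partial>M) - (\<integral>x. (u x - \<phi> n x) * g x \<partial>M) = (\<integral>x. g x * \<phi> n x \<partial>M)" for n
    using integrable_mult_square_integrable[OF g u] integrable_mult_square_integrable[OF g \<phi>_square_integrable]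
    by (simp add: right_diff_distrib mult.commute[of _ "g _"])
  ultimately show ?thesis by simp
qed

lemma u_square_lim: "(\<lambda>n. \<integral>x. (\<phi> n x)\<^sup>2 \<partial>M) \<longlonglongrightarrow> (\<integral>x. (u x)\<^sup>2 \<partial>M)"
proof -
  have "(\<lambda>n. (\<integral>x. (u x - \<phi> n x)\<^sup>2 \<partial>M) + 2 * (\<integral>x. u x * \<phi> n x \<partial>M) - (\<integral>x. (u x)\<^sup>2 \<partial>M))
      \<longlonglongrightarrow> 0 + 2 * (\<integral>x. u x * u x \<partial>M) - (\<integral>x. (u x)\<^sup>2 \<partial>M)"
    by (intro tendsto_intros u_lim u_weak_lim u)
  moreover have "(\<integral>x. (u x - \<phi> n x)\<^sup>2 \<partial>M) + 2 * (\<integral>x. u x * \<phi> n x \<partial>M) - (\<integral>x. (u x)\<^sup>2 \<partial>M)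
      = (\<integral>x. (\<phi> n x)\<^sup>2 \<partial>M)" for n
  proof -
    have i: "integrable M (\<lambda>x. (u x)\<^sup>2)" "integrable M (\<lambda>x. (\<phi> n x)\<^sup>2)" "integrable M (\<lambda>x. u x * \<phi> n x)"
      using u \<phi>_square_integrable[of n] integrable_mult_square_integrable[OF u \<phi>_square_integrable]
      by (auto simp: square_integrable_def)
    have "(\<lambda>x. (u x - \<phi> n x)\<^sup>2) = (\<lambda>x. (u x)\<^sup>2 + (\<phi> n x)\<^sup>2 - 2 * (u x * \<phi> n x))"
      by (simp add: power2_diff mult.assoc)
    then show ?thesis using i by simp
  qed
  ultimately show ?thesis by (simp add: power2_eq_square)
qed

text \<open>The equation holds exactly with \<open>Du\<close> in place of the gradient of \<open>\<phi>\<^sub>n\<close>, so the residual is the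
integral of \<open>(\<nabla>\<phi>\<^sub>n - Du) \<bullet> \<nabla>v\<^sub>n\<close>, which Cauchy-Schwarz bounds. Since only the boundedness of the \<open>v\<^sub>n\<close>
enters, they need not converge.\<close>

lemma residual_tendsto_0:
  assumes v: "\<And>n. v n \<in> test_functions U" and B: "\<And>n. (\<integral>x. (norm (grad (v n) x))\<^sup>2 \<partial>M) \<le> B"
  shows "(\<lambda>n. (\<integral>x. grad (\<phi> n) x \<bullet> grad (v n) x \<partial>M) - (\<integral>x. f x * v n x \<partial>M)) \<longlonglongrightarrow> 0"
proof -
  note vs = test_functions_smooth[OF v]
  have lim: "(\<lambda>n. \<integral>x. \<bar>norm (Du x - grad (\<phi> n) x) * norm (grad (v n) x)\<bar> \<partial>M) \<longlonglongrightarrow> 0"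
    by (rule Cauchy_Schwarz_tendsto_0[OF Du_diff_square_integrable grad_square_integrable[OF vs] Du_lim B])
  show ?thesis
  proof (rule tendsto_0_le[OF lim, where K = 1], rule always_eventually, rule allI)
    fix n
    let ?d = "\<lambda>x. norm (Du x - grad (\<phi> n) x) * norm (grad (v n) x)"
    have d: "integrable M ?d"
      by (rule integrable_mult_square_integrable[OF Du_diff_square_integrable grad_square_integrable[OF vs]])
    have m: "(\<lambda>x. (Du x - grad (\<phi> n) x) \<bullet> grad (v n) x) \<in> borel_measurable M"
      by (intro borel_measurable_inner borel_measurable_diff Du_measurable continuous_measurable
          smooth_continuous_on_grad \<phi>_smooth vs)
    have i1: "integrable M (\<lambda>x. (Du x - grad (\<phi> n) x) \<bullet> grad (v n) x)"
      by (rule Bochner_Integration.integrable_bound[OF d m]) (simp add: Cauchy_Schwarz_ineq2)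
    have i2: "integrable M (\<lambda>x. grad (\<phi> n) x \<bullet> grad (v n) x)"
      by (intro continuous_integrable continuous_on_inner smooth_continuous_on_grad \<phi>_smooth vs)
    have "(\<integral>x. f x * v n x \<partial>M) = (\<integral>x. (Du x - grad (\<phi> n) x) \<bullet> grad (v n) x + grad (\<phi> n) x \<bullet> grad (v n) x \<partial>M)"
      unfolding tested[OF v, symmetric] by (simp add: inner_diff_left)
    also have "\<dots> = (\<integral>x. (Du x - grad (\<phi> n) x) \<bullet> grad (v n) x \<partial>M) + (\<integral>x. grad (\<phi> n) x \<bullet> grad (v n) x \<partial>M)"
      using i1 i2 by (rule Bochner_Integration.integral_add)
    finally have "norm ((\<integral>x. grad (\<phi> n) x \<bullet> grad (v n) x \<partial>M) - (\<integral>x. f x * v n x \<partial>M))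
        = norm (\<integral>x. (Du x - grad (\<phi> n) x) \<bullet> grad (v n) x \<partial>M)" by simp
    also have "\<dots> \<le> (\<integral>x. norm ((Du x - grad (\<phi> n) x) \<bullet> grad (v n) x) \<partial>M)"
      by (rule integral_norm_bound)
    also have "\<dots> \<le> (\<integral>x. ?d x \<partial>M)"
      by (rule integral_mono[OF integrable_norm[OF i1] d]) (simp add: Cauchy_Schwarz_ineq2)
    also have "\<dots> = norm (\<integral>x. \<bar>?d x\<bar> \<partial>M) * 1" by simp
    finally show "norm ((\<integral>x. grad (\<phi> n) x \<bullet> grad (v n) x \<partial>M) - (\<integral>x. f x * v n x \<partial>M))
        \<le> norm (\<integral>x. \<bar>?d x\<bar> \<partial>M) * 1" .
  qed
qed

end

section \<open>Comparison with a superharmonic function\<close>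

lemma exp_bump_0_has_derivative: "(exp_bump 0 has_real_derivative exp_bump 2 t) (at t)"
  using exp_bump_has_derivative[of 0 t] by (simp add: numeral_2_eq_2)

text \<open>With \<open>s = 1 / t\<close> the claim is \<open>s\<^sup>2 \<le> 4 e\<^sup>s\<close>, the square of \<open>s / 2 \<le> e\<^sup>s\<^sup>/\<^sup>2\<close>.\<close>

lemma exp_bump_2_bounds: "0 \<le> exp_bump 2 t" "exp_bump 2 t \<le> 4"
proof -
  show "0 \<le> exp_bump 2 t" by (simp add: exp_bump_def)
  show "exp_bump 2 t \<le> 4"
  proof (cases "t > 0")
    case True
    let ?s = "1 / t"
    have "?s / 2 \<le> exp (?s / 2)" using exp_ge_add_one_self[of "?s / 2"] by linarith
    then have "(?s / 2)\<^sup>2 \<le> (exp (?s / 2))\<^sup>2" using True by (intro power_mono) simp_all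
    also have "(exp (?s / 2))\<^sup>2 = exp ?s" by (simp add: exp_double[symmetric])
    finally have "?s\<^sup>2 \<le> 4 * exp ?s" by (simp add: power_divide)
    then have "exp (- ?s) * ?s\<^sup>2 \<le> exp (- ?s) * (4 * exp ?s)" by (rule mult_left_mono) simp
    also have "\<dots> = 4" by (simp add: exp_minus)
    finally show ?thesis using True by (simp add: exp_bump_def power_divide)
  qed (simp add: exp_bump_def)
qed

lemma exp_bump_0_lipschitz: "\<bar>exp_bump 0 s - exp_bump 0 t\<bar> \<le> 4 * \<bar>s - t\<bar>"
  using field_differentiable_bound[OF convex_UNIV, of "exp_bump 0" "exp_bump 2" 4 s t]
    exp_bump_0_has_derivative exp_bump_2_bounds by simp

context approximated_weak_solution
begin

lemma u_measurable: "u \<in> borel_measurable M"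
  using u by (simp add: square_integrable_def)

text \<open>Test with \<open>v\<^sub>n = s(\<phi>\<^sub>n - W)\<close>, \<open>s = exp_bump 0\<close>. It has compact support in \<open>U\<close>, because \<open>s\<close>
vanishes at negative arguments and \<open>W\<close> is positive. As \<open>s' \<ge> 0\<close>, the gradients of \<open>\<phi>\<^sub>n - W\<close> and \<open>v\<^sub>n\<close>
have nonnegative product, so \<open>\<integral> (-\<Delta>W) v\<^sub>n = \<integral> \<nabla>W \<bullet> \<nabla>v\<^sub>n \<le> \<integral> \<nabla>\<phi>\<^sub>n \<bullet> \<nabla>v\<^sub>n\<close>, which up to the residual is
\<open>\<integral> f v\<^sub>n \<le> \<integral> (-\<Delta>W) v\<^sub>n / 2\<close>. In the limit \<open>\<integral> (-\<Delta>W) s(u - W) \<le> 0\<close>. The factor \<open>2\<close> in the last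
hypothesis leaves half of \<open>-\<Delta>W\<close> over, and this half being positive forces \<open>s(u - W) = 0\<close>.\<close>

lemma comparison:
  assumes W: "smooth W" "\<And>x. W x > 0" and lap: "\<And>x. laplacian W x < 0"
    and f: "f \<in> borel_measurable M" "AE x in M. 2 * \<bar>f x\<bar> \<le> - laplacian W x"
  shows "AE x in M. u x \<le> W x"
proof -
  define g where "g x = - laplacian W x" for x
  define v where "v n x = exp_bump 0 (\<phi> n x - W x)" for n x
  have g: "smooth g" unfolding g_def[abs_def] by (intro smooth_uminus smooth_laplacian W)
  have g_pos: "g x > 0" for x using lap[of x] by (simp add: g_def)
  have vs: "smooth (v n)" for n
    unfolding v_def[abs_def] by (intro smooth_exp_bump smooth_diff \<phi>_smooth W)
  have v: "v n \<in> test_functions U" for n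
  proof (rule test_functionsI_support[OF test vs])
    fix x assume "x \<notin> closure {x. \<phi> n x \<noteq> 0}"
    then have "\<phi> n x = 0" by (rule zero_off_support)
    then show "v n x = 0" using W(2)[of x] by (simp add: v_def exp_bump_def)
  qed
  have v01: "0 \<le> v n x" "v n x \<le> 1" for n x by (simp_all add: v_def exp_bump_0_simps)
  have dv: "grad (v n) x = exp_bump 2 (\<phi> n x - W x) *\<^sub>R (grad (\<phi> n) x - grad W x)" for n x
    unfolding v_def[abs_def]
    by (subst grad_comp[OF smooth_diff[OF \<phi>_smooth W(1)] exp_bump_0_has_derivative])
       (simp add: grad_diff[OF \<phi>_smooth W(1)])
  obtain B where "\<forall>n. (\<integral>x. (norm (grad (\<phi> n) x))\<^sup>2 \<partial>M) \<le> B"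
    using grad_\<phi>_bounded by (elim exE)
  then have B: "(\<integral>x. (norm (grad (\<phi> n) x))\<^sup>2 \<partial>M) \<le> B" for n by simp
  have dv_bound: "(\<integral>x. (norm (grad (v n) x))\<^sup>2 \<partial>M) \<le> 32 * B + 32 * (\<integral>x. (norm (grad W x))\<^sup>2 \<partial>M)" for n
  proof -
    have "(\<integral>x. (norm (grad (v n) x))\<^sup>2 \<partial>M)
        \<le> 2 * (\<integral>x. (4 * norm (grad (\<phi> n) x))\<^sup>2 \<partial>M) + 2 * (\<integral>x. (4 * norm (grad W x))\<^sup>2 \<partial>M)"
    proof (rule square_integral_le_twice)
      fix x
      have "norm (grad (v n) x) = exp_bump 2 (\<phi> n x - W x) * norm (grad (\<phi> n) x - grad W x)"
        using exp_bump_2_bounds(1) by (simp add: dv)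
      also have "\<dots> \<le> 4 * (norm (grad (\<phi> n) x) + norm (grad W x))"
        using exp_bump_2_bounds norm_triangle_ineq4 by (intro mult_mono) auto
      finally show "\<bar>norm (grad (v n) x)\<bar> \<le> \<bar>4 * norm (grad (\<phi> n) x)\<bar> + \<bar>4 * norm (grad W x)\<bar>" by simp
    qed (intro square_integrable_cmult grad_square_integrable vs \<phi>_smooth W)+
    then show ?thesis using B[of n] by (simp add: power_mult_distrib)
  qed
  define r where "r n = (\<integral>x. grad (\<phi> n) x \<bullet> grad (v n) x \<partial>M) - (\<integral>x. f x * v n x \<partial>M)" for n
  have r0: "r \<longlonglongrightarrow> 0" unfolding r_def[abs_def] by (rule residual_tendsto_0[OF v dv_bound])
  have gv: "integrable M (\<lambda>x. g x * v n x)" for n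
    by (intro continuous_integrable smooth_continuous_on smooth_mult g vs)
  have gv_le: "(\<integral>x. g x * v n x \<partial>M) \<le> 2 * r n" for n
  proof -
    have c: "continuous_on UNIV (\<lambda>x. grad W x \<bullet> grad (v n) x)"
      "continuous_on UNIV (\<lambda>x. grad (\<phi> n) x \<bullet> grad (v n) x)"
      by (intro continuous_on_inner smooth_continuous_on_grad W vs \<phi>_smooth)+
    have "(\<integral>x. g x * v n x \<partial>M) = (\<integral>x. grad W x \<bullet> grad (v n) x \<partial>M)"
      by (simp add: Green_identity[OF U(2) Us W(1) v] g_def)
    also have "\<dots> \<le> (\<integral>x. grad (\<phi> n) x \<bullet> grad (v n) x \<partial>M)"
    proof (rule integral_mono[OF continuous_integrable[OF c(1)] continuous_integrable[OF c(2)]])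
      fix x
      have "0 \<le> exp_bump 2 (\<phi> n x - W x) * ((grad (\<phi> n) x - grad W x) \<bullet> (grad (\<phi> n) x - grad W x))"
        by (intro mult_nonneg_nonneg exp_bump_2_bounds inner_ge_zero)
      also have "\<dots> = (grad (\<phi> n) x - grad W x) \<bullet> grad (v n) x" by (simp add: dv)
      finally show "grad W x \<bullet> grad (v n) x \<le> grad (\<phi> n) x \<bullet> grad (v n) x"
        by (simp add: inner_diff_left)
    qed
    finally have 1: "(\<integral>x. g x * v n x \<partial>M) - (\<integral>x. f x * v n x \<partial>M) \<le> r n" by (simp add: r_def)
    have le: "AE x in M. \<bar>f x * v n x\<bar> \<le> g x * v n x / 2"
      using f(2)
    proof eventually_elim
      case (elim x)
      then have "\<bar>f x\<bar> * v n x \<le> (g x / 2) * v n x" using v01(1) by (intro mult_right_mono) (simp_all add: g_def)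
      then show ?case using v01(1)[of n x] by (simp add: abs_mult)
    qed
    have gi: "integrable M (\<lambda>x. g x * v n x / 2)" using gv[of n] by simp
    have fi: "integrable M (\<lambda>x. f x * v n x)"
    proof (rule Bochner_Integration.integrable_bound[OF gi])
      show "(\<lambda>x. f x * v n x) \<in> borel_measurable M"
        by (intro borel_measurable_times f continuous_measurable smooth_continuous_on vs)
      show "AE x in M. norm (f x * v n x) \<le> norm (g x * v n x / 2)"
        using le by eventually_elim simp
    qed
    have "(\<integral>x. f x * v n x \<partial>M) \<le> (\<integral>x. g x * v n x / 2 \<partial>M)"
      by (rule integral_mono_AE[OF fi gi]) (use le in \<open>eventually_elim, simp\<close>)
    then show ?thesis using 1 by simp
  qed
  define w where "w x = exp_bump 0 (u x - W x)" for x
  have g_sq: "square_integrable M g" by (intro continuous_square_integrable smooth_continuous_on g)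
  have diff: "square_integrable M (\<lambda>x. u x - \<phi> n x)" for n
    by (rule square_integrable_diff[OF u \<phi>_square_integrable])
  have gd: "integrable M (\<lambda>x. \<bar>(u x - \<phi> n x) * g x\<bar>)" for n
    by (rule integrable_abs[OF integrable_mult_square_integrable[OF diff g_sq]])
  have w_meas: "w \<in> borel_measurable M"
  proof -
    have "exp_bump 0 \<in> borel_measurable borel"
      using C_k_on_exp_bump[of 0 0] by (intro borel_measurable_continuous_onI) simp
    moreover have "(\<lambda>x. u x - W x) \<in> borel_measurable M"
      by (intro borel_measurable_diff u_measurable continuous_measurable smooth_continuous_on W)
    ultimately show ?thesis unfolding w_def[abs_def] by (rule measurable_compose[rotated])
  qed
  have w01: "0 \<le> w x" "w x \<le> 1" for x by (simp_all add: w_def exp_bump_0_simps)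
  have gw: "integrable M (\<lambda>x. g x * w x)"
  proof (rule Bochner_Integration.integrable_bound)
    show "integrable M g" by (intro continuous_integrable smooth_continuous_on g)
    show "(\<lambda>x. g x * w x) \<in> borel_measurable M"
      by (intro borel_measurable_times w_meas continuous_measurable smooth_continuous_on g)
    show "AE x in M. norm (g x * w x) \<le> norm (g x)"
      using w01 by (intro AE_I2) (simp add: abs_mult mult_left_le)
  qed
  have "(\<integral>x. g x * w x \<partial>M) \<le> 2 * r n + 4 * (\<integral>x. \<bar>(u x - \<phi> n x) * g x\<bar> \<partial>M)" for n
  proof -
    have "(\<integral>x. g x * w x \<partial>M) \<le> (\<integral>x. g x * v n x + 4 * \<bar>(u x - \<phi> n x) * g x\<bar> \<partial>M)"
    proof (rule integral_mono[OF gw])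
      show "integrable M (\<lambda>x. g x * v n x + 4 * \<bar>(u x - \<phi> n x) * g x\<bar>)"
        by (intro Bochner_Integration.integrable_add gv integrable_mult_right gd)
      fix x
      have "w x - v n x \<le> 4 * \<bar>u x - \<phi> n x\<bar>"
        using exp_bump_0_lipschitz[of "u x - W x" "\<phi> n x - W x"] by (simp add: w_def v_def)
      then have "g x * (w x - v n x) \<le> g x * (4 * \<bar>u x - \<phi> n x\<bar>)"
        using g_pos[of x] by (intro mult_left_mono) simp_all
      moreover have "\<bar>(u x - \<phi> n x) * g x\<bar> = g x * \<bar>u x - \<phi> n x\<bar>"
        using g_pos[of x] by (simp add: abs_mult)
      ultimately show "g x * w x \<le> g x * v n x + 4 * \<bar>(u x - \<phi> n x) * g x\<bar>"
        by (simp add: right_diff_distrib[of "g x" "w x"])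
    qed
    also have "\<dots> = (\<integral>x. g x * v n x \<partial>M) + 4 * (\<integral>x. \<bar>(u x - \<phi> n x) * g x\<bar> \<partial>M)"
      using gv[of n] gd[of n] by simp
    finally show ?thesis using gv_le[of n] by simp
  qed
  moreover have "(\<lambda>n. 2 * r n + 4 * (\<integral>x. \<bar>(u x - \<phi> n x) * g x\<bar> \<partial>M)) \<longlonglongrightarrow> 2 * 0 + 4 * 0"
    by (intro tendsto_intros r0 Cauchy_Schwarz_tendsto_0[OF diff g_sq u_lim order_refl])
  ultimately have "(\<integral>x. g x * w x \<partial>M) \<le> 0"
    by (intro LIMSEQ_le_const[of _ 0]) auto
  moreover have gw_nonneg: "AE x in M. 0 \<le> g x * w x"
    using g_pos w01 by (intro AE_I2) (simp add: less_imp_le)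
  ultimately have "(\<integral>x. g x * w x \<partial>M) = 0"
    using integral_nonneg_AE[OF gw_nonneg] by linarith
  then have "AE x in M. g x * w x = 0"
    using integral_nonneg_eq_0_iff_AE[OF gw gw_nonneg] by blast
  then show ?thesis
  proof eventually_elim
    case (elim x)
    then have "w x = 0" using g_pos[of x] by simp
    then show ?case using exp_bump_0_simps(4)[of "u x - W x"] by (force simp: w_def)
  qed
qed

lemma uminus_solution:
  "approximated_weak_solution U (\<lambda>x. - f x) (\<lambda>x. - u x) (\<lambda>x. - Du x) (\<lambda>n x. - \<phi> n x)"
proof
  show "square_integrable M (\<lambda>x. - u x)" using square_integrable_cmult[OF u, of "-1"] by simp
  show "(\<lambda>x. - Du x) \<in> borel_measurable M" using Du_measurable by (rule borel_measurable_uminus)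
  show "square_integrable M (\<lambda>x. norm (- Du x))" using Du by simp
  show "(\<lambda>x. - \<phi> n x) \<in> test_functions U" for n by (rule test_functions_uminus[OF test])
  show "(\<lambda>n. \<integral>x. (- u x - - \<phi> n x)\<^sup>2 \<partial>M) \<longlonglongrightarrow> 0"
    using u_lim by (simp add: power2_commute)
  show "(\<lambda>n. \<integral>x. (norm (- Du x - grad (\<lambda>x. - \<phi> n x) x))\<^sup>2 \<partial>M) \<longlonglongrightarrow> 0"
    using Du_lim by (simp add: grad_uminus[OF \<phi>_smooth] norm_minus_commute)
  show "(\<integral>x. - Du x \<bullet> grad v x \<partial>M) = (\<integral>x. - f x * v x \<partial>M)" if "v \<in> test_functions U" for v
    using tested[OF that] by simp
qed (use U in auto)

lemma comparison_abs:
  assumes "smooth W" "\<And>x. W x > 0" "\<And>x. laplacian W x < 0"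
    and "f \<in> borel_measurable M" "AE x in M. 2 * \<bar>f x\<bar> \<le> - laplacian W x"
  shows "AE x in M. \<bar>u x\<bar> \<le> W x"
proof -
  interpret neg: approximated_weak_solution U "\<lambda>x. - f x" "\<lambda>x. - u x" "\<lambda>x. - Du x" "\<lambda>n x. - \<phi> n x"
    by (rule uminus_solution)
  have "AE x in M. u x \<le> W x" by (rule comparison[OF assms])
  moreover have "AE x in M. - u x \<le> W x"
    by (rule neg.comparison) (use assms in auto)
  ultimately show ?thesis by eventually_elim simp
qed

section \<open>The weighted gradient estimate\<close>

text \<open>The product rule produces \<open>\<psi> \<nabla>\<psi> \<bullet> \<nabla>\<omega>\<close>, which is half of \<open>\<nabla>(\<psi>\<^sup>2) \<bullet> \<nabla>\<omega>\<close>; Green's identity moves the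
remaining derivative to \<open>\<omega>\<close>.\<close>

lemma weighted_energy_identity:
  assumes \<omega>: "smooth \<omega>" "\<And>x. laplacian \<omega> x = c" and \<psi>: "\<psi> \<in> test_functions U"
  shows "(\<integral>x. grad \<psi> x \<bullet> grad (\<lambda>y. \<omega> y * \<psi> y) x \<partial>M)
    = (\<integral>x. \<omega> x * (norm (grad \<psi> x))\<^sup>2 \<partial>M) - c / 2 * (\<integral>x. (\<psi> x)\<^sup>2 \<partial>M)"
proof -
  note s = test_functions_smooth[OF \<psi>]
  have i1: "integrable M (\<lambda>x. \<omega> x * (norm (grad \<psi> x))\<^sup>2)"
    by (intro continuous_integrable continuous_on_mult continuous_on_power continuous_on_norm
        smooth_continuous_on smooth_continuous_on_grad \<omega> s)
  have i2: "integrable M (\<lambda>x. grad \<omega> x \<bullet> grad (\<lambda>y. \<psi> y * \<psi> y) x)"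
    by (intro continuous_integrable continuous_on_inner smooth_continuous_on_grad smooth_mult \<omega> s)
  have "grad \<psi> x \<bullet> grad (\<lambda>y. \<omega> y * \<psi> y) x
      = \<omega> x * (norm (grad \<psi> x))\<^sup>2 + 1 / 2 * (grad \<omega> x \<bullet> grad (\<lambda>y. \<psi> y * \<psi> y) x)" for x
    by (simp add: grad_mult[OF \<omega>(1) s] grad_mult[OF s s] inner_add_right power2_norm_eq_inner
        inner_commute[of "grad \<psi> x" "grad \<omega> x"])
  then have "(\<integral>x. grad \<psi> x \<bullet> grad (\<lambda>y. \<omega> y * \<psi> y) x \<partial>M)
      = (\<integral>x. \<omega> x * (norm (grad \<psi> x))\<^sup>2 \<partial>M) + 1 / 2 * (\<integral>x. grad \<omega> x \<bullet> grad (\<lambda>y. \<psi> y * \<psi> y) x \<partial>M)"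
    using i1 i2 by simp
  also have "(\<integral>x. grad \<omega> x \<bullet> grad (\<lambda>y. \<psi> y * \<psi> y) x \<partial>M) = - (c * (\<integral>x. (\<psi> x)\<^sup>2 \<partial>M))"
    unfolding Green_identity[OF U(2) Us \<omega>(1) test_functions_mult[OF s \<psi>]] by (simp add: \<omega>(2) power2_eq_square)
  finally show ?thesis by simp
qed

text \<open>The energy identity is applied to the approximations \<open>\<phi>\<^sub>n\<close> with the test functions \<open>\<omega> \<phi>\<^sub>n\<close>. Apart from the
residual its right side contains no derivatives of \<open>\<phi>\<^sub>n\<close> and passes to the limit; the left side needs no limit,
because \<open>2 |\<nabla>\<phi>\<^sub>n| \<le> \<omega> |\<nabla>\<phi>\<^sub>n|\<^sup>2 + 1 / \<omega>\<close> is used for each \<open>n\<close>.\<close>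

lemma weighted_gradient_estimate:
  assumes \<omega>: "smooth \<omega>" "\<And>x. laplacian \<omega> x = c" "\<And>x. \<omega> x > 0"
    and f: "square_integrable M f"
  shows "2 * (\<integral>x. norm (Du x) \<partial>M) \<le>
    c / 2 * (\<integral>x. (u x)\<^sup>2 \<partial>M) + (\<integral>x. \<omega> x * f x * u x \<partial>M) + (\<integral>x. 1 / \<omega> x \<partial>M)"
proof -
  define v where "v n x = \<omega> x * \<phi> n x" for n x
  have v: "v n \<in> test_functions U" for n
    unfolding v_def[abs_def] by (rule test_functions_mult[OF \<omega>(1) test])
  have "\<exists>K. \<forall>x\<in>U. \<omega> x \<le> K \<and> norm (grad \<omega> x) \<le> K"
  proof -
    have "compact (closure U)" using U(2) by simp
    then have "bounded (\<omega> ` closure U)" "bounded (grad \<omega> ` closure U)"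
      using smooth_continuous_on[OF \<omega>(1)] smooth_continuous_on_grad[OF \<omega>(1)]
      by (simp_all only: compact_imp_bounded compact_continuous_image)
    then obtain K1 K2 where K: "\<forall>y\<in>\<omega> ` closure U. norm y \<le> K1" "\<forall>y\<in>grad \<omega> ` closure U. norm y \<le> K2"
      unfolding bounded_iff by (elim exE)
    have "\<omega> x \<le> max K1 K2 \<and> norm (grad \<omega> x) \<le> max K1 K2" if "x \<in> U" for x
    proof -
      have "x \<in> closure U" using that closure_subset by blast
      then have "norm (\<omega> x) \<le> K1" "norm (grad \<omega> x) \<le> K2" using K by simp_all
      then show ?thesis by (simp add: le_max_iff_disj abs_le_iff)
    qed
    then show ?thesis by blast
  qed
  then obtain K where "\<forall>x\<in>U. \<omega> x \<le> K \<and> norm (grad \<omega> x) \<le> K" by (elim exE)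
  then have K: "\<omega> x \<le> K" "norm (grad \<omega> x) \<le> K" if "x \<in> U" for x using that by simp_all
  obtain B where "\<forall>n. (\<integral>x. (norm (grad (\<phi> n) x))\<^sup>2 \<partial>M) \<le> B"
    using grad_\<phi>_bounded by (elim exE)
  then have B: "(\<integral>x. (norm (grad (\<phi> n) x))\<^sup>2 \<partial>M) \<le> B" for n by simp
  obtain B' where "\<forall>n. (\<integral>x. (\<phi> n x)\<^sup>2 \<partial>M) \<le> B'"
    using \<phi>_bounded by (elim exE)
  then have B': "(\<integral>x. (\<phi> n x)\<^sup>2 \<partial>M) \<le> B'" for n by simp
  have dv_bound: "(\<integral>x. (norm (grad (v n) x))\<^sup>2 \<partial>M) \<le> 2 * (K\<^sup>2 * B) + 2 * (K\<^sup>2 * B')" for n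
  proof -
    have "(\<integral>x. (norm (grad (v n) x))\<^sup>2 \<partial>M) \<le> 2 * (\<integral>x. (K * norm (grad (\<phi> n) x))\<^sup>2 \<partial>M) + 2 * (\<integral>x. (K * \<phi> n x)\<^sup>2 \<partial>M)"
    proof (rule square_integral_le_twice)
      show "square_integrable M (\<lambda>x. norm (grad (v n) x))"
        by (rule grad_square_integrable[OF test_functions_smooth[OF v]])
      show "square_integrable M (\<lambda>x. K * norm (grad (\<phi> n) x))"
        by (rule square_integrable_cmult[OF grad_square_integrable[OF \<phi>_smooth]])
      show "square_integrable M (\<lambda>x. K * \<phi> n x)"
        by (rule square_integrable_cmult[OF \<phi>_square_integrable])
      fix x
      show "\<bar>norm (grad (v n) x)\<bar> \<le> \<bar>K * norm (grad (\<phi> n) x)\<bar> + \<bar>K * \<phi> n x\<bar>"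
      proof (cases "x \<in> U")
        case True
        have "grad (v n) x = \<omega> x *\<^sub>R grad (\<phi> n) x + \<phi> n x *\<^sub>R grad \<omega> x"
          unfolding v_def[abs_def] by (rule grad_mult[OF \<omega>(1) \<phi>_smooth])
        then have "norm (grad (v n) x) \<le> \<omega> x * norm (grad (\<phi> n) x) + \<bar>\<phi> n x\<bar> * norm (grad \<omega> x)"
          using norm_triangle_ineq[of "\<omega> x *\<^sub>R grad (\<phi> n) x" "\<phi> n x *\<^sub>R grad \<omega> x"] \<omega>(3)[of x] by simp
        also have "\<dots> \<le> K * norm (grad (\<phi> n) x) + \<bar>\<phi> n x\<bar> * K"
          using K[OF True] by (intro add_mono mult_right_mono mult_left_mono) simp_all
        finally show ?thesis using K(1)[OF True] \<omega>(3)[of x] by (simp add: abs_mult mult.commute)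
      next
        case False
        then show ?thesis by (simp add: test_functions_grad_zero[OF v])
      qed
    qed
    also have "\<dots> = 2 * (K\<^sup>2 * (\<integral>x. (norm (grad (\<phi> n) x))\<^sup>2 \<partial>M)) + 2 * (K\<^sup>2 * (\<integral>x. (\<phi> n x)\<^sup>2 \<partial>M))"
      by (simp add: power_mult_distrib)
    also have "\<dots> \<le> 2 * (K\<^sup>2 * B) + 2 * (K\<^sup>2 * B')"
      using B[of n] B'[of n] by (intro add_mono mult_left_mono) simp_all
    finally show ?thesis .
  qed
  define r where "r n = (\<integral>x. grad (\<phi> n) x \<bullet> grad (v n) x \<partial>M) - (\<integral>x. f x * v n x \<partial>M)" for n
  have r0: "r \<longlonglongrightarrow> 0" unfolding r_def[abs_def] by (rule residual_tendsto_0[OF v dv_bound])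
  define E where "E n = (\<integral>x. \<omega> x * (norm (grad (\<phi> n) x))\<^sup>2 \<partial>M)" for n
  have \<omega>f: "square_integrable M (\<lambda>x. \<omega> x * f x)"
  proof (rule square_integrable_bound[OF square_integrable_cmult[OF f, of K]])
    show "(\<lambda>x. \<omega> x * f x) \<in> borel_measurable M"
      using f continuous_measurable[OF smooth_continuous_on[OF \<omega>(1)]]
      unfolding square_integrable_def by (intro borel_measurable_times) simp_all
    show "AE x in M. \<bar>\<omega> x * f x\<bar> \<le> \<bar>K * f x\<bar>"
    proof (rule AE_I2)
      fix x assume "x \<in> space M"
      then have "x \<in> U" by (simp add: space_restrict_space)
      then have "\<omega> x * \<bar>f x\<bar> \<le> K * \<bar>f x\<bar>" using K(1) by (intro mult_right_mono) simp_all
      then show "\<bar>\<omega> x * f x\<bar> \<le> \<bar>K * f x\<bar>" using \<omega>(3)[of x] K(1)[OF \<open>x \<in> U\<close>] by (simp add: abs_mult)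
    qed
  qed
  have E_eq: "E n = c / 2 * (\<integral>x. (\<phi> n x)\<^sup>2 \<partial>M) + (\<integral>x. \<omega> x * f x * \<phi> n x \<partial>M) + r n" for n
  proof -
    have "(\<integral>x. grad (\<phi> n) x \<bullet> grad (v n) x \<partial>M) = E n - c / 2 * (\<integral>x. (\<phi> n x)\<^sup>2 \<partial>M)"
      unfolding E_def v_def[abs_def] by (rule weighted_energy_identity[OF \<omega>(1,2) test])
    moreover have "(\<integral>x. f x * v n x \<partial>M) = (\<integral>x. \<omega> x * f x * \<phi> n x \<partial>M)"
      by (simp add: v_def mult_ac)
    ultimately show ?thesis by (simp add: r_def)
  qed
  have "(\<lambda>n. c / 2 * (\<integral>x. (\<phi> n x)\<^sup>2 \<partial>M) + (\<integral>x. \<omega> x * f x * \<phi> n x \<partial>M) + r n)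
      \<longlonglongrightarrow> c / 2 * (\<integral>x. (u x)\<^sup>2 \<partial>M) + (\<integral>x. \<omega> x * f x * u x \<partial>M) + 0"
    by (intro tendsto_add tendsto_mult tendsto_const u_square_lim u_weak_lim[OF \<omega>f] r0)
  then have E_lim: "E \<longlonglongrightarrow> c / 2 * (\<integral>x. (u x)\<^sup>2 \<partial>M) + (\<integral>x. \<omega> x * f x * u x \<partial>M)"
    unfolding E_eq[symmetric] by simp
  have c1: "continuous_on UNIV (\<lambda>x. 1 / \<omega> x)"
    using \<omega>(3) by (intro continuous_on_divide continuous_on_const smooth_continuous_on \<omega>(1)) (metis less_irrefl)
  have one: "square_integrable M (\<lambda>_. 1)" by (intro continuous_square_integrable continuous_on_const)
  have dlim: "(\<lambda>n. \<integral>x. \<bar>norm (Du x - grad (\<phi> n) x) * 1\<bar> \<partial>M) \<longlonglongrightarrow> 0"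
    by (rule Cauchy_Schwarz_tendsto_0[OF Du_diff_square_integrable one Du_lim order_refl])
  have Dui: "integrable M (\<lambda>x. norm (Du x))"
    using integrable_mult_square_integrable[OF Du one] by simp
  have "2 * (\<integral>x. norm (Du x) \<partial>M) \<le> 2 * (\<integral>x. \<bar>norm (Du x - grad (\<phi> n) x) * 1\<bar> \<partial>M) + E n + (\<integral>x. 1 / \<omega> x \<partial>M)" for n
  proof -
    have i1: "integrable M (\<lambda>x. \<bar>norm (Du x - grad (\<phi> n) x) * 1\<bar>)"
      by (intro integrable_abs integrable_mult_square_integrable Du_diff_square_integrable one)
    have i2: "integrable M (\<lambda>x. \<omega> x * (norm (grad (\<phi> n) x))\<^sup>2)"
      by (intro continuous_integrable continuous_on_mult continuous_on_power continuous_on_norm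
          smooth_continuous_on smooth_continuous_on_grad \<omega> \<phi>_smooth)
    have i3: "integrable M (\<lambda>x. 1 / \<omega> x)" by (rule continuous_integrable[OF c1])
    have "(\<integral>x. 2 * norm (Du x) \<partial>M)
        \<le> (\<integral>x. 2 * \<bar>norm (Du x - grad (\<phi> n) x) * 1\<bar> + \<omega> x * (norm (grad (\<phi> n) x))\<^sup>2 + 1 / \<omega> x \<partial>M)"
    proof (rule integral_mono)
      show "integrable M (\<lambda>x. 2 * norm (Du x))" using Dui by simp
      show "integrable M (\<lambda>x. 2 * \<bar>norm (Du x - grad (\<phi> n) x) * 1\<bar> + \<omega> x * (norm (grad (\<phi> n) x))\<^sup>2 + 1 / \<omega> x)"
        by (intro Bochner_Integration.integrable_add integrable_mult_right i1 i2 i3)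
      fix x
      let ?a = "norm (grad (\<phi> n) x)"
      have "0 \<le> (\<omega> x * ?a - 1)\<^sup>2 / \<omega> x" using \<omega>(3)[of x] by simp
      also have "\<dots> = \<omega> x * ?a\<^sup>2 + 1 / \<omega> x - 2 * ?a"
        using \<omega>(3)[of x] by (simp add: field_simps power2_eq_square)
      finally have "2 * ?a \<le> \<omega> x * ?a\<^sup>2 + 1 / \<omega> x" by simp
      moreover have "norm (Du x) \<le> norm (Du x - grad (\<phi> n) x) + ?a"
        using norm_triangle_sub[of "Du x" "grad (\<phi> n) x"] by simp
      ultimately show "2 * norm (Du x)
          \<le> 2 * \<bar>norm (Du x - grad (\<phi> n) x) * 1\<bar> + \<omega> x * (norm (grad (\<phi> n) x))\<^sup>2 + 1 / \<omega> x"
        by simp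
    qed
    also have "\<dots> = 2 * (\<integral>x. \<bar>norm (Du x - grad (\<phi> n) x) * 1\<bar> \<partial>M) + E n + (\<integral>x. 1 / \<omega> x \<partial>M)"
      using i1 i2 i3 unfolding E_def by simp
    finally show ?thesis by simp
  qed
  moreover have "(\<lambda>n. 2 * (\<integral>x. \<bar>norm (Du x - grad (\<phi> n) x) * 1\<bar> \<partial>M) + E n + (\<integral>x. 1 / \<omega> x \<partial>M))
      \<longlonglongrightarrow> 2 * 0 + (c / 2 * (\<integral>x. (u x)\<^sup>2 \<partial>M) + (\<integral>x. \<omega> x * f x * u x \<partial>M)) + (\<integral>x. 1 / \<omega> x \<partial>M)"
    by (intro tendsto_add tendsto_mult tendsto_const dlim E_lim)
  ultimately have "2 * (\<integral>x. norm (Du x) \<partial>M)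
      \<le> 2 * 0 + (c / 2 * (\<integral>x. (u x)\<^sup>2 \<partial>M) + (\<integral>x. \<omega> x * f x * u x \<partial>M)) + (\<integral>x. 1 / \<omega> x \<partial>M)"
    by (intro LIMSEQ_le_const) auto
  then show ?thesis by simp
qed

end

section \<open>The regularized fundamental solution in dimension three\<close>

definition shifted_square :: "real \<Rightarrow> 'a::euclidean_space \<Rightarrow> 'a \<Rightarrow> real" where
  "shifted_square h z x = (norm (x - z))\<^sup>2 + h\<^sup>2"

lemma shifted_square_pos: "h > 0 \<Longrightarrow> shifted_square h z x > 0"
  unfolding shifted_square_def by (intro add_nonneg_pos) simp_all

lemma smooth_shifted_square: "smooth (shifted_square h z)"
proof -
  have "shifted_square h z = (\<lambda>x. (\<Sum>b\<in>Basis. (x \<bullet> b - z \<bullet> b) * (x \<bullet> b - z \<bullet> b)) + h\<^sup>2)"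
    unfolding shifted_square_def power2_norm_eq_inner euclidean_inner[of "_ - z" "_ - z"]
    by (simp add: inner_diff_left)
  then show ?thesis
    by (simp only:) (intro smooth_add smooth_sum smooth_mult smooth_diff smooth_inner smooth_const finite_Basis)
qed

lemma grad_shifted_square: "grad (shifted_square h z) x = 2 *\<^sub>R (x - z)"
proof (rule grad_eqI)
  have "((\<lambda>x. (x - z) \<bullet> (x - z) + h\<^sup>2) has_derivative (\<lambda>v. (2 *\<^sub>R (x - z)) \<bullet> v)) (at x)"
    by (auto intro!: derivative_eq_intros simp: inner_commute)
  then show "(shifted_square h z has_derivative (\<lambda>v. (2 *\<^sub>R (x - z)) \<bullet> v)) (at x)"
    by (simp add: shifted_square_def[abs_def] power2_norm_eq_inner)
qed

lemma grad_inner_const: "grad (\<lambda>x. (x - z) \<bullet> b) x = b"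
  by (rule grad_eqI) (auto intro!: derivative_eq_intros simp: inner_commute)

lemma smooth_inner_diff: "smooth (\<lambda>x. (x - z) \<bullet> b)"
  unfolding inner_diff_left by (intro smooth_diff smooth_inner smooth_const)

lemma laplacian_shifted_square:
  "laplacian (shifted_square h (z :: 'a::euclidean_space)) x = 2 * real DIM('a)"
proof -
  have "grad (\<lambda>y. grad (shifted_square h z) y \<bullet> b) x \<bullet> b = 2" if "b \<in> Basis" for b
  proof -
    have "grad (\<lambda>y. 2 * ((y - z) \<bullet> b)) x = 2 *\<^sub>R grad (\<lambda>y. (y - z) \<bullet> b) x + ((x - z) \<bullet> b) *\<^sub>R grad (\<lambda>_. 2) x"
      by (rule grad_mult[OF smooth_const smooth_inner_diff])
    moreover have "grad (\<lambda>_::'a. 2::real) x = 0" by (simp add: grad_def)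
    ultimately show ?thesis using that by (simp add: grad_shifted_square grad_inner_const)
  qed
  then show ?thesis by (simp add: laplacian_def)
qed

text \<open>In dimension three \<open>|x - z|\<^sup>-\<^sup>1\<close> is harmonic away from \<open>z\<close>; the shift by \<open>h\<^sup>2\<close> leaves a negative
Laplacian with the mass concentrated at distance of order \<open>h\<close> from \<open>z\<close>. The terms with
\<open>\<omega>\<^sup>-\<^sup>3\<^sup>/\<^sup>2\<close> and \<open>|x - z|\<^sup>2 \<omega>\<^sup>-\<^sup>5\<^sup>/\<^sup>2\<close> have opposite coefficients because the trace of the identity is three.\<close>

lemma laplacian_barrier:
  fixes z :: "'a::euclidean_space" and K h :: real
  assumes h: "h > 0" and dim: "DIM('a) = 3"
  defines "W \<equiv> \<lambda>x. K * shifted_square h z x powr (- 1 / 2)"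
  shows "smooth W" "laplacian W x = - 3 * K * h\<^sup>2 * shifted_square h z x powr (- 5 / 2)"
proof -
  let ?\<omega> = "shifted_square h z"
  note pos = shifted_square_pos[OF h, of z]
  have sp: "smooth (\<lambda>x. c * ?\<omega> x powr a)" for a c
    by (intro smooth_mult smooth_const smooth_powr smooth_shifted_square pos)
  show "smooth W" unfolding W_def by (rule sp)
  have gp: "grad (\<lambda>x. c * ?\<omega> x powr a) x = (2 * c * a * ?\<omega> x powr (a - 1)) *\<^sub>R (x - z)" for a c x
  proof -
    have "((\<lambda>t. c * t powr a) has_real_derivative c * (a * ?\<omega> x powr (a - 1))) (at (?\<omega> x))"
      by (intro DERIV_cmult has_real_derivative_powr pos)
    from grad_comp[OF smooth_shifted_square this] show ?thesis
      by (simp add: grad_shifted_square mult_ac)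
  qed
  have gW: "grad W y \<bullet> b = (- K * ?\<omega> y powr (- 3 / 2)) * ((y - z) \<bullet> b)" for y b
    unfolding W_def gp by simp
  have term_eq: "grad (\<lambda>y. grad W y \<bullet> b) x \<bullet> b
      = - K * ?\<omega> x powr (- 3 / 2) + 3 * K * ?\<omega> x powr (- 5 / 2) * (((x - z) \<bullet> b) * ((x - z) \<bullet> b))"
    if "b \<in> Basis" for b
  proof -
    have eq: "grad (\<lambda>y. grad W y \<bullet> b) x = (- K * ?\<omega> x powr (- 3 / 2)) *\<^sub>R b
        + ((x - z) \<bullet> b) *\<^sub>R ((3 * K * ?\<omega> x powr (- 5 / 2)) *\<^sub>R (x - z))"
      unfolding gW grad_mult[OF sp smooth_inner_diff] grad_inner_const gp by simp
    show ?thesis unfolding eq inner_add_left inner_scaleR_left using that by (simp add: mult_ac)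
  qed
  have "laplacian W x = (\<Sum>b\<in>Basis. - K * ?\<omega> x powr (- 3 / 2)
      + 3 * K * ?\<omega> x powr (- 5 / 2) * (((x - z) \<bullet> b) * ((x - z) \<bullet> b)))"
    unfolding laplacian_def by (intro sum.cong refl term_eq)
  also have "\<dots> = - 3 * K * ?\<omega> x powr (- 3 / 2)
      + 3 * K * ?\<omega> x powr (- 5 / 2) * ((x - z) \<bullet> (x - z))"
    unfolding sum.distrib euclidean_inner[of "x - z" "x - z"] sum_distrib_left by (simp add: dim)
  also have "?\<omega> x powr (- 3 / 2) = ?\<omega> x powr (- 5 / 2) * ?\<omega> x"
    using pos[of x] powr_mult_base[of "?\<omega> x" "- 5 / 2"] by (simp add: mult.commute)
  also have "- 3 * K * (?\<omega> x powr (- 5 / 2) * ?\<omega> x) + 3 * K * ?\<omega> x powr (- 5 / 2) * ((x - z) \<bullet> (x - z))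
      = - 3 * K * ?\<omega> x powr (- 5 / 2) * (?\<omega> x - (x - z) \<bullet> (x - z))"
    by (simp add: algebra_simps)
  also have "?\<omega> x - (x - z) \<bullet> (x - z) = h\<^sup>2"
    by (simp add: shifted_square_def power2_norm_eq_inner)
  finally show "laplacian W x = - 3 * K * h\<^sup>2 * ?\<omega> x powr (- 5 / 2)" by (simp add: mult_ac)
qed

text \<open>The smallest ball of radius \<open>R / 2\<^sup>k\<close> about the origin that contains a point at distance \<open>r\<close> has radius
less than \<open>2 r\<close>.\<close>

lemma inverse_square_dyadic_bound:
  fixes r R :: real
  assumes "0 < r" "r \<le> R"
  shows "\<exists>k. r \<le> R / 2 ^ k \<and> 1 / r\<^sup>2 \<le> 4 ^ Suc k / R\<^sup>2"
proof -
  have R: "R > 0" using assms by simp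
  define P where "P k \<longleftrightarrow> R / 2 ^ k < r" for k :: nat
  \<comment> \<open>The first radius below \<open>r\<close>; its predecessor is the one sought.\<close>
  have "\<exists>k. P k"
  proof -
    obtain k where "R / r < 2 ^ k" using real_arch_pow[of 2 "R / r"] by auto
    then show ?thesis unfolding P_def using assms(1) by (intro exI[of _ k]) (simp add: field_simps)
  qed
  then have least: "P (LEAST k. P k)" "\<And>j. j < (LEAST k. P k) \<Longrightarrow> \<not> P j"
    by (auto intro: LeastI_ex dest: not_less_Least)
  have "\<not> P 0" using assms by (simp add: P_def)
  then obtain k where k: "(LEAST k. P k) = Suc k" using least(1) by (cases "LEAST k. P k") auto
  have 1: "r \<le> R / 2 ^ k" using least(2)[of k] k by (simp add: P_def)
  have "R / 2 ^ Suc k < r" using least(1) unfolding k by (simp add: P_def)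
  then have "(R / 2 ^ Suc k)\<^sup>2 \<le> r\<^sup>2" using R by (intro power_mono) simp_all
  moreover have "(R / 2 ^ Suc k)\<^sup>2 = R\<^sup>2 / 4 ^ Suc k"
    by (simp only: power_divide power_mult[symmetric] mult.commute[of "Suc k"]) (simp add: power_mult)
  ultimately have "R\<^sup>2 / 4 ^ Suc k \<le> r\<^sup>2" by simp
  then have "1 / r\<^sup>2 \<le> 1 / (R\<^sup>2 / 4 ^ Suc k)" using R assms(1) by (intro divide_left_mono) simp_all
  with 1 show ?thesis by auto
qed

text \<open>The integrand is dominated by the sum over \<open>k\<close> of the constants \<open>4\<^sup>k\<^sup>+\<^sup>1 / R\<^sup>2\<close> on the concentric balls
of radius \<open>R / 2\<^sup>k\<close>, whose volumes are proportional to \<open>R\<^sup>3 / 8\<^sup>k\<close>: a geometric series.\<close>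

lemma inverse_square_nn_integral_bound:
  fixes z :: "'a::euclidean_space"
  assumes dim: "DIM('a) = 3" and R: "R > 0"
  shows "(\<integral>\<^sup>+x. indicator (cball z R) x * ennreal (1 / (norm (x - z))\<^sup>2) \<partial>lborel)
    \<le> ennreal (8 * unit_ball_vol 3 * R)"
proof -
  let ?c = "\<lambda>k::nat. ennreal (4 ^ Suc k / R\<^sup>2)"
  define g where "g k x = ?c k * indicator (cball z (R / 2 ^ k)) x" for k x
  have "AE x in lborel. x \<noteq> z" by (rule AE_lborel_singleton)
  then have "AE x in lborel. indicator (cball z R) x * ennreal (1 / (norm (x - z))\<^sup>2) \<le> (\<Sum>k. g k x)"
  proof eventually_elim
    case (elim x)
    show ?case
    proof (cases "x \<in> cball z R")
      case True
      then have "norm (x - z) \<le> R" by (simp add: dist_norm norm_minus_commute)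
      then obtain k where k: "norm (x - z) \<le> R / 2 ^ k" "1 / (norm (x - z))\<^sup>2 \<le> 4 ^ Suc k / R\<^sup>2"
        using inverse_square_dyadic_bound[of "norm (x - z)" R] elim by auto
      have "ennreal (1 / (norm (x - z))\<^sup>2) \<le> g k x"
        using k by (simp add: g_def dist_norm norm_minus_commute ennreal_leI)
      also have "\<dots> = (\<Sum>j\<in>{k}. g j x)" by simp
      also have "\<dots> \<le> (\<Sum>k. g k x)" by (rule sum_le_suminf) auto
      finally show ?thesis using True by simp
    qed simp
  qed
  then have "(\<integral>\<^sup>+x. indicator (cball z R) x * ennreal (1 / (norm (x - z))\<^sup>2) \<partial>lborel)
      \<le> (\<integral>\<^sup>+x. (\<Sum>k. g k x) \<partial>lborel)" by (rule nn_integral_mono_AE)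
  also have "\<dots> = (\<Sum>k. \<integral>\<^sup>+x. g k x \<partial>lborel)" 
  proof (rule nn_integral_suminf)
    fix k
    have [measurable]: "cball z (R / 2 ^ k) \<in> sets borel" by simp
    show "g k \<in> borel_measurable lborel" unfolding g_def by measurable
  qed
  also have "\<dots> = (\<Sum>k. ennreal (4 * unit_ball_vol 3 * R * (1 / 2) ^ k))"
  proof (rule suminf_cong)
    fix k
    have "(\<integral>\<^sup>+x. g k x \<partial>lborel) = ?c k * emeasure lborel (cball z (R / 2 ^ k))"
      unfolding g_def by (rule nn_integral_cmult_indicator) simp
    also have "\<dots> = ?c k * ennreal (unit_ball_vol 3 * (R / 2 ^ k) ^ 3)"
      using R by (subst emeasure_cball) (simp_all add: dim)
    also have "\<dots> = ennreal (4 ^ Suc k / R\<^sup>2 * (unit_ball_vol 3 * (R / 2 ^ k) ^ 3))"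
      using R by (intro ennreal_mult[symmetric]) simp_all
    also have "4 ^ Suc k / R\<^sup>2 * (unit_ball_vol 3 * (R / 2 ^ k) ^ 3) = 4 * unit_ball_vol 3 * R * (1 / 2) ^ k"
    proof -
      have p: "(2 ^ k) ^ 3 = (4::real) ^ k * 2 ^ k"
        by (simp add: power_mult_distrib[symmetric] power3_eq_cube)
      have "R \<noteq> 0" using R by simp
      then show ?thesis
        by (simp add: power_divide p) (simp add: field_simps power2_eq_square power3_eq_cube)
    qed
    finally show "(\<integral>\<^sup>+x. g k x \<partial>lborel) = ennreal (4 * unit_ball_vol 3 * R * (1 / 2) ^ k)" .
  qed
  also have "\<dots> = ennreal (\<Sum>k. 4 * unit_ball_vol 3 * R * (1 / 2) ^ k)"
    using R by (intro suminf_ennreal2) (auto intro!: summable_mult summable_geometric)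
  also have "(\<Sum>k. 4 * unit_ball_vol 3 * R * (1 / 2) ^ k) = 8 * unit_ball_vol 3 * R"
    using suminf_mult[OF summable_geometric[of "1 / 2 :: real"], of "4 * unit_ball_vol 3 * R"]
      suminf_geometric[of "1 / 2 :: real"] by simp
  finally show ?thesis .
qed

lemma inverse_shifted_square_integral_bound:
  fixes U :: "'a::euclidean_space set"
  assumes dim: "DIM('a) = 3" and U: "open U" "bounded U" and z: "z \<in> U" and h: "h > 0"
  shows "(\<integral>x. 1 / shifted_square h z x \<partial>lebesgue_on U) \<le> 8 * unit_ball_vol 3 * (diameter U + 1)"
proof -
  let ?R = "diameter U + 1"
  have Us: "U \<in> sets lebesgue" using U by simp
  have R: "?R > 0" using diameter_ge_0[OF U(2)] by simp
  note pos = shifted_square_pos[OF h, of z]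
  have c: "continuous_on UNIV (\<lambda>x. 1 / shifted_square h z x)"
    using pos by (intro continuous_on_divide continuous_on_const smooth_continuous_on smooth_shifted_square)
      (metis less_irrefl)
  have i: "integrable (lebesgue_on U) (\<lambda>x. 1 / shifted_square h z x)"
    by (rule continuous_integrable_lebesgue_on[OF U(2) Us c])
  have "ennreal (\<integral>x. 1 / shifted_square h z x \<partial>lebesgue_on U) = (\<integral>\<^sup>+x. ennreal (1 / shifted_square h z x) \<partial>lebesgue_on U)"
    by (rule nn_integral_eq_integral[symmetric, OF i]) (simp add: less_imp_le[OF pos])
  also have "\<dots> = (\<integral>\<^sup>+x. ennreal (1 / shifted_square h z x) * indicator U x \<partial>lebesgue)"
    using Us by (intro nn_integral_restrict_space) simp
  also have "\<dots> \<le> (\<integral>\<^sup>+x. indicator (cball z ?R) x * ennreal (1 / (norm (x - z))\<^sup>2) \<partial>lebesgue)"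
  proof (rule nn_integral_mono_AE)
    have "AE x in lborel. x \<noteq> z" by (rule AE_lborel_singleton)
    then have "AE x in lebesgue. x \<noteq> z" by (rule AE_completion)
    then show "AE x in lebesgue. ennreal (1 / shifted_square h z x) * indicator U x
        \<le> indicator (cball z ?R) x * ennreal (1 / (norm (x - z))\<^sup>2)"
    proof eventually_elim
      case (elim x)
      show ?case
      proof (cases "x \<in> U")
        case True
        have "dist z x \<le> diameter U" by (rule diameter_bounded_bound[OF U(2) z True])
        moreover have "1 / shifted_square h z x \<le> 1 / (norm (x - z))\<^sup>2"
          using elim by (intro divide_left_mono) (simp_all add: shifted_square_def add_pos_nonneg)
        ultimately show ?thesis using True by (simp add: ennreal_leI)
      qed simp
    qed
  qed
  also have "\<dots> = (\<integral>\<^sup>+x. indicator (cball z ?R) x * ennreal (1 / (norm (x - z))\<^sup>2) \<partial>lborel)"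
    by (rule nn_integral_completion)
  also have "\<dots> \<le> ennreal (8 * unit_ball_vol 3 * ?R)"
    by (rule inverse_square_nn_integral_bound[OF dim R])
  finally show ?thesis
    using R by (subst (asm) ennreal_le_iff) auto
qed

section \<open>The uniform gradient bound\<close>

lemma approximated_weak_solutionI:
  fixes U :: "'a::euclidean_space set"
  assumes U: "open U" "bounded U" and sol: "solves_dirichlet_poisson U f u"
  obtains \<phi> where "approximated_weak_solution U f u (weak_grad U u) \<phi>"
proof -
  have u: "u \<in> H1_0 U" using sol by (simp add: solves_dirichlet_poisson_def)
  note H1 = H1_0_square_integrable[OF u]
  obtain \<phi> where \<phi>: "\<And>n::nat. \<phi> n \<in> test_functions U"
    "(\<lambda>n. \<integral>x. (u x - \<phi> n x)\<^sup>2 \<partial>lebesgue_on U) \<longlonglongrightarrow> 0"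
    "(\<lambda>n. \<integral>x. (norm (weak_grad U u x - grad (\<phi> n) x))\<^sup>2 \<partial>lebesgue_on U) \<longlonglongrightarrow> 0"
    by (rule H1_0_approximation[OF U u]) (rule that)
  have "square_integrable (lebesgue_on U) u" using H1(1,2) by (simp add: square_integrable_def)
  moreover have "square_integrable (lebesgue_on U) (\<lambda>x. norm (weak_grad U u x))"
    using H1(4) measurable_compose[OF H1(3) borel_measurable_norm] by (simp add: square_integrable_def)
  ultimately have "approximated_weak_solution U f u (weak_grad U u) \<phi>"
    using U H1(3) \<phi> solves_dirichlet_poisson_tested[OF U sol] by unfold_locales
  then show ?thesis by (rule that)
qed

text \<open>The support and size of \<open>f\<close> enter only through the barrier. On the support \<open>\<omega> \<le> (B\<^sup>2 + 1) h\<^sup>2\<close>, so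
\<open>-\<Delta>W \<ge> 3 K (B\<^sup>2 + 1)\<^sup>-\<^sup>5\<^sup>/\<^sup>2 h\<^sup>-\<^sup>3\<close>, and the choice of \<open>K\<close> makes this \<open>3 (A + 1) h\<^sup>-\<^sup>3 \<ge> 2 |f|\<close>;
taking \<open>A + 1\<close> instead of \<open>A\<close> keeps \<open>K\<close> positive. What remains are multiples of the integral of
\<open>1 / \<omega>\<close>.\<close>

lemma gradient_L1_bound:
  fixes U :: "'a::euclidean_space set" and f :: "'a \<Rightarrow> real"
  assumes dim: "DIM('a) = 3" and U: "open U" "bounded U" and sol: "solves_dirichlet_poisson U f u"
    and z: "z \<in> U" and h: "h > 0" and A: "A \<ge> 0" and B: "B \<ge> 1"
    and f: "f \<in> borel_measurable (lebesgue_on U)"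
    and f_bound: "AE x in lebesgue_on U. \<bar>f x\<bar> \<le> A * h powr (-3)"
    and f_support: "\<And>x. f x \<noteq> 0 \<Longrightarrow> norm (x - z) \<le> B * h"
  shows "integrable (lebesgue_on U) (\<lambda>x. norm (weak_grad U u x))"
    and "(\<integral>x. norm (weak_grad U u x) \<partial>lebesgue_on U)
      \<le> (5 * ((A + 1) * (B\<^sup>2 + 1) powr (5 / 2))\<^sup>2 + 1) * (8 * unit_ball_vol 3 * (diameter U + 1))"
proof -
  obtain \<phi> where "approximated_weak_solution U f u (weak_grad U u) \<phi>"
    by (rule approximated_weak_solutionI[OF U sol])
  then interpret approximated_weak_solution U f u "weak_grad U u" \<phi> .
  have one: "square_integrable M (\<lambda>_. 1)" by (intro continuous_square_integrable continuous_on_const)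
  show "integrable M (\<lambda>x. norm (weak_grad U u x))"
    using integrable_mult_square_integrable[OF Du one] by simp
  define K where "K = (A + 1) * (B\<^sup>2 + 1) powr (5 / 2)"
  define \<omega> where "\<omega> = shifted_square h z"
  define W where "W x = K * \<omega> x powr (- 1 / 2)" for x
  have B1: "B\<^sup>2 + 1 > 0" by (intro add_nonneg_pos) simp_all
  have K: "K > 0" unfolding K_def using A B1 by simp
  have pos: "\<omega> x > 0" for x unfolding \<omega>_def by (rule shifted_square_pos[OF h])
  have h_le: "h\<^sup>2 \<le> \<omega> x" for x by (simp add: \<omega>_def shifted_square_def)
  have W: "smooth W" "laplacian W x = - 3 * K * h\<^sup>2 * \<omega> x powr (- 5 / 2)" for x
    using laplacian_barrier[OF h dim, of K z] unfolding W_def[abs_def] \<omega>_def by auto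
  have f_le: "AE x in M. 2 * \<bar>f x\<bar> \<le> - laplacian W x"
    using f_bound
  proof eventually_elim
    case (elim x)
    show ?case
    proof (cases "f x = 0")
      case True
      then show ?thesis using K pos[of x] by (simp add: W)
    next
      case False
      then have "(norm (x - z))\<^sup>2 \<le> (B * h)\<^sup>2" using f_support by (intro power_mono) simp_all
      then have \<omega>_le: "\<omega> x \<le> (B\<^sup>2 + 1) * h\<^sup>2"
        by (simp add: \<omega>_def shifted_square_def power_mult_distrib algebra_simps)
      have "(B\<^sup>2 + 1) powr (- 5 / 2) * h powr (- 5) = ((B\<^sup>2 + 1) * h\<^sup>2) powr (- 5 / 2)"
        using h B1 by (simp add: powr_mult powr_powr flip: powr_numeral)
      also have "\<dots> \<le> \<omega> x powr (- 5 / 2)" by (rule powr_mono2'[OF _ pos \<omega>_le]) simp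
      finally have le: "3 * K * h\<^sup>2 * ((B\<^sup>2 + 1) powr (- 5 / 2) * h powr (- 5)) \<le> 3 * K * h\<^sup>2 * \<omega> x powr (- 5 / 2)"
        using K by (intro mult_left_mono) simp_all
      have "h\<^sup>2 * h powr (- 5) = h powr (-3)"
        using h powr_add[of h 2 "- 5"] by simp
      moreover have "(B\<^sup>2 + 1) powr (5 / 2) * (B\<^sup>2 + 1) powr (- 5 / 2) = 1"
        using B1 powr_add[of "B\<^sup>2 + 1" "5 / 2" "- 5 / 2"] by simp
      ultimately have "3 * K * h\<^sup>2 * ((B\<^sup>2 + 1) powr (- 5 / 2) * h powr (- 5)) = 3 * (A + 1) * h powr (-3)"
        unfolding K_def by (simp add: mult_ac)
      moreover have "2 * \<bar>f x\<bar> \<le> 3 * (A + 1) * h powr (-3)"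
      proof -
        have "2 * \<bar>f x\<bar> \<le> 2 * A * h powr (-3)" using elim by simp
        also have "\<dots> \<le> 3 * (A + 1) * h powr (-3)" using A by (intro mult_right_mono) simp_all
        finally show ?thesis .
      qed
      ultimately show ?thesis using le by (simp add: W)
    qed
  qed
  have W_pos: "W x > 0" for x unfolding W_def using K pos[of x] by simp
  have lap_neg: "laplacian W x < 0" for x unfolding W using K h pos[of x] by simp
  have u_le: "AE x in M. \<bar>u x\<bar> \<le> W x"
    by (rule comparison_abs[OF W(1) W_pos lap_neg f f_le])
  have lap_cont: "continuous_on UNIV (laplacian W)"
    by (rule smooth_continuous_on[OF smooth_laplacian[OF W(1)]])
  have f_sq: "square_integrable M f"
  proof (rule square_integrable_bound[OF continuous_square_integrable[OF lap_cont] f])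
    show "AE x in M. \<bar>f x\<bar> \<le> \<bar>laplacian W x\<bar>" using f_le by eventually_elim linarith
  qed
  have \<omega>_smooth: "smooth \<omega>" unfolding \<omega>_def by (rule smooth_shifted_square)
  have lap_\<omega>: "laplacian \<omega> x = 6" for x unfolding \<omega>_def laplacian_shifted_square dim by simp
  define I where "I = (\<integral>x. 1 / \<omega> x \<partial>M)"
  have c1: "continuous_on UNIV (\<lambda>x. 1 / \<omega> x)"
    using pos by (intro continuous_on_divide continuous_on_const smooth_continuous_on \<omega>_smooth)
      (metis less_irrefl)
  have I_int: "integrable M (\<lambda>x. 1 / \<omega> x)" by (rule continuous_integrable[OF c1])
  have W_sq: "(W x)\<^sup>2 = K\<^sup>2 * (1 / \<omega> x)" for x
  proof -
    have "(\<omega> x powr (- 1 / 2))\<^sup>2 = \<omega> x powr (- 1)"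
      using pos[of x] powr_add[of "\<omega> x" "- 1 / 2" "- 1 / 2"] by (simp add: power2_eq_square)
    also have "\<dots> = 1 / \<omega> x" using pos[of x] by (simp add: powr_minus_divide)
    finally show ?thesis unfolding W_def power_mult_distrib by (simp only:)
  qed
  have u2: "(\<integral>x. (u x)\<^sup>2 \<partial>M) \<le> K\<^sup>2 * I"
  proof -
    have "(\<integral>x. (u x)\<^sup>2 \<partial>M) \<le> (\<integral>x. K\<^sup>2 * (1 / \<omega> x) \<partial>M)"
    proof (rule integral_mono_AE)
      show "integrable M (\<lambda>x. (u x)\<^sup>2)" using u by (simp add: square_integrable_def)
      show "integrable M (\<lambda>x. K\<^sup>2 * (1 / \<omega> x))" by (rule integrable_mult_right[OF I_int])
      show "AE x in M. (u x)\<^sup>2 \<le> K\<^sup>2 * (1 / \<omega> x)"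
        using u_le
      proof eventually_elim
        case (elim x)
        then have "\<bar>u x\<bar>\<^sup>2 \<le> (W x)\<^sup>2" by (intro power_mono) simp_all
        then show ?case by (simp only: power2_abs W_sq)
      qed
    qed
    then show ?thesis unfolding I_def by (simp only: integral_mult_right_zero)
  qed
  have fu: "(\<integral>x. \<omega> x * f x * u x \<partial>M) \<le> 3 / 2 * (K\<^sup>2 * I)"
  proof -
    \<comment> \<open>\<open>|f| \<le> 3/2 K h\<^sup>2 \<omega>\<^sup>-\<^sup>5\<^sup>/\<^sup>2\<close>, \<open>|u| \<le> K \<omega>\<^sup>-\<^sup>1\<^sup>/\<^sup>2\<close> and \<open>h\<^sup>2 \<le> \<omega>\<close> leave the power \<open>-1\<close> of \<open>\<omega>\<close>.\<close>
    have fu_AE: "AE x in M. \<bar>\<omega> x * f x * u x\<bar> \<le> 3 / 2 * K\<^sup>2 * (1 / \<omega> x)"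
      using f_le u_le
    proof eventually_elim
      case (elim x)
      let ?p = "\<lambda>a. \<omega> x powr a"
      have "\<bar>f x\<bar> \<le> 3 / 2 * K * h\<^sup>2 * ?p (- 5 / 2)" using elim(1) by (simp add: W)
      also have "\<dots> \<le> 3 / 2 * K * \<omega> x * ?p (- 5 / 2)"
        using h_le[of x] K by (intro mult_right_mono mult_left_mono) simp_all
      finally have "\<bar>f x\<bar> * \<bar>u x\<bar> \<le> (3 / 2 * K * \<omega> x * ?p (- 5 / 2)) * (K * ?p (- 1 / 2))"
        using elim(2) K pos[of x] by (intro mult_mono) (simp_all add: W_def)
      then have "\<omega> x * (\<bar>f x\<bar> * \<bar>u x\<bar>) \<le> \<omega> x * ((3 / 2 * K * \<omega> x * ?p (- 5 / 2)) * (K * ?p (- 1 / 2)))"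
        using pos[of x] by (intro mult_left_mono) simp_all
      also have "\<dots> = 3 / 2 * K\<^sup>2 * (?p 1 * ?p 1 * ?p (- 5 / 2) * ?p (- 1 / 2))"
        using pos[of x] by (simp add: power2_eq_square mult_ac)
      also have "?p 1 * ?p 1 * ?p (- 5 / 2) * ?p (- 1 / 2) = 1 / \<omega> x"
        using pos[of x] unfolding powr_add[symmetric] by (simp add: powr_minus_divide)
      finally show ?case using pos[of x] by (simp add: abs_mult mult.assoc)
    qed
    have J_int: "integrable M (\<lambda>x. 3 / 2 * K\<^sup>2 * (1 / \<omega> x))" by (rule integrable_mult_right[OF I_int])
    have fu_int: "integrable M (\<lambda>x. \<omega> x * f x * u x)"
    proof (rule Bochner_Integration.integrable_bound[OF J_int])
      show "(\<lambda>x. \<omega> x * f x * u x) \<in> borel_measurable M"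
        using f u_measurable continuous_measurable[OF smooth_continuous_on[OF \<omega>_smooth]]
        by (intro borel_measurable_times)
      show "AE x in M. norm (\<omega> x * f x * u x) \<le> norm (3 / 2 * K\<^sup>2 * (1 / \<omega> x))"
        unfolding real_norm_def using fu_AE by eventually_elim (rule order_trans[OF _ abs_ge_self])
    qed
    have "AE x in M. \<omega> x * f x * u x \<le> 3 / 2 * K\<^sup>2 * (1 / \<omega> x)"
      using fu_AE by eventually_elim (rule order_trans[OF abs_ge_self])
    then have "(\<integral>x. \<omega> x * f x * u x \<partial>M) \<le> (\<integral>x. 3 / 2 * K\<^sup>2 * (1 / \<omega> x) \<partial>M)"
      by (rule integral_mono_AE[OF fu_int J_int])
    then show ?thesis unfolding I_def by (simp only: integral_mult_right_zero mult.assoc)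
  qed
  have I_le: "I \<le> 8 * unit_ball_vol 3 * (diameter U + 1)"
    unfolding I_def \<omega>_def by (rule inverse_shifted_square_integral_bound[OF dim U z h])
  have I_nonneg: "I \<ge> 0" unfolding I_def by (intro Bochner_Integration.integral_nonneg) (simp add: less_imp_le[OF pos])
  have "2 * (\<integral>x. norm (weak_grad U u x) \<partial>M) \<le> 6 / 2 * (\<integral>x. (u x)\<^sup>2 \<partial>M) + (\<integral>x. \<omega> x * f x * u x \<partial>M) + I"
    unfolding I_def by (rule weighted_gradient_estimate[OF \<omega>_smooth lap_\<omega> pos f_sq])
  also have "\<dots> \<le> 3 * (K\<^sup>2 * I) + 3 / 2 * (K\<^sup>2 * I) + I" using u2 fu by linarith
  also have "\<dots> \<le> 2 * ((5 * K\<^sup>2 + 1) * I)"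
    using I_nonneg mult_nonneg_nonneg[OF zero_le_power2[of K] I_nonneg] by (simp add: algebra_simps)
  finally have "(\<integral>x. norm (weak_grad U u x) \<partial>M) \<le> (5 * K\<^sup>2 + 1) * I" by simp
  also have "\<dots> \<le> (5 * K\<^sup>2 + 1) * (8 * unit_ball_vol 3 * (diameter U + 1))"
    using I_le by (intro mult_left_mono) simp_all
  finally show "(\<integral>x. norm (weak_grad U u x) \<partial>M)
      \<le> (5 * ((A + 1) * (B\<^sup>2 + 1) powr (5 / 2))\<^sup>2 + 1) * (8 * unit_ball_vol 3 * (diameter U + 1))"
    unfolding K_def .
qed

lemma epowr_1: "epowr x 1 = x"
  by (cases x) (simp_all add: epowr_def)

lemma Lp_norm_1_le:
  fixes g :: "'a::euclidean_space \<Rightarrow> 'b::euclidean_space"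
  assumes S: "S \<in> sets lebesgue" "T \<in> sets lebesgue" "S \<subseteq> T"
    and g: "g \<in> borel_measurable (lebesgue_on T)" "integrable (lebesgue_on T) (\<lambda>x. norm (g x))"
  shows "Lp_norm 1 S g \<le> ennreal (\<integral>x. norm (g x) \<partial>lebesgue_on T)"
proof -
  have "g \<in> borel_measurable (lebesgue_on S)" by (rule measurable_restrict_mono[OF g(1) S(3)])
  then have "Lp_norm 1 S g = (\<integral>\<^sup>+x. ennreal (norm (g x)) \<partial>lebesgue_on S)"
    by (simp add: Lp_norm_def epowr_1)
  also have "\<dots> = (\<integral>\<^sup>+x. ennreal (norm (g x)) * indicator S x \<partial>lebesgue)"
    using S by (intro nn_integral_restrict_space) simp
  also have "\<dots> \<le> (\<integral>\<^sup>+x. ennreal (norm (g x)) * indicator T x \<partial>lebesgue)"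
    using S(3) by (intro nn_integral_mono) (auto simp: indicator_def)
  also have "\<dots> = (\<integral>\<^sup>+x. ennreal (norm (g x)) \<partial>lebesgue_on T)"
    using S by (intro nn_integral_restrict_space[symmetric]) simp
  also have "\<dots> = ennreal (\<integral>x. norm (g x) \<partial>lebesgue_on T)"
    using g(2) by (intro nn_integral_eq_integral) simp_all
  finally show ?thesis .
qed

text \<open>The pointwise bound is the case \<open>p = \<infinity>\<close>, in which the exponent is \<open>-3\<close>. The maximum with \<open>0\<close> covers a
negative \<open>C\<close>, for which \<open>ennreal\<close> truncates the bound to \<open>0\<close>.\<close>

lemma regularized_delta_bounds:
  assumes \<delta>: "regularized_delta C \<T> h z \<delta>" and mesh: "tetrahedral_mesh \<T>"
    and D: "\<And>\<tau>. \<tau> \<in> \<T> \<Longrightarrow> diameter \<tau> \<le> D * h" and S: "S \<in> sets lebesgue"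
  shows "\<delta> \<in> borel_measurable (lebesgue_on S)"
    and "AE x in lebesgue_on S. \<bar>\<delta> x\<bar> \<le> max C 0 * h powr (-3)"
    and "\<delta> x \<noteq> 0 \<Longrightarrow> norm (x - z) \<le> D * h"
proof -
  obtain \<tau> where \<tau>: "\<tau> \<in> \<T>" "z \<in> \<tau>" "\<forall>x. x \<notin> \<tau> \<longrightarrow> \<delta> x = 0"
    and Lp: "\<forall>p\<ge>1. Lp_norm p \<tau> \<delta> \<le> ennreal (C * h powr (- 3 * (1 - enn2real (1 / p))))"
    using \<delta> unfolding regularized_delta_def by (elim bexE conjE)
  have "compact \<tau>" using mesh \<tau>(1) by (auto simp: tetrahedral_mesh_def intro: compact_simplex)
  then have \<tau>s: "\<tau> \<in> sets lebesgue" and \<tau>b: "bounded \<tau>"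
    by (auto intro: compact_imp_bounded fmeasurableD lmeasurable_compact)
  have inf: "Lp_norm \<infinity> \<tau> \<delta> \<le> ennreal (C * h powr (- 3))"
    using Lp[rule_format, of \<infinity>] by simp
  then have m: "\<delta> \<in> borel_measurable (lebesgue_on \<tau>)"
    by (auto simp: Lp_norm_def top_unique split: if_splits)
  have zero: "\<delta> x = 0" if "x \<notin> \<tau>" for x using \<tau>(3) that by simp
  have "(\<lambda>x. indicator \<tau> x *\<^sub>R \<delta> x) = \<delta>" using zero by (auto simp: indicator_def fun_eq_iff)
  with m \<tau>s have "\<delta> \<in> borel_measurable lebesgue"
    by (simp add: borel_measurable_restrict_space_iff)
  then show "\<delta> \<in> borel_measurable (lebesgue_on S)" by (rule measurable_restrict_space1)
  have le: "esssup (lebesgue_on \<tau>) (\<lambda>x. ennreal (norm (\<delta> x))) \<le> ennreal (C * h powr (- 3))"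
    using inf m by (simp add: Lp_norm_def)
  have "AE x in lebesgue_on \<tau>. ennreal (norm (\<delta> x)) \<le> ennreal (C * h powr (- 3))"
    using esssup_AE[of "\<lambda>x. ennreal (norm (\<delta> x))" "lebesgue_on \<tau>"]
    by eventually_elim (rule order_trans[OF _ le])
  then have "AE x in lebesgue. x \<in> \<tau> \<longrightarrow> ennreal (norm (\<delta> x)) \<le> ennreal (C * h powr (- 3))"
    using \<tau>s by (simp add: AE_restrict_space_iff)
  then have "AE x in lebesgue. \<bar>\<delta> x\<bar> \<le> max C 0 * h powr (-3)"
  proof eventually_elim
    case (elim x)
    show ?case
    proof (cases "x \<in> \<tau>")
      case True
      have "C * h powr (- 3) \<le> max C 0 * h powr (- 3)" by (intro mult_right_mono) simp_all
      then have "ennreal (norm (\<delta> x)) \<le> ennreal (max C 0 * h powr (- 3))"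
        using elim True ennreal_leI order_trans by blast
      then show ?thesis by (subst (asm) ennreal_le_iff) simp_all
    next
      case False
      then show ?thesis using zero[of x] by simp
    qed
  qed
  then have "AE x in lebesgue. x \<in> S \<longrightarrow> \<bar>\<delta> x\<bar> \<le> max C 0 * h powr (-3)"
    by eventually_elim simp
  then show "AE x in lebesgue_on S. \<bar>\<delta> x\<bar> \<le> max C 0 * h powr (-3)"
    using S by (simp add: AE_restrict_space_iff)
  assume "\<delta> x \<noteq> 0"
  then have "x \<in> \<tau>" using zero by blast
  then have "dist x z \<le> diameter \<tau>" using \<tau>(2) \<tau>b by (intro diameter_bounded_bound)
  with D[OF \<tau>(1)] show "norm (x - z) \<le> D * h" by (simp add: dist_norm)
qed

theorem lemma3p5:
  fixes \<Omega> :: "(real^3) set"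
    and \<T> :: "real \<Rightarrow> (real^3) set set"
    and \<delta> :: "real \<Rightarrow> real^3 \<Rightarrow> real^3 \<Rightarrow> real"
    and G :: "real \<Rightarrow> real^3 \<Rightarrow> real^3 \<Rightarrow> real"
  assumes "open \<Omega>" and "\<Omega> \<noteq> {}" and "bounded \<Omega>" and "convex \<Omega>" and "C_k_boundary 2 \<Omega>"
    and "\<And>h. 0 < h \<Longrightarrow> h < 1 \<Longrightarrow> tetrahedral_mesh (\<T> h) \<and> mesh_domain (\<T> h) \<subseteq> \<Omega>"
    and "shape_regular \<T>" and "quasi_uniform \<T>"
    and "\<exists>C. \<forall>h z. 0 < h \<and> h < 1 \<and> z \<in> mesh_domain (\<T> h) \<longrightarrow>
           regularized_delta C (\<T> h) h z (\<delta> h z)"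
    and "\<And>h z. 0 < h \<Longrightarrow> h < 1 \<Longrightarrow> z \<in> mesh_domain (\<T> h) \<Longrightarrow>
           solves_dirichlet_poisson \<Omega> (\<delta> h z) (G h z)"
  shows "\<exists>C::real. \<forall>h z. 0 < h \<and> h < 1 \<and> z \<in> mesh_domain (\<T> h) \<longrightarrow>
           Lp_norm 1 (mesh_domain (\<T> h)) (weak_grad \<Omega> (G h z)) \<le> ennreal C"
proof -
  obtain C where C: "\<forall>h z. 0 < h \<and> h < 1 \<and> z \<in> mesh_domain (\<T> h) \<longrightarrow>
      regularized_delta C (\<T> h) h z (\<delta> h z)"
    using assms(9) by (elim exE)
  obtain D where D: "\<forall>h\<in>{0<..<1}. \<forall>\<tau>\<in>\<T> h. diameter \<tau> \<le> D * h"
    using assms(8) unfolding quasi_uniform_def by blast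
  define E where "E = (5 * ((max C 0 + 1) * ((max D 1)\<^sup>2 + 1) powr (5 / 2))\<^sup>2 + 1)
      * (8 * unit_ball_vol 3 * (diameter \<Omega> + 1))"
  have "Lp_norm 1 (mesh_domain (\<T> h)) (weak_grad \<Omega> (G h z)) \<le> ennreal E"
    if h: "0 < h" "h < 1" and z: "z \<in> mesh_domain (\<T> h)" for h z
  proof -
    have mesh: "tetrahedral_mesh (\<T> h)" "mesh_domain (\<T> h) \<subseteq> \<Omega>" using assms(6)[OF h] by auto
    have \<Omega>s: "\<Omega> \<in> sets lebesgue" using assms(1) by simp
    have "diameter \<tau> \<le> max D 1 * h" if "\<tau> \<in> \<T> h" for \<tau>
    proof -
      have "diameter \<tau> \<le> D * h" using D h that by simp
      also have "\<dots> \<le> max D 1 * h" using h by (intro mult_right_mono) simp_all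
      finally show ?thesis .
    qed
    note \<delta> = regularized_delta_bounds[OF C[rule_format, OF conjI[OF h(1) conjI[OF h(2) z]]] mesh(1) this \<Omega>s]
    have sol: "solves_dirichlet_poisson \<Omega> (\<delta> h z) (G h z)" using assms(10)[OF h z] .
    have dim: "DIM(real^3) = 3" by simp
    have z\<Omega>: "z \<in> \<Omega>" using z mesh(2) by blast
    have max: "0 \<le> max C 0" "1 \<le> max D 1" by simp_all
    note bound = gradient_L1_bound[OF dim assms(1,3) sol z\<Omega> h(1) max \<delta>]
    have G: "G h z \<in> H1_0 \<Omega>" using sol by (simp add: solves_dirichlet_poisson_def)
    have "mesh_domain (\<T> h) \<in> sets lebesgue" by (simp add: mesh_domain_def)
    from Lp_norm_1_le[OF this \<Omega>s mesh(2) H1_0_square_integrable(3)[OF G] bound(1)]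
    have "Lp_norm 1 (mesh_domain (\<T> h)) (weak_grad \<Omega> (G h z))
        \<le> ennreal (\<integral>x. norm (weak_grad \<Omega> (G h z) x) \<partial>lebesgue_on \<Omega>)" .
    also have "\<dots> \<le> ennreal E" unfolding E_def by (rule ennreal_leI[OF bound(2)])
    finally show ?thesis .
  qed
  then show ?thesis by blast
qed

end
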